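(* Let $\chi$ be a primitive Dirichlet character modulo $q$ (with $q\ge3$), and let $n\ge0$ be an integer. Then $$\frac{\psi_\chi^{(n)}(1)}{n!}=\frac{\varphi(q)}{2\pi i q}\,\frac{(-1)^n}{n+1}+\mathscr{B}_\chi(n)+(-1)^n\sum_{j=0}^n\binom nj\mathscr{B}_{\overline\chi}(j),$$ where, for a primitive character $\chi$ modulo $q$ and an integer $j\ge 0$, $$\mathscr{B}_\chi(j)=\frac{(2\pi i q)^j}{\tau(\chi)\,(j+1)\,(j+1)!}\sum_{1\le a,b\le q}B_{j+1}\left(\tfrac aq\right)B_{j+1}\left(\tfrac bq\right)\chi(ab)\,\xi^{ab}.$$
   Context: $e(z)=e^{2\pi i z}$, $\xi=e^{2\pi i/q}$; $\tau(\chi)=\sum_{a=1}^{q-1}\chi(a)\xi^a$ is the Gauss sum; $\varphi$ is Euler's totient function; $d(n)$ is the number of divisors of $n$; $B_k(\cdot)$ is the $k$-th Bernoulli polynomial; $\overline\chi$ is the complex conjugate character. For $\mathrm{Im}(z)>0$ define $$E_\chi(z)=\frac1{\tau(\chi)}\sum_{n=1}^\infty\chi(n)d(n)e(nz/q),\qquad \psi_\chi(z)=E_\chi(z)-\frac{\chi(-1)}{z}E_{\overline\chi}\left(-\frac1z\right).$$ The function $\psi_\chi$ has an analytic continuation to $\mathbb{C}\setminus(-\infty,0]$, still denoted $\psi_\chi$; $\psi_\chi^{(n)}(1)$ is the $n$-th derivative of this continuation at $1$. *)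

theory Defs
  imports "HOL-Analysis.Analysis" "HOL-Number_Theory.Totient"
begin

definition dirichlet_character :: "nat \<Rightarrow> (int \<Rightarrow> complex) \<Rightarrow> bool" where
  "dirichlet_character q chi \<longleftrightarrow>
     q > 0 \<and>
     (\<forall>m n. chi (m * n) = chi m * chi n) \<and>
     (\<forall>n. chi (n + int q) = chi n) \<and>
     (\<forall>n. chi n \<noteq> 0 \<longleftrightarrow> coprime n (int q))"

(* Primitive: not induced by a character modulo a proper divisor of q. *)
definition primitive_character :: "nat \<Rightarrow> (int \<Rightarrow> complex) \<Rightarrow> bool" where
  "primitive_character q chi \<longleftrightarrow>
     dirichlet_character q chi \<and>
     \<not> (\<exists>d chi'. d dvd q \<and> d < q \<and> dirichlet_character d chi' \<and>
            (\<forall>n. coprime n (int q) \<longrightarrow> chi n = chi' n))"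

definition conj_character :: "(int \<Rightarrow> complex) \<Rightarrow> int \<Rightarrow> complex" where
  "conj_character chi = (\<lambda>n. cnj (chi n))"

definition expi :: "complex \<Rightarrow> complex" where
  "expi z = exp (2 * of_real pi * \<i> * z)"

definition root_xi :: "nat \<Rightarrow> complex" where
  "root_xi q = expi (1 / of_nat q)"

definition gauss_sum :: "nat \<Rightarrow> (int \<Rightarrow> complex) \<Rightarrow> complex" where
  "gauss_sum q chi = (\<Sum>a = 1..q - 1. chi (int a) * root_xi q ^ a)"

definition divisor_count :: "nat \<Rightarrow> nat" where
  "divisor_count n = card {d. d dvd n}"

(* Generating function: t exp(xt) / (exp(t) - 1) = (SUM n. B_n(x) t^n / n!). *)
definition bernoulli_poly :: "nat \<Rightarrow> 'a :: field_char_0 \<Rightarrow> 'a" where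
  "bernoulli_poly n x = fact n * fps_nth (fps_X * fps_exp x / (fps_exp 1 - 1)) n"

definition E_chi :: "nat \<Rightarrow> (int \<Rightarrow> complex) \<Rightarrow> complex \<Rightarrow> complex" where
  "E_chi q chi z = 1 / gauss_sum q chi *
     (\<Sum>\<^sub>\<infinity>n\<in>{1..}. chi (int n) * of_nat (divisor_count n) * expi (of_nat n * z / of_nat q))"

(* Meaningful only for Im z > 0. *)
definition psi_upper :: "nat \<Rightarrow> (int \<Rightarrow> complex) \<Rightarrow> complex \<Rightarrow> complex" where
  "psi_upper q chi z = E_chi q chi z - chi (- 1) / z * E_chi q (conj_character chi) (- (1 / z))"

(* The slit plane is connected and open, so the continuation is unique there; its values on the
   slit, which the choice operator leaves open, do not affect derivatives at points of the slit
   plane. *)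
definition psi_chi :: "nat \<Rightarrow> (int \<Rightarrow> complex) \<Rightarrow> complex \<Rightarrow> complex" where
  "psi_chi q chi = (SOME f. f holomorphic_on (- \<real>\<^sub>\<le>\<^sub>0) \<and>
                        (\<forall>z. Im z > 0 \<longrightarrow> f z = psi_upper q chi z))"

definition B_chi :: "nat \<Rightarrow> (int \<Rightarrow> complex) \<Rightarrow> nat \<Rightarrow> complex" where
  "B_chi q chi j =
     (2 * of_real pi * \<i> * of_nat q) ^ j / (gauss_sum q chi * of_nat (j + 1) * fact (j + 1)) *
     (\<Sum>a = 1..q. \<Sum>b = 1..q.
        bernoulli_poly (j + 1) (of_nat a / of_nat q) * bernoulli_poly (j + 1) (of_nat b / of_nat q) *
        chi (int (a * b)) * root_xi q ^ (a * b))"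

end

theory Submission
  imports Defs "HOL-Number_Theory.Residues" "HOL-Complex_Analysis.Complex_Analysis"
begin

text \<open>
  Everything is governed by \<open>F(u) = \<Sum>n\<ge>1. \<chi>(n) e^(-n u)\<close>, continued to a meromorphic function \<open>char_gf\<close>.
  Since \<open>\<chi>\<close> is primitive, Gauss sums (\<open>gauss_sum_twist\<close>) make \<open>F\<close> a finite combination of the functions
  \<open>1 / (e^u \<xi>^(-k) - 1)\<close>. Hence \<open>F\<close> has period \<open>2\<pi>i\<close>, is even or odd, is regular at 0, decays like
  \<open>e^(-|Re u|)\<close>, and has simple poles at \<open>2\<pi>i k/q\<close> whose residues are proportional to the values of the
  conjugate character. Write \<open>G\<close> for the same function of the conjugate character.

  Up to a constant, the partial fraction expansion of \<open>F\<close> turns \<open>E\<^sub>\<chi>(z)\<close> into the conditionally convergent sum of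
  \<open>\<chi>(m) cnj(\<chi>(k)) / (m z + k)\<close> over \<open>m \<ge> 1\<close> and all integers \<open>k\<close>. In \<open>\<psi>\<^sub>\<chi>\<close> the terms with \<open>k < 0\<close> cancel
  and those with \<open>k > 0\<close> appear twice, so that \<open>\<psi>\<^sub>\<chi>(z) = \<chi>(-1) (i/\<pi>) L(z)\<close> (\<open>psi_upper_eq\<close>), where \<open>L\<close>
  (\<open>lattice_limit\<close>) is the sum over \<open>m, k \<ge> 1\<close>. Summing over whole periods and writing each term as an integral of an
  exponential gives \<open>L(z) = w \<integral> F(z w t) G(w t) dt\<close> over \<open>t > 0\<close>, for any \<open>w\<close> with \<open>Re w > 0\<close> and
  \<open>Re (z w) > 0\<close>. On the slit plane \<open>w = 1/\<surd>z\<close> is admissible, the convergence is locally uniform there, and \<open>L\<close>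
  is the continuation (\<open>lattice_limit_holomorphic\<close>, \<open>psi_chi_eq\<close>).

  With \<open>w = 1\<close> and parity, \<open>L(z)\<close> is half of the integral of \<open>F(z t) G(t)\<close> over the whole
  real line. Its \<open>n\<close>-th Taylor coefficient at 1 is therefore half of the coefficient of \<open>s^n\<close> in
  \<open>A(s) = \<integral> t^n F(t + s) G(t) dt\<close>, because both come
  from the integral of \<open>t^n F^(n)(t) G(t) / n!\<close>, where \<open>F^(n)\<close> is the \<open>n\<close>-th derivative (\<open>psi_chi_taylor\<close>).
  The shift by \<open>s\<close> separates the poles of the two factors. As these are \<open>2\<pi>i\<close>-periodic, the residue theorem on
  a rectangle of height \<open>2\<pi>\<close> evaluates \<open>A(s)\<close> once \<open>t^n\<close> is written as a difference \<open>P(t + 2\<pi>i) - P(t)\<close>, and a rescaled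
  Bernoulli polynomial \<open>P\<close> does this (\<open>moment_integral_residues\<close>). At its poles the expansion of \<open>F\<close> in \<open>s\<close> has
  Bernoulli polynomials as coefficients too, which is where the products \<open>B_j(a/q) B_j(b/q)\<close> come from. The poles of \<open>G(t)\<close>
  contribute the value of \<open>B_chi\<close> at \<open>n\<close>. At the poles of \<open>F(t + s)\<close> the polynomial \<open>P\<close> is evaluated at points
  shifted by \<open>-s\<close>; its binomial expansion yields the sum over \<open>j\<close>, and the products with \<open>B_0 = 1\<close>
  yield the term with \<open>\<phi>(q)\<close>.
\<close>

section \<open>Characters and Gauss sums\<close>

lemma primitive_character_imp_dirichlet:
  "primitive_character q chi \<Longrightarrow> dirichlet_character q chi"
  by (simp add: primitive_character_def)

context
  fixes q :: nat and chi :: "int \<Rightarrow> complex"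
  assumes chi: "dirichlet_character q chi"
begin

lemma dirichlet_modulus_pos: "q > 0"
  and dirichlet_mult: "chi (m * n) = chi m * chi n"
  and dirichlet_eq_0_iff: "chi n = 0 \<longleftrightarrow> \<not> coprime n (int q)"
  using chi by (auto simp: dirichlet_character_def)

lemma dirichlet_periodic: "chi (n + int q * k) = chi n"
proof -
  have step: "chi (m + int q) = chi m" for m
    using chi by (simp add: dirichlet_character_def)
  have nonneg: "chi (m + int q * int j) = chi m" for m j
  proof (induction j)
    case (Suc j)
    then show ?case
      using step[of "m + int q * int j"] by (simp add: algebra_simps)
  qed simp
  show ?thesis
  proof (cases "k \<ge> 0")
    case True
    then show ?thesis using nonneg[of n "nat k"] by simp
  next
    case False
    then show ?thesis using nonneg[of "n + int q * k" "nat (- k)"] by (simp add: algebra_simps)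
  qed
qed

lemma dirichlet_cong: "[m = n] (mod int q) \<Longrightarrow> chi m = chi n"
  using dirichlet_periodic[of m] by (auto simp: cong_iff_lin)

lemma dirichlet_1: "chi 1 = 1"
  using dirichlet_mult[of 1 1] dirichlet_eq_0_iff[of 1] by simp

lemma dirichlet_power: "chi (n ^ k) = chi n ^ k"
  by (induction k) (auto simp: dirichlet_1 dirichlet_mult)

lemma dirichlet_minus: "chi (- n) = chi (- 1) * chi n"
  using dirichlet_mult[of "- 1" n] by simp

lemma dirichlet_minus_1_square: "chi (- 1) * chi (- 1) = 1"
  using dirichlet_mult[of "- 1" "- 1"] dirichlet_1 by simp

lemma norm_dirichlet: "norm (chi n) = (if coprime n (int q) then 1 else 0)"
proof (cases "coprime n (int q)")
  case True
  define m where "m = nat (n mod int q)"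
  have m: "[int m = n] (mod int q)"
    using dirichlet_modulus_pos by (simp add: m_def cong_def)
  have "coprime m q"
    using True cong_imp_coprime[OF cong_sym[OF m]] by simp
  then have "[m ^ totient q = 1] (mod q)"
    by (rule euler_theorem)
  then have "[int m ^ totient q = 1] (mod int q)"
    using cong_int_iff[of "m ^ totient q" 1 q] by simp
  then have "chi (int m) ^ totient q = 1"
    unfolding dirichlet_power[symmetric] using dirichlet_1 dirichlet_cong by simp
  then have "norm (chi n) ^ totient q = 1"
    unfolding dirichlet_cong[OF m, symmetric] norm_power[symmetric] by simp
  moreover have "totient q > 0"
    using dirichlet_modulus_pos by simp
  ultimately show ?thesis
    using True power_eq_imp_eq_base[of "norm (chi n)" "totient q" 1] by simp
qed (simp add: dirichlet_eq_0_iff)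

lemma norm_dirichlet_le: "norm (chi n) \<le> 1"
  by (simp add: norm_dirichlet)

lemma dirichlet_mult_cnj: "chi n * cnj (chi n) = (if coprime n (int q) then 1 else 0)"
  by (simp add: norm_dirichlet flip: complex_norm_square)

lemma dirichlet_minus_1_real: "cnj (chi (- 1)) = chi (- 1)"
proof -
  have "chi (- 1) * cnj (chi (- 1)) = chi (- 1) * chi (- 1)"
    by (simp add: dirichlet_mult_cnj dirichlet_minus_1_square)
  then show ?thesis
    using dirichlet_minus_1_square by (metis mult_cancel_left zero_neq_one mult_zero_left)
qed

end

lemma dirichlet_character_conj:
  "dirichlet_character q chi \<Longrightarrow> dirichlet_character q (conj_character chi)"
  by (simp add: dirichlet_character_def conj_character_def)

lemma conj_conj_character [simp]: "conj_character (conj_character chi) = chi"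
  by (simp add: conj_character_def)

lemma primitive_character_conj:
  assumes "primitive_character q chi"
  shows "primitive_character q (conj_character chi)"
proof -
  have "\<exists>d chi'. d dvd q \<and> d < q \<and> dirichlet_character d chi' \<and>
            (\<forall>n. coprime n (int q) \<longrightarrow> chi n = chi' n)"
    if "d dvd q" "d < q" "dirichlet_character d chi'"
       "\<forall>n. coprime n (int q) \<longrightarrow> conj_character chi n = chi' n" for d chi'
  proof (intro exI conjI allI impI)
    show "dirichlet_character d (conj_character chi')"
      using that by (intro dirichlet_character_conj)
    show "chi n = conj_character chi' n" if "coprime n (int q)" for n
    proof -
      have "cnj (chi n) = chi' n"
        using that \<open>\<forall>n. coprime n (int q) \<longrightarrow> conj_character chi n = chi' n\<close>
        by (simp add: conj_character_def)
      then show ?thesis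
        unfolding conj_character_def by (metis complex_cnj_cnj)
    qed
  qed (use that in auto)
  then show ?thesis
    using assms dirichlet_character_conj unfolding primitive_character_def by blast
qed

text \<open>Add to \<open>n\<close> the product of \<open>d\<close> and all primes of \<open>q\<close> that do not divide \<open>n\<close>: a prime of \<open>q\<close> then
  divides exactly one of the two summands.\<close>
lemma exists_coprime_lift:
  fixes n :: int and d q :: nat
  assumes "coprime n (int d)" "d dvd q" "q > 0"
  shows "\<exists>m. coprime m (int q) \<and> [m = n] (mod int d)"
proof -
  define t where "t = (\<Prod>p\<in>{p\<in>prime_factors (int q). \<not> p dvd n}. p)"
  have "coprime (n + int d * t) (int q)"
  proof (rule ccontr)
    assume "\<not> coprime (n + int d * t) (int q)"
    then obtain c where c: "c dvd n + int d * t" "c dvd int q" "\<not> is_unit c"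
      by (rule not_coprimeE)
    moreover have "c \<noteq> 0"
      using c(2) assms(3) by auto
    ultimately obtain p where "prime p" "p dvd c"
      using prime_divisor_exists by blast
    with c have p: "prime p" "p dvd n + int d * t" "p dvd int q"
      by (auto intro: dvd_trans)
    show False
    proof (cases "p dvd n")
      case True
      then have "p dvd int d * t"
        using p(2) by (simp add: dvd_add_right_iff)
      moreover have "\<not> p dvd int d"
        using True assms(1) p(1) by (meson coprime_common_divisor not_prime_unit)
      ultimately have "p dvd t"
        using p(1) by (simp add: prime_dvd_mult_iff)
      then obtain p' where "p' \<in> prime_factors (int q)" "\<not> p' dvd n" "p dvd p'"
        using p(1) by (auto simp: t_def prime_dvd_prod_iff)
      then show False
        using True p(1) by (metis in_prime_factors_iff primes_dvd_imp_eq)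
    next
      case False
      then have "p dvd t"
        using p assms(3) by (auto simp: t_def in_prime_factors_iff intro!: dvd_prodI)
      then show False
        using p(2) False by (simp add: dvd_add_left_iff)
    qed
  qed
  then show ?thesis
    by (intro exI[of _ "n + int d * t"]) (auto simp: cong_def)
qed

text \<open>Otherwise \<open>\<chi>\<close> would take the same value at all units modulo \<open>q\<close> in a given residue class modulo \<open>d\<close>, and so be
  induced by the character modulo \<open>d\<close> that assigns to \<open>n\<close> the value of \<open>\<chi>\<close> at any lift of \<open>n\<close> to a unit modulo \<open>q\<close>.\<close>
lemma primitive_character_not_trivial_on_kernel:
  assumes prim: "primitive_character q chi" and d: "d dvd q" "d < q"
  shows "\<exists>c. coprime c (int q) \<and> [c = 1] (mod int d) \<and> chi c \<noteq> 1"
proof (rule ccontr)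
  assume "\<not> ?thesis"
  then have triv: "chi c = 1" if "coprime c (int q)" "[c = 1] (mod int d)" for c
    using that by blast
  note dc = primitive_character_imp_dirichlet[OF prim]
  have q: "q > 0" and d0: "d > 0"
    using dirichlet_modulus_pos[OF dc] d by (auto intro: Nat.gr0I)
  have welldef: "chi m = chi m'"
    if "coprime m (int q)" "coprime m' (int q)" "[m = m'] (mod int d)" for m m'
  proof -
    from cong_solve_coprime_int[OF that(2)] obtain x where x: "[m' * x = 1] (mod int q)"
      by auto
    have x_d: "[m' * x = 1] (mod int d)"
      using x d(1) by (meson cong_dvd_modulus int_dvd_int_iff)
    have m_d: "[m * x = 1] (mod int d)"
      using cong_trans[OF cong_scalar_right[OF that(3)] x_d] .
    have cx: "coprime x (int q)"
      using x by (metis cong_imp_coprime cong_sym coprime_1_left coprime_mult_left_iff)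
    have "chi m * chi x = 1" "chi m' * chi x = 1"
      using triv[of "m * x"] triv[of "m' * x"] m_d x_d cx that
      by (simp_all add: dirichlet_mult[OF dc])
    then show ?thesis
      by (metis mult.commute mult.left_neutral mult.assoc)
  qed
  define rep where "rep n = (SOME m. coprime m (int q) \<and> [m = n] (mod int d))" for n
  have rep: "coprime (rep n) (int q)" "[rep n = n] (mod int d)" if "coprime n (int d)" for n
    using someI_ex[OF exists_coprime_lift[OF that d(1) q]] by (auto simp: rep_def)
  define chi' where "chi' n = (if coprime n (int d) then chi (rep n) else 0)" for n
  have chi'_eq: "chi' n = chi m" if "coprime m (int q)" "[m = n] (mod int d)" for m n
  proof -
    have "coprime m (int d)"
      using that(1) d(1) by (meson coprime_divisors dvd_refl int_dvd_int_iff)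
    then have "coprime n (int d)"
      using that(2) cong_imp_coprime by blast
    then show ?thesis
      using welldef[OF that(1) rep(1)[of n]] rep(2)[of n] that(2)
      by (simp add: chi'_def cong_def)
  qed
  have "dirichlet_character d chi'"
    unfolding dirichlet_character_def
  proof (intro conjI allI)
    fix m n
    show "chi' (m * n) = chi' m * chi' n"
    proof (cases "coprime m (int d) \<and> coprime n (int d)")
      case True
      then have "chi' (m * n) = chi (rep m * rep n)"
        by (intro chi'_eq) (auto simp: rep intro!: cong_mult)
      then show ?thesis
        using True by (simp add: chi'_def dirichlet_mult[OF dc])
    qed (auto simp: chi'_def)
    show "chi' (n + int d) = chi' n"
    proof (cases "coprime n (int d)")
      case True
      then have "chi' (n + int d) = chi (rep n)"
        using rep[OF True] by (intro chi'_eq) (auto simp: cong_def)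
      then show ?thesis
        using True by (simp add: chi'_def)
    qed (simp add: chi'_def coprime_iff_gcd_eq_1)
    show "(chi' n \<noteq> 0) = coprime n (int d)"
      using rep(1)[of n] by (simp add: chi'_def dirichlet_eq_0_iff[OF dc])
  qed (use d0 in auto)
  moreover have "\<forall>n. coprime n (int q) \<longrightarrow> chi n = chi' n"
    using chi'_eq by (metis cong_refl)
  ultimately show False
    using prim d by (auto simp: primitive_character_def)
qed

text \<open>Powers of \<open>\<xi>\<close> with integer exponents, so that residues can be negated and reduced.\<close>
definition add_char :: "nat \<Rightarrow> int \<Rightarrow> complex" where
  "add_char q k = expi (of_int k / of_nat q)"

lemma add_char_add: "add_char q (m + n) = add_char q m * add_char q n"
  by (simp add: add_char_def expi_def add_divide_distrib ring_distribs exp_add)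

lemma add_char_0 [simp]: "add_char q 0 = 1"
  by (simp add: add_char_def expi_def)

lemma add_char_minus: "add_char q (- n) = inverse (add_char q n)"
  by (simp add: add_char_def expi_def exp_minus)

lemma add_char_neq_0 [simp]: "add_char q n \<noteq> 0"
  by (simp add: add_char_def expi_def)

lemma norm_add_char [simp]: "norm (add_char q n) = 1"
  by (simp add: add_char_def expi_def norm_exp_eq_Re)

lemma add_char_power: "add_char q n ^ k = add_char q (n * int k)"
  by (induction k) (auto simp: add_char_add algebra_simps)

lemma root_xi_power: "root_xi q ^ n = add_char q (int n)"
proof -
  have "root_xi q = add_char q 1"
    by (simp add: root_xi_def add_char_def)
  then show ?thesis
    by (simp add: add_char_power)
qed

lemma add_char_eq_1_iff:
  assumes "q > 0"
  shows "add_char q n = 1 \<longleftrightarrow> int q dvd n"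
proof -
  have "add_char q n = 1 \<longleftrightarrow> (\<exists>k. 2 * pi * of_int n / of_nat q = of_int (2 * k) * pi)"
    by (simp add: add_char_def expi_def exp_eq_1 mult.assoc)
  also have "\<dots> \<longleftrightarrow> (\<exists>k. real_of_int n = real_of_int (int q * k))"
    using assms by (intro ex_cong1) (auto simp: field_simps)
  also have "\<dots> \<longleftrightarrow> int q dvd n"
    by (auto simp: dvd_def simp del: of_int_mult)
  finally show ?thesis .
qed

lemma add_char_cong:
  assumes "q > 0" "[m = n] (mod int q)"
  shows "add_char q m = add_char q n"
proof -
  have "add_char q (m - n) = 1"
    using assms by (simp add: add_char_eq_1_iff cong_iff_dvd_diff)
  then show ?thesis
    using add_char_add[of q "m - n" n] by simp
qed

lemma sum_mod_reindex:
  fixes f :: "int \<Rightarrow> 'a :: comm_monoid_add"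
  assumes "q > 0" "coprime c (int q)" "\<And>m n. [m = n] (mod int q) \<Longrightarrow> f m = f n"
  shows "(\<Sum>k\<in>{0..<int q}. f (c * k)) = (\<Sum>k\<in>{0..<int q}. f k)"
proof -
  have inj: "inj_on (\<lambda>k. (c * k) mod int q) {0..<int q}"
  proof
    fix x y assume "x \<in> {0..<int q}" "y \<in> {0..<int q}" "(c * x) mod int q = (c * y) mod int q"
    then show "x = y"
      using assms(2) by (metis atLeastLessThan_iff cong_def cong_less_imp_eq_int cong_mult_lcancel)
  qed
  have "(\<lambda>k. (c * k) mod int q) ` {0..<int q} = {0..<int q}"
    using assms(1) by (intro endo_inj_surj inj) auto
  with inj have "bij_betw (\<lambda>k. (c * k) mod int q) {0..<int q} {0..<int q}"
    by (simp add: bij_betw_def)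
  from sum.reindex_bij_betw[OF this, of f] show ?thesis
    using assms(3)[of "_ mod int q"] by (simp add: cong_def)
qed

lemma sum_add_char:
  assumes "q > 0"
  shows "(\<Sum>k\<in>{0..<int q}. add_char q (n * k)) = (if int q dvd n then of_nat q else 0)"
proof (cases "int q dvd n")
  case True
  then have "add_char q (n * k) = 1" for k
    using assms by (simp add: add_char_eq_1_iff)
  then show ?thesis
    using True by simp
next
  case False
  have "(\<Sum>k\<in>{0..<int q}. add_char q (n * k)) = (\<Sum>k<q. add_char q n ^ k)"
    by (rule sum.reindex_bij_witness[of _ int nat]) (auto simp: add_char_power)
  also have "\<dots> = (1 - add_char q n ^ q) / (1 - add_char q n)"
    using False assms by (simp add: sum_gp_strict add_char_eq_1_iff)
  also have "add_char q n ^ q = 1"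
    using assms by (simp add: add_char_power add_char_eq_1_iff)
  finally show ?thesis
    using False by simp
qed

lemma sum_dirichlet_int_nat:
  assumes "dirichlet_character q chi" "q > 1"
  shows "(\<Sum>k\<in>{0..<int q}. chi k * f k) = (\<Sum>k=1..q-1. chi (int k) * f (int k))"
proof -
  have "chi 0 = 0"
    using assms by (simp add: dirichlet_eq_0_iff)
  then have "(\<Sum>k\<in>{0..<int q}. chi k * f k) = (\<Sum>k\<in>{1..<int q}. chi k * f k)"
  proof (intro sum.mono_neutral_right ballI)
    fix k assume "chi 0 = 0" "k \<in> {0..<int q} - {1..<int q}"
    moreover from this have "k = 0" by auto
    ultimately show "chi k * f k = 0" by simp
  qed auto
  also have "\<dots> = (\<Sum>k=1..q-1. chi (int k) * f (int k))"
    by (rule sum.reindex_bij_witness[of _ int nat]) auto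
  finally show ?thesis .
qed

lemma gauss_sum_alt:
  assumes "dirichlet_character q chi" "q > 1"
  shows "gauss_sum q chi = (\<Sum>k\<in>{0..<int q}. chi k * add_char q k)"
  by (simp add: sum_dirichlet_int_nat[OF assms] gauss_sum_def root_xi_power)

text \<open>If \<open>n\<close> is a unit, substitute \<open>n k\<close> for \<open>k\<close>. Otherwise primitivity provides a unit \<open>c\<close> with \<open>\<chi>(c) \<noteq> 1\<close> and
  \<open>c \<equiv> 1\<close> modulo \<open>q / gcd(n, q)\<close>. Multiplication by \<open>c\<close> permutes the residues and leaves \<open>\<xi>^(k n)\<close> unchanged,
  so the sum equals \<open>\<chi>(c)\<close> times itself and vanishes.\<close>
lemma gauss_sum_twist:
  assumes prim: "primitive_character q chi" and q: "q > 1"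
  shows "(\<Sum>k\<in>{0..<int q}. chi k * add_char q (k * n)) = cnj (chi n) * gauss_sum q chi"
proof -
  note dc = primitive_character_imp_dirichlet[OF prim]
  have q0: "q > 0" using q by simp
  show ?thesis
  proof (cases "coprime n (int q)")
    case True
    have "chi n * (\<Sum>k\<in>{0..<int q}. chi k * add_char q (k * n)) =
          (\<Sum>k\<in>{0..<int q}. chi (n * k) * add_char q (n * k))"
      by (simp add: dirichlet_mult[OF dc] sum_distrib_left mult_ac)
    also have "\<dots> = (\<Sum>k\<in>{0..<int q}. chi k * add_char q k)"
      using q0 True
      by (rule sum_mod_reindex[where f = "\<lambda>k. chi k * add_char q k"])
         (simp add: add_char_cong[OF q0] dirichlet_cong[OF dc])
    also have "\<dots> = gauss_sum q chi"
      by (simp add: gauss_sum_alt[OF dc q])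
    finally have "chi n * (\<Sum>k\<in>{0..<int q}. chi k * add_char q (k * n)) = gauss_sum q chi" .
    then have "(chi n * cnj (chi n)) * (\<Sum>k\<in>{0..<int q}. chi k * add_char q (k * n)) =
               cnj (chi n) * gauss_sum q chi"
      by (simp add: mult_ac)
    then show ?thesis
      using True by (simp add: dirichlet_mult_cnj[OF dc])
  next
    case False
    define g where "g = nat (gcd n (int q))"
    define d where "d = q div g"
    have g: "int g = gcd n (int q)" by (simp add: g_def)
    have "g > 0" using q0 by (simp add: g_def)
    moreover have "g \<noteq> 1" using False g by (metis coprime_iff_gcd_eq_1 of_nat_1)
    ultimately have g1: "g > 1" by simp
    have gq: "g dvd q" using g by (metis gcd_dvd2 int_dvd_int_iff)
    have gn: "int g dvd n" using g by simp
    have dg: "q = d * g" using gq by (simp add: d_def)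
    have d: "d dvd q" "d < q" using dg g1 q0 by auto
    obtain c where c: "coprime c (int q)" "[c = 1] (mod int d)" "chi c \<noteq> 1"
      using primitive_character_not_trivial_on_kernel[OF prim d] by blast
    \<comment> \<open>the modulus \<open>d = q / g\<close> is chosen such that \<open>d g\<close> divides \<open>(c - 1) n\<close>\<close>
    have cn: "[c * n = n] (mod int q)"
    proof -
      have "int d * int g dvd (c - 1) * n"
        using c(2) gn by (intro mult_dvd_mono) (auto simp: cong_iff_dvd_diff)
      then show ?thesis
        by (simp add: cong_iff_dvd_diff dg algebra_simps)
    qed
    define S where "S = (\<Sum>k\<in>{0..<int q}. chi k * add_char q (k * n))"
    have "chi c * S = (\<Sum>k\<in>{0..<int q}. chi (c * k) * add_char q (k * n))"
      by (simp add: S_def dirichlet_mult[OF dc] sum_distrib_left mult_ac)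
    also have "\<dots> = (\<Sum>k\<in>{0..<int q}. chi (c * k) * add_char q ((c * k) * n))"
    proof (intro sum.cong refl)
      fix k
      have "[k * n = (c * k) * n] (mod int q)"
        using cong_scalar_left[OF cong_sym[OF cn], of k] by (simp add: mult_ac)
      then show "chi (c * k) * add_char q (k * n) = chi (c * k) * add_char q ((c * k) * n)"
        using add_char_cong[OF q0] by metis
    qed
    also have "\<dots> = S"
      unfolding S_def using q0 c(1)
      by (rule sum_mod_reindex[where f = "\<lambda>k. chi k * add_char q (k * n)"])
         (metis add_char_cong[OF q0] dirichlet_cong[OF dc] cong_scalar_right)
    finally have "S = 0"
      using c(3) by simp
    then show ?thesis
      using False by (simp add: S_def dirichlet_eq_0_iff[OF dc])
  qed
qed

text \<open>Multiply the formula for the twisted sum by \<open>\<xi>^n\<close> and sum over \<open>n\<close>: by orthogonality only \<open>k = -1\<close> survives.\<close>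
lemma gauss_sum_mult_conj:
  assumes prim: "primitive_character q chi" and q: "q > 1"
  shows "gauss_sum q chi * gauss_sum q (conj_character chi) = chi (- 1) * of_nat q"
proof -
  note dc = primitive_character_imp_dirichlet[OF prim]
  have q0: "q > 0" using q by simp
  have "gauss_sum q chi * gauss_sum q (conj_character chi) =
        (\<Sum>n\<in>{0..<int q}. (cnj (chi n) * gauss_sum q chi) * add_char q n)"
    unfolding gauss_sum_alt[OF dirichlet_character_conj[OF dc] q] sum_distrib_left
    by (intro sum.cong) (auto simp: conj_character_def)
  also have "\<dots> = (\<Sum>n\<in>{0..<int q}. \<Sum>k\<in>{0..<int q}. chi k * add_char q ((k + 1) * n))"
    by (simp add: gauss_sum_twist[OF prim q, symmetric] sum_distrib_left sum_distrib_right
                  add_char_add ring_distribs mult_ac)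
  also have "\<dots> = (\<Sum>k\<in>{0..<int q}. chi k * (\<Sum>n\<in>{0..<int q}. add_char q ((k + 1) * n)))"
    by (subst sum.swap) (simp add: sum_distrib_left)
  also have "\<dots> = (\<Sum>k\<in>{0..<int q}. if k = int q - 1 then chi (int q - 1) * of_nat q else 0)"
  proof (intro sum.cong refl)
    fix k assume "k \<in> {0..<int q}"
    then have "int q dvd k + 1 \<longleftrightarrow> k = int q - 1"
      by (auto dest: zdvd_imp_le)
    then show "chi k * (\<Sum>n\<in>{0..<int q}. add_char q ((k + 1) * n)) =
               (if k = int q - 1 then chi (int q - 1) * of_nat q else 0)"
      by (subst sum_add_char[OF q0]) auto
  qed
  also have "\<dots> = chi (int q - 1) * of_nat q"
    using q by simp
  also have "chi (int q - 1) = chi (- 1)"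
    by (rule dirichlet_cong[OF dc]) (simp add: cong_def)
  finally show ?thesis .
qed

lemma gauss_sum_neq_0:
  assumes "primitive_character q chi" "q > 1"
  shows "gauss_sum q chi \<noteq> 0"
  using gauss_sum_mult_conj[OF assms] assms(2)
        dirichlet_minus_1_square[OF primitive_character_imp_dirichlet[OF assms(1)]] by auto

lemma sum_dirichlet_eq_0:
  assumes "primitive_character q chi" "q > 1"
  shows "(\<Sum>k\<in>{0..<int q}. chi k) = 0"
  using gauss_sum_twist[OF assms, of 0] assms(2)
        dirichlet_eq_0_iff[OF primitive_character_imp_dirichlet[OF assms(1)], of 0] by simp

text \<open>Cutting off at a multiple of \<open>q\<close> gives all residue classes the same number of terms; this is what makes
  the divergent parts of the conditionally convergent series below cancel.\<close>
lemma sum_dirichlet_progression: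
  assumes dc: "dirichlet_character q chi" and q: "q > 1"
  shows "(\<Sum>k\<in>{1..<q * N}. chi (int k) * f k) = (\<Sum>b<q. chi (int b) * (\<Sum>j<N. f (b + q * j)))"
proof -
  have "chi 0 = 0" using q by (simp add: dirichlet_eq_0_iff[OF dc])
  then have "(\<Sum>k\<in>{1..<q * N}. chi (int k) * f k) = (\<Sum>k<q * N. chi (int k) * f k)"
    by (intro sum.mono_neutral_left) (auto simp: not_le)
  also have "\<dots> = (\<Sum>j<N. \<Sum>k=j*q..<j*q+q. chi (int k) * f k)"
    by (simp add: sum.nat_group mult.commute)
  also have "\<dots> = (\<Sum>j<N. \<Sum>b<q. chi (int b) * f (b + q * j))"
  proof (rule sum.cong[OF refl])
    fix j
    have "chi (int (b + q * j)) = chi (int b)" for b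
      using dirichlet_periodic[OF dc, of "int b" "int j"] by simp
    moreover have "(\<Sum>k=j*q..<j*q+q. chi (int k) * f k) = (\<Sum>b<q. chi (int (b + q * j)) * f (b + q * j))"
      by (rule sum.reindex_bij_witness[of _ "\<lambda>b. b + q * j" "\<lambda>k. k - q * j"]) (auto simp: mult.commute)
    ultimately show "(\<Sum>k=j*q..<j*q+q. chi (int k) * f k) = (\<Sum>b<q. chi (int b) * f (b + q * j))"
      by simp
  qed
  also have "\<dots> = (\<Sum>b<q. chi (int b) * (\<Sum>j<N. f (b + q * j)))"
    by (subst sum.swap) (simp add: sum_distrib_left)
  finally show ?thesis .
qed

lemma sum_dirichlet_nat:
  assumes "primitive_character q chi" "q > 1"
  shows "(\<Sum>b<q. chi (int b)) = 0"
proof -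
  have "(\<Sum>b<q. chi (int b)) = (\<Sum>k\<in>{0..<int q}. chi k)"
    by (rule sum.reindex_bij_witness[of _ nat int]) auto
  then show ?thesis using sum_dirichlet_eq_0[OF assms] by simp
qed

section \<open>The generating function of a primitive character\<close>

text \<open>The continuation of \<open>\<Sum>n\<ge>1. \<chi>(n) e^(-n u)\<close>, written as a combination of partial fractions in \<open>e^u\<close>. The closed form
  with denominator \<open>1 - e^(-q u)\<close> (\<open>char_gf_eq\<close>) has a removable singularity at 0; this one does not.\<close>
definition char_gf :: "nat \<Rightarrow> (int \<Rightarrow> complex) \<Rightarrow> complex \<Rightarrow> complex" where
  "char_gf q chi u = (\<Sum>k\<in>{1..<int q}. cnj (chi k) / (exp u * add_char q (- k) - 1)) /
                     gauss_sum q (conj_character chi)"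

definition char_gf_dom :: "nat \<Rightarrow> complex set" where
  "char_gf_dom q = {u. \<forall>k\<in>{1..<int q}. exp u * add_char q (- k) \<noteq> 1}"

definition gf_pole :: "nat \<Rightarrow> int \<Rightarrow> complex" where
  "gf_pole q k = 2 * of_real pi * \<i> * of_int k / of_nat q"

lemma exp_gf_pole: "exp (gf_pole q k) = add_char q k"
  by (simp add: gf_pole_def add_char_def expi_def)

lemma exp_mult_add_char_minus: "exp u * add_char q (- k) = exp (u - gf_pole q k)"
  by (simp add: exp_diff exp_gf_pole add_char_minus field_simps)

lemma open_char_gf_dom: "open (char_gf_dom q)"
proof -
  have "char_gf_dom q = (\<Inter>k\<in>{1..<int q}. {u. exp u * add_char q (- k) \<noteq> 1})"
    by (auto simp: char_gf_dom_def)
  also have "open \<dots>"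
    by (intro open_INT ballI open_Collect_neq continuous_intros) auto
  finally show ?thesis .
qed

lemma char_gf_dom_Re: "Re u \<noteq> 0 \<Longrightarrow> u \<in> char_gf_dom q"
proof -
  assume "Re u \<noteq> 0"
  have "norm (exp u * add_char q (- k)) = exp (Re u)" for k
    by (simp add: norm_mult)
  then have "exp u * add_char q (- k) \<noteq> 1" for k
    using \<open>Re u \<noteq> 0\<close> by (metis exp_eq_one_iff norm_one)
  then show ?thesis by (simp add: char_gf_dom_def)
qed

lemma exp_eq_1_small:
  assumes "exp u = 1" "\<bar>Im u\<bar> < 2 * pi"
  shows "u = 0"
proof -
  from assms(1) obtain n :: int where n: "Re u = 0" "Im u = of_int (2 * n) * pi"
    by (auto simp: exp_eq_1)
  from n(2) assms(2) have "\<bar>real_of_int n\<bar> < 1"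
    by (simp add: abs_mult)
  with n show ?thesis
    by (auto simp: complex_eq_iff)
qed

lemma char_gf_dom_Im:
  assumes "\<bar>Im u\<bar> < 2 * pi / real q" "q > 0"
  shows "u \<in> char_gf_dom q"
proof -
  have "exp (u - gf_pole q k) \<noteq> 1" if "k \<in> {1..<int q}" for k
  proof
    assume "exp (u - gf_pole q k) = 1"
    moreover have "Im (gf_pole q k) = 2 * pi * of_int k / real q" "Re (gf_pole q k) = 0"
      by (auto simp: gf_pole_def)
    moreover have "2 * pi * 1 / real q \<le> 2 * pi * of_int k / real q"
      "2 * pi * of_int k / real q \<le> 2 * pi * (real q - 1) / real q"
      using that assms(2) by (intro divide_right_mono mult_left_mono; simp)+
    moreover have "2 * pi * (real q - 1) / real q = 2 * pi - 2 * pi / real q"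
      using assms(2) by (simp add: field_simps)
    moreover from this have "\<bar>Im (u - gf_pole q k)\<bar> < 2 * pi"
      using assms(1) calculation unfolding minus_complex.sel by linarith
    ultimately have "u = gf_pole q k"
      using exp_eq_1_small[of "u - gf_pole q k"] by simp
    then have "Im u = 2 * pi * of_int k / real q"
      using \<open>Im (gf_pole q k) = _\<close> by simp
    then show False
      using assms(1) \<open>2 * pi * 1 / real q \<le> _\<close> by linarith
  qed
  then show ?thesis by (simp add: char_gf_dom_def exp_mult_add_char_minus)
qed

lemma char_gf_holomorphic: "char_gf q chi holomorphic_on char_gf_dom q"
  unfolding char_gf_def
proof (cases "gauss_sum q (conj_character chi) = 0")
  case False
  then show "(\<lambda>u. (\<Sum>k\<in>{1..<int q}. cnj (chi k) / (exp u * add_char q (- k) - 1)) /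
          gauss_sum q (conj_character chi)) holomorphic_on char_gf_dom q"
    by (intro holomorphic_intros) (auto simp: char_gf_dom_def)
qed auto

lemma char_gf_periodic: "char_gf q chi (u + 2 * of_real pi * \<i>) = char_gf q chi u"
  by (simp add: char_gf_def exp_add)

context
  fixes q :: nat and chi :: "int \<Rightarrow> complex"
  assumes prim: "primitive_character q chi" and q: "q > 1"
begin

lemma sum_char_gf_index:
  "(\<Sum>k\<in>{1..<int q}. cnj (chi k) * f k) = (\<Sum>k\<in>{0..<int q}. cnj (chi k) * f k)"
proof (rule sum.mono_neutral_left)
  have "chi 0 = 0"
    using primitive_character_imp_dirichlet[OF prim] q by (simp add: dirichlet_eq_0_iff)
  moreover have "{0..<int q} - {1..<int q} \<subseteq> {0}"
    by auto
  ultimately show "\<forall>i\<in>{0..<int q} - {1..<int q}. cnj (chi i) * f i = 0"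
    by auto
qed auto

lemma sum_cnj_char_eq_0: "(\<Sum>k\<in>{1..<int q}. cnj (chi k)) = 0"
proof -
  have "(\<Sum>k\<in>{1..<int q}. cnj (chi k)) = cnj (\<Sum>k\<in>{0..<int q}. chi k)"
    using sum_char_gf_index[of "\<lambda>_. 1"] by simp
  then show ?thesis
    using sum_dirichlet_eq_0[OF prim q] by simp
qed

text \<open>Each partial fraction is a geometric sum over \<open>b < q\<close> divided by \<open>1 - e^(-q u)\<close>, up to a constant that
  cancels; the sum over \<open>k\<close> is then a twisted Gauss sum, equal to \<open>\<chi>(b)\<close> times the Gauss sum in the definition.\<close>
lemma char_gf_eq:
  assumes u: "exp (of_nat q * u) \<noteq> 1"
  shows "char_gf q chi u =
           (\<Sum>b<q. chi (int b) * exp (- (of_nat b * u))) / (1 - exp (- (of_nat q * u)))"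
proof -
  define T where "T = gauss_sum q (conj_character chi)"
  have T: "T \<noteq> 0"
    using gauss_sum_neq_0[OF primitive_character_conj[OF prim] q] by (simp add: T_def)
  define x where "x k = exp (- u) * add_char q k" for k
  have xq: "x k ^ q = exp (- (of_nat q * u))" for k
    using q by (simp add: x_def power_mult_distrib add_char_power add_char_eq_1_iff
                     flip: exp_of_nat_mult)
  have nz: "1 - exp (- (of_nat q * u)) \<noteq> 0"
    using u by (simp add: exp_minus)
  have x1: "x k \<noteq> 1" for k
    using nz xq[of k] by auto
  have "(\<Sum>k\<in>{1..<int q}. cnj (chi k) / (exp u * add_char q (- k) - 1)) =
        (\<Sum>k\<in>{1..<int q}. cnj (chi k) * (1 / (1 - x k) - 1))"
  proof (intro sum.cong refl)
    fix k
    have e: "exp u * add_char q (- k) = inverse (x k)"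
      by (simp add: x_def exp_minus add_char_minus)
    have "x k \<noteq> 0" by (simp add: x_def)
    then show "cnj (chi k) / (exp u * add_char q (- k) - 1) = cnj (chi k) * (1 / (1 - x k) - 1)"
      unfolding e using x1[of k] by (simp add: divide_simps)
  qed
  also have "\<dots> = (\<Sum>k\<in>{1..<int q}. cnj (chi k) * (1 / (1 - x k)))"
    using sum_cnj_char_eq_0 by (simp add: ring_distribs sum_subtractf)
  also have "\<dots> = (\<Sum>k\<in>{0..<int q}. cnj (chi k) * (1 / (1 - x k)))"
    by (rule sum_char_gf_index)
  also have "\<dots> = (\<Sum>k\<in>{0..<int q}. cnj (chi k) * ((\<Sum>b<q. x k ^ b) / (1 - exp (- (of_nat q * u)))))"
    using x1 nz by (intro sum.cong refl arg_cong2[of _ _ _ _ "(*)"]) (simp add: sum_gp_strict xq)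
  also have "\<dots> = (\<Sum>b<q. exp (- (of_nat b * u)) * (\<Sum>k\<in>{0..<int q}. cnj (chi k) * add_char q (k * int b))) /
                   (1 - exp (- (of_nat q * u)))"
    unfolding sum_divide_distrib sum_distrib_left
    by (subst sum.swap)
       (simp add: x_def power_mult_distrib add_char_power mult_ac flip: exp_of_nat_mult)
  also have "(\<lambda>b. \<Sum>k\<in>{0..<int q}. cnj (chi k) * add_char q (k * int b)) = (\<lambda>b. chi (int b) * T)"
  proof
    fix b
    show "(\<Sum>k\<in>{0..<int q}. cnj (chi k) * add_char q (k * int b)) = chi (int b) * T"
      using gauss_sum_twist[OF primitive_character_conj[OF prim] q, of "int b"]
      by (simp add: conj_character_def T_def)
  qed
  also have "(\<Sum>b<q. exp (- (of_nat b * u)) * (chi (int b) * T)) =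
             (\<Sum>b<q. chi (int b) * exp (- (of_nat b * u))) * T"
    unfolding sum_distrib_right by (simp add: mult_ac)
  finally show ?thesis
    using T by (simp add: char_gf_def T_def)
qed

lemma char_gf_partial_sum:
  assumes u: "exp (of_nat q * u) \<noteq> 1"
  shows "(\<Sum>k\<in>{1..<q * N}. chi (int k) * exp (- (of_nat k * u))) =
           char_gf q chi u * (1 - exp (- (of_nat (q * N) * u)))"
proof -
  have e: "exp (- (of_nat (b + q * j) * u)) = exp (- (of_nat b * u)) * exp (- (of_nat q * u)) ^ j" for b j
    unfolding exp_of_nat_mult[symmetric] exp_add[symmetric] by (simp add: algebra_simps)
  have "(\<Sum>k\<in>{1..<q * N}. chi (int k) * exp (- (of_nat k * u))) =
        (\<Sum>b<q. chi (int b) * exp (- (of_nat b * u))) * (\<Sum>j<N. exp (- (of_nat q * u)) ^ j)"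
    unfolding sum_dirichlet_progression[OF primitive_character_imp_dirichlet[OF prim] q] e
    by (simp add: sum_distrib_left sum_distrib_right mult_ac)
  also have "exp (- (of_nat q * u)) ^ N = exp (- (of_nat (q * N) * u))"
    unfolding exp_of_nat_mult[symmetric] by (simp add: algebra_simps)
  then have "(\<Sum>j<N. exp (- (of_nat q * u)) ^ j) =
             (1 - exp (- (of_nat (q * N) * u))) / (1 - exp (- (of_nat q * u)))"
    using u by (simp add: sum_gp_strict exp_minus)
  finally show ?thesis
    by (simp add: char_gf_eq[OF u])
qed

text \<open>From \<open>1 / (y^(-1) - 1) = -1 - 1 / (y - 1)\<close>; the constants cancel because the values of the character sum to 0.\<close>
lemma char_gf_minus:
  assumes "u \<in> char_gf_dom q"
  shows "char_gf q chi (- u) = - (chi (- 1) * char_gf q chi u)"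
proof -
  note dc = primitive_character_imp_dirichlet[OF prim]
  have "(\<Sum>k\<in>{1..<int q}. cnj (chi k) / (exp (- u) * add_char q (- k) - 1)) =
        (\<Sum>k\<in>{1..<int q}. cnj (chi (- k)) / (exp (- u) * add_char q k - 1))"
  proof (rule sum.reindex_bij_witness[of _ "\<lambda>k. int q - k" "\<lambda>k. int q - k"])
    fix k
    have "chi (- (int q - k)) = chi k"
      by (rule dirichlet_cong[OF dc]) (simp add: cong_iff_dvd_diff)
    moreover have "add_char q (int q - k) = add_char q (- k)"
      using q by (intro add_char_cong) (auto simp: cong_iff_dvd_diff)
    ultimately show "cnj (chi (- (int q - k))) / (exp (- u) * add_char q (int q - k) - 1) =
                     cnj (chi k) / (exp (- u) * add_char q (- k) - 1)"
      by simp
  qed auto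
  also have "\<dots> = (\<Sum>k\<in>{1..<int q}. chi (- 1) * (cnj (chi k) * (- 1 - 1 / (exp u * add_char q (- k) - 1))))"
  proof (intro sum.cong refl)
    fix k assume k: "k \<in> {1..<int q}"
    define y where "y = exp u * add_char q (- k)"
    have y: "y \<noteq> 0" "y \<noteq> 1"
      using assms k by (auto simp: y_def char_gf_dom_def)
    have "exp (- u) * add_char q k = inverse y"
      by (simp add: y_def exp_minus add_char_minus)
    moreover have "1 / (inverse y - 1) = - 1 - 1 / (y - 1)"
      using y by (simp add: field_simps)
    moreover have "cnj (chi (- k)) = chi (- 1) * cnj (chi k)"
      by (simp add: dirichlet_minus[OF dc, of k] dirichlet_minus_1_real[OF dc])
    ultimately show "cnj (chi (- k)) / (exp (- u) * add_char q k - 1) =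
        chi (- 1) * (cnj (chi k) * (- 1 - 1 / (exp u * add_char q (- k) - 1)))"
      by (metis (no_types, lifting) mult.assoc mult.right_neutral times_divide_eq_right y_def)
  qed
  also have "\<dots> = chi (- 1) * (- (\<Sum>k\<in>{1..<int q}. cnj (chi k)) -
                    (\<Sum>k\<in>{1..<int q}. cnj (chi k) / (exp u * add_char q (- k) - 1)))"
    unfolding sum_distrib_left[symmetric]
    by (simp add: ring_distribs sum_subtractf sum_negf)
  also have "\<dots> = - (chi (- 1) * (\<Sum>k\<in>{1..<int q}. cnj (chi k) / (exp u * add_char q (- k) - 1)))"
    unfolding sum_cnj_char_eq_0 by simp
  finally show ?thesis
    by (simp add: char_gf_def)
qed

lemma char_gf_bound_half_plane:
  assumes "Re u \<ge> 1"
  shows "norm (char_gf q chi u) \<le> 2 * real q / norm (gauss_sum q (conj_character chi)) * exp (- Re u)"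
proof -
  note dc = primitive_character_imp_dirichlet[OF prim]
  have "norm (cnj (chi k) / (exp u * add_char q (- k) - 1)) \<le> 2 * exp (- Re u)" for k
  proof -
    have "exp (Re u) \<ge> 2"
      using exp_ge_add_one_self[of 1] assms by (smt (verit) exp_le_cancel_iff)
    moreover have "exp (Re u) - 1 \<le> norm (exp u * add_char q (- k) - 1)"
      using norm_triangle_ineq2[of "exp u * add_char q (- k)" 1] by (simp add: norm_mult)
    ultimately have "norm (exp u * add_char q (- k) - 1) \<ge> exp (Re u) / 2" by linarith
    then have "norm (chi k) / norm (exp u * add_char q (- k) - 1) \<le> 1 / (exp (Re u) / 2)"
      using norm_dirichlet_le[OF dc, of k] by (intro frac_le) auto
    then show ?thesis
      by (simp add: norm_divide exp_minus field_simps)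
  qed
  then have "norm (\<Sum>k\<in>{1..<int q}. cnj (chi k) / (exp u * add_char q (- k) - 1)) \<le>
             of_nat (card {1..<int q}) * (2 * exp (- Re u))"
    by (intro sum_norm_bound)
  also have "\<dots> \<le> real q * (2 * exp (- Re u))"
    by (intro mult_right_mono) auto
  finally have "norm (\<Sum>k\<in>{1..<int q}. cnj (chi k) / (exp u * add_char q (- k) - 1)) / norm (gauss_sum q (conj_character chi)) \<le>
             real q * (2 * exp (- Re u)) / norm (gauss_sum q (conj_character chi))"
    by (intro divide_right_mono) auto
  then show ?thesis
    by (simp add: char_gf_def norm_divide mult_ac)
qed

text \<open>The region consists of two half-planes and of a neighbourhood of the real axis that avoids all poles: a strip of
  half-width \<open>r\<close>, widened by a sector of slope \<open>A\<close>. Strips are needed for the shifts \<open>t + s\<close>, sectors for the rays \<open>w t\<close>.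
  The part with \<open>|Re u| \<le> 1\<close> is compact.\<close>
lemma char_gf_bound:
  assumes r: "r < 2 * pi / real q" and A: "A \<ge> 0"
  shows "\<exists>C>0. \<forall>u. \<bar>Re u\<bar> \<ge> 1 \<or> \<bar>Im u\<bar> \<le> r + A * \<bar>Re u\<bar> \<longrightarrow>
           norm (char_gf q chi u) \<le> C * exp (- \<bar>Re u\<bar>)"
proof -
  note dc = primitive_character_imp_dirichlet[OF prim]
  define K where "K = {u. \<bar>Re u\<bar> \<le> 1 \<and> \<bar>Im u\<bar> \<le> r + A * \<bar>Re u\<bar>}"
  have "K \<subseteq> char_gf_dom q"
  proof
    fix u assume "u \<in> K"
    then show "u \<in> char_gf_dom q"
      using char_gf_dom_Re[of u] char_gf_dom_Im[of u] q r by (cases "Re u = 0") (auto simp: K_def)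
  qed
  moreover have "compact K"
  proof (rule compact_eq_bounded_closed[THEN iffD2], intro conjI)
    show "bounded K"
    proof (rule boundedI)
      fix u assume "u \<in> K"
      then have "\<bar>Re u\<bar> \<le> 1" "\<bar>Im u\<bar> \<le> \<bar>r\<bar> + A * 1"
        using A mult_left_mono[of "\<bar>Re u\<bar>" 1 A] by (auto simp: K_def)
      then show "norm u \<le> 1 + (\<bar>r\<bar> + A * 1)"
        using cmod_le[of u] by linarith
    qed
    have "K = {u. \<bar>Re u\<bar> \<le> 1} \<inter> {u. \<bar>Im u\<bar> \<le> r + A * \<bar>Re u\<bar>}"
      by (auto simp: K_def)
    also have "closed \<dots>"
      by (intro closed_Int closed_Collect_le continuous_intros)
    finally show "closed K" .
  qed
  ultimately have "bounded (char_gf q chi ` K)"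
    by (meson compact_continuous_image compact_imp_bounded continuous_on_subset
              char_gf_holomorphic holomorphic_on_imp_continuous_on)
  then obtain B where B: "B > 0" "\<And>u. u \<in> K \<Longrightarrow> norm (char_gf q chi u) \<le> B"
    by (auto simp: bounded_pos)
  define D where "D = 2 * real q / norm (gauss_sum q (conj_character chi))"
  have D: "D \<ge> 0" by (simp add: D_def)
  have half: "norm (char_gf q chi u) \<le> D * exp (- \<bar>Re u\<bar>)" if "\<bar>Re u\<bar> \<ge> 1" for u
  proof (cases "Re u \<ge> 0")
    case True
    then show ?thesis
      using char_gf_bound_half_plane[of u] that by (simp add: D_def)
  next
    case False
    then have "norm (char_gf q chi (- u)) \<le> D * exp (- \<bar>Re u\<bar>)"
      using char_gf_bound_half_plane[of "- u"] that by (simp add: D_def)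
    then show ?thesis
      using False char_gf_minus[OF char_gf_dom_Re[of u]] q
      by (simp add: norm_mult norm_dirichlet[OF dc])
  qed
  show ?thesis
  proof (intro exI[of _ "B * exp 1 + D"] conjI allI impI)
    show "B * exp 1 + D > 0"
      using B(1) D by (simp add: add_pos_nonneg)
  next
    fix u assume u: "1 \<le> \<bar>Re u\<bar> \<or> \<bar>Im u\<bar> \<le> r + A * \<bar>Re u\<bar>"
    show "norm (char_gf q chi u) \<le> (B * exp 1 + D) * exp (- \<bar>Re u\<bar>)"
    proof (cases "\<bar>Re u\<bar> \<ge> 1")
      case True
      then have "norm (char_gf q chi u) \<le> D * exp (- \<bar>Re u\<bar>)"
        by (rule half)
      also have "\<dots> \<le> (B * exp 1 + D) * exp (- \<bar>Re u\<bar>)"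
        using B(1) by (intro mult_right_mono) auto
      finally show ?thesis .
    next
      case False
      then have "norm (char_gf q chi u) \<le> B * 1"
        using u B(2)[of u] by (simp add: K_def)
      also have "\<dots> \<le> B * exp (1 - \<bar>Re u\<bar>)"
        using B(1) False by (intro mult_left_mono) auto
      also have "\<dots> = B * exp 1 * exp (- \<bar>Re u\<bar>)"
        by (simp add: exp_diff exp_minus field_simps)
      also have "\<dots> \<le> (B * exp 1 + D) * exp (- \<bar>Re u\<bar>)"
        using D by (intro mult_right_mono) auto
      finally show ?thesis .
    qed
  qed
qed

text \<open>Only the \<open>k\<close>-th partial fraction is singular at the point.\<close>
lemma char_gf_pole_limit:
  assumes k: "k \<in> {1..<int q}"
  shows "((\<lambda>u. char_gf q chi u * (u - gf_pole q k)) \<longlongrightarrow>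
            cnj (chi k) / gauss_sum q (conj_character chi)) (at (gf_pole q k))"
proof -
  define T where "T = gauss_sum q (conj_character chi)"
  define p where "p = gf_pole q k"
  have T: "T \<noteq> 0"
    using gauss_sum_neq_0[OF primitive_character_conj[OF prim] q] by (simp add: T_def)
  have "((\<lambda>u. \<Sum>j\<in>{1..<int q}. cnj (chi j) * ((u - p) / (exp u * add_char q (- j) - 1))) \<longlongrightarrow>
          (\<Sum>j\<in>{1..<int q}. cnj (chi j) * (if j = k then 1 else 0))) (at p)"
  proof (intro tendsto_sum tendsto_mult tendsto_const)
    fix j assume j: "j \<in> {1..<int q}"
    show "((\<lambda>u. (u - p) / (exp u * add_char q (- j) - 1)) \<longlongrightarrow> (if j = k then 1 else 0)) (at p)"
    proof (cases "j = k")
      case True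
      have "((\<lambda>u. exp (u - p)) has_field_derivative 1) (at p)"
        by (auto intro!: derivative_eq_intros)
      then have "((\<lambda>u. (exp (u - p) - 1) / (u - p)) \<longlongrightarrow> 1) (at p)"
        by (simp add: has_field_derivative_iff)
      from tendsto_inverse[OF this] show ?thesis
        using True by (simp add: exp_mult_add_char_minus p_def inverse_eq_divide)
    next
      case False
      have "exp p * add_char q (- j) \<noteq> 1"
      proof
        assume "exp p * add_char q (- j) = 1"
        then have "int q dvd k - j"
          using q by (simp add: p_def exp_gf_pole add_char_eq_1_iff flip: add_char_add)
        then have "\<bar>k - j\<bar> \<ge> int q"
          using False dvd_imp_le_int[of "k - j" "int q"] by auto
        then show False using j k by auto
      qed
      then have "((\<lambda>u. (u - p) / (exp u * add_char q (- j) - 1)) \<longlongrightarrow>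
                   (p - p) / (exp p * add_char q (- j) - 1)) (at p)"
        by (intro tendsto_intros) auto
      then show ?thesis using False by simp
    qed
  qed
  then have "((\<lambda>u. (\<Sum>j\<in>{1..<int q}. cnj (chi j) * ((u - p) / (exp u * add_char q (- j) - 1))) / T) \<longlongrightarrow>
          (\<Sum>j\<in>{1..<int q}. cnj (chi j) * (if j = k then 1 else 0)) / T) (at p)"
    using T by (intro tendsto_divide tendsto_const)
  also have "(\<Sum>j\<in>{1..<int q}. cnj (chi j) * (if j = k then 1 else 0)) = cnj (chi k)"
    using k by (simp add: if_distrib[of "\<lambda>x. _ * x"] sum.delta cong: if_cong)
  finally show ?thesis
    by (simp add: char_gf_def p_def T_def sum_distrib_left mult_ac)
qed

end

section \<open>The analytic continuation\<close>

abbreviation halfline :: "real measure" where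
  "halfline \<equiv> restrict_space lborel {0<..}"

lemma borel_measurable_halfline:
  fixes f :: "real \<Rightarrow> complex"
  assumes "continuous_on {0<..} f"
  shows "f \<in> borel_measurable halfline"
  using borel_measurable_continuous_on_restrict[OF assms]
  by (subst measurable_cong_sets[OF _ refl, of _ "restrict_space borel {0<..}"])
     (simp_all add: sets_restrict_space)

lemma has_bochner_integral_halfline_iff:
  fixes f :: "real \<Rightarrow> 'a :: {banach, second_countable_topology}"
  shows "has_bochner_integral halfline f x \<longleftrightarrow>
           set_integrable lborel {0<..} f \<and> (LBINT t:{0<..}. f t) = x"
  by (simp add: has_bochner_integral_iff integrable_restrict_space integral_restrict_space
                set_integrable_def set_lebesgue_integral_def)

lemma einterval_0_infinity: "einterval 0 \<infinity> = {0<..}"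
  by (auto simp: einterval_def)

lemma has_bochner_integral_exp_real:
  assumes c: "c > 0"
  shows "has_bochner_integral halfline (\<lambda>t. exp (- (c * t))) (1 / c :: real)"
proof -
  have A: "(((\<lambda>t. - exp (- (c * t)) / c) \<circ> real_of_ereal) \<longlongrightarrow> - 1 / c) (at_right 0)"
  proof -
    have "((\<lambda>t. - exp (- (c * t)) / c) \<longlongrightarrow> - exp (- (c * 0)) / c) (at_right 0)"
      using c by (intro tendsto_intros) auto
    then show ?thesis
      by (simp add: zero_ereal_def ereal_tendsto_simps)
  qed
  have B: "(((\<lambda>t. - exp (- (c * t)) / c) \<circ> real_of_ereal) \<longlongrightarrow> 0) (at_left \<infinity>)"
  proof -
    have "((\<lambda>t. - exp (- (c * t)) / c) \<longlongrightarrow> 0) at_top"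
      using c by real_asymp
    then show ?thesis
      by (simp add: ereal_tendsto_simps)
  qed
  have "set_integrable lborel (einterval 0 \<infinity>) (\<lambda>t. exp (- (c * t)))"
       "(LBINT t=0..\<infinity>. exp (- (c * t))) = 0 - (- 1 / c)"
    using c by (intro interval_integral_FTC_nonneg[OF _ _ _ _ A B];
                auto intro!: derivative_eq_intros continuous_intros)+
  then show ?thesis
    by (simp add: has_bochner_integral_halfline_iff einterval_0_infinity interval_lebesgue_integral_0_infty)
qed

lemma has_bochner_integral_exp:
  assumes p: "Re p > 0"
  shows "has_bochner_integral halfline (\<lambda>t. exp (- (p * of_real t))) (1 / p)"
proof -
  have p0: "p \<noteq> 0" using p by auto
  have int: "integrable halfline (\<lambda>t. exp (- (p * of_real t)))"
  proof (rule Bochner_Integration.integrable_bound)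
    show "integrable halfline (\<lambda>t. exp (- (Re p * t)))"
      using has_bochner_integral_exp_real[OF p] by (simp add: has_bochner_integral_iff)
  qed (auto intro!: borel_measurable_halfline continuous_intros)
  have A: "(((\<lambda>t. - exp (- (p * of_real t)) / p) \<circ> real_of_ereal) \<longlongrightarrow> - 1 / p) (at_right 0)"
  proof -
    have "((\<lambda>t. - exp (- (p * of_real t)) / p) \<longlongrightarrow> - exp (- (p * of_real 0)) / p) (at_right 0)"
      using p0 by (intro tendsto_intros) auto
    then show ?thesis
      by (simp add: zero_ereal_def ereal_tendsto_simps)
  qed
  have B: "(((\<lambda>t. - exp (- (p * of_real t)) / p) \<circ> real_of_ereal) \<longlongrightarrow> 0) (at_left \<infinity>)"
  proof -
    have "((\<lambda>t. exp (- (Re p * t)) / norm p) \<longlongrightarrow> 0) at_top"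
      using p p0 by real_asymp
    then have "((\<lambda>t. - exp (- (p * of_real t)) / p) \<longlongrightarrow> 0) at_top"
      by (rule Lim_null_comparison[rotated]) (auto simp: norm_divide)
    then show ?thesis
      by (simp add: ereal_tendsto_simps)
  qed
  have "(LBINT t=0..\<infinity>. exp (- (p * of_real t))) = 0 - (- 1 / p)"
  proof (rule interval_integral_FTC_integrable[OF _ _ _ _ A B])
    show "set_integrable lborel (einterval 0 \<infinity>) (\<lambda>t. exp (- (p * of_real t)))"
      using int by (simp add: einterval_0_infinity integrable_restrict_space set_integrable_def)
    fix t :: real
    have "((\<lambda>z. - exp (- (p * z)) / p) has_field_derivative exp (- (p * of_real t))) (at (of_real t))"
      using p0 by (auto intro!: derivative_eq_intros)
    then show "((\<lambda>t. - exp (- (p * of_real t)) / p) has_vector_derivative exp (- (p * of_real t))) (at t)"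
      by (rule has_vector_derivative_real_field)
  qed (auto intro!: continuous_intros)
  with int show ?thesis
    by (simp add: has_bochner_integral_iff interval_lebesgue_integral_0_infty
                  integral_restrict_space set_lebesgue_integral_def)
qed

lemma exp_neq_1_Re: "Re u \<noteq> 0 \<Longrightarrow> exp u \<noteq> 1"
  by (metis exp_eq_one_iff norm_exp_eq_Re norm_one)

text \<open>Partial sums over whole periods in both variables. Over an arbitrary exhaustion the double series need
  not converge, since it is not absolutely convergent.\<close>
definition lattice_sum :: "nat \<Rightarrow> (int \<Rightarrow> complex) \<Rightarrow> complex \<Rightarrow> nat \<Rightarrow> nat \<Rightarrow> complex" where
  "lattice_sum q chi z M N =
     (\<Sum>m\<in>{1..<q * M}. \<Sum>n\<in>{1..<q * N}. chi (int m) * cnj (chi (int n)) / (of_nat m * z + of_nat n))"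

text \<open>The parameter \<open>w\<close> is the direction of the ray of integration; the integral does not depend on \<open>w\<close> as long as \<open>w\<close>
  and \<open>z w\<close> lie in the right half-plane (\<open>lattice_limit_eq_integral\<close>).\<close>
definition lattice_integral :: "nat \<Rightarrow> (int \<Rightarrow> complex) \<Rightarrow> complex \<Rightarrow> complex \<Rightarrow> complex" where
  "lattice_integral q chi z w =
     w * (\<integral>t. char_gf q chi (z * w * of_real t) * char_gf q (conj_character chi) (w * of_real t) \<partial>halfline)"

definition lattice_limit :: "nat \<Rightarrow> (int \<Rightarrow> complex) \<Rightarrow> complex \<Rightarrow> complex" where
  "lattice_limit q chi z = lim (\<lambda>N. lattice_sum q chi z N N)"

context
  fixes q :: nat and chi :: "int \<Rightarrow> complex"
  assumes prim: "primitive_character q chi" and q: "q > 1"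
begin

text \<open>Write \<open>1 / (m z + n)\<close> as \<open>w\<close> times the integral of \<open>exp (- (m z + n) w t)\<close>. The two finite sums under the
  integral then separate and have the closed form of \<open>char_gf_partial_sum\<close>.\<close>
lemma has_bochner_integral_lattice_sum:
  assumes w: "Re w > 0" and zw: "Re (z * w) > 0"
  shows "has_bochner_integral halfline
           (\<lambda>t. (char_gf q chi (z * w * of_real t) * (1 - exp (- (of_nat (q * M) * (z * w * of_real t))))) *
                (char_gf q (conj_character chi) (w * of_real t) * (1 - exp (- (of_nat (q * N) * (w * of_real t))))))
           (lattice_sum q chi z M N / w)"
proof -
  have w0: "w \<noteq> 0" using w by auto
  have single: "has_bochner_integral halfline
      (\<lambda>t. chi (int m) * cnj (chi (int n)) * exp (- ((of_nat m * (z * w) + of_nat n * w) * of_real t)))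
      (chi (int m) * cnj (chi (int n)) * (1 / (of_nat m * (z * w) + of_nat n * w)))"
    if "m \<in> {1..<q * M}" "n \<in> {1..<q * N}" for m n
  proof (intro has_bochner_integral_mult_right has_bochner_integral_exp)
    have "Re (of_nat m * (z * w) + of_nat n * w) = real m * Re (z * w) + real n * Re w"
      by simp
    also have "\<dots> > 0"
      using that w zw by (intro add_pos_pos mult_pos_pos) auto
    finally show "Re (of_nat m * (z * w) + of_nat n * w) > 0" .
  qed
  have "has_bochner_integral halfline
      (\<lambda>t. \<Sum>m\<in>{1..<q * M}. \<Sum>n\<in>{1..<q * N}. chi (int m) * cnj (chi (int n)) *
             exp (- ((of_nat m * (z * w) + of_nat n * w) * of_real t)))
      (\<Sum>m\<in>{1..<q * M}. \<Sum>n\<in>{1..<q * N}. chi (int m) * cnj (chi (int n)) *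
             (1 / (of_nat m * (z * w) + of_nat n * w)))"
    by (intro has_bochner_integral_sum single)
  also have "(\<Sum>m\<in>{1..<q * M}. \<Sum>n\<in>{1..<q * N}. chi (int m) * cnj (chi (int n)) *
             (1 / (of_nat m * (z * w) + of_nat n * w))) = lattice_sum q chi z M N / w"
    unfolding lattice_sum_def sum_divide_distrib
    using w0 by (intro sum.cong refl) (simp add: field_simps)
  also have "has_bochner_integral halfline
      (\<lambda>t. \<Sum>m\<in>{1..<q * M}. \<Sum>n\<in>{1..<q * N}. chi (int m) * cnj (chi (int n)) *
             exp (- ((of_nat m * (z * w) + of_nat n * w) * of_real t))) = has_bochner_integral halfline
           (\<lambda>t. (char_gf q chi (z * w * of_real t) * (1 - exp (- (of_nat (q * M) * (z * w * of_real t))))) *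
                (char_gf q (conj_character chi) (w * of_real t) * (1 - exp (- (of_nat (q * N) * (w * of_real t))))))"
  proof (intro ext has_bochner_integral_cong refl)
    fix t assume "t \<in> space halfline"
    then have t: "t > 0" by simp
    have ne: "exp (of_nat q * (z * w * of_real t)) \<noteq> 1" "exp (of_nat q * (w * of_real t)) \<noteq> 1"
      using t w zw q by (intro exp_neq_1_Re; simp)+
    show "(\<Sum>m\<in>{1..<q * M}. \<Sum>n\<in>{1..<q * N}. chi (int m) * cnj (chi (int n)) *
             exp (- ((of_nat m * (z * w) + of_nat n * w) * of_real t))) =
          (char_gf q chi (z * w * of_real t) * (1 - exp (- (of_nat (q * M) * (z * w * of_real t))))) *
                (char_gf q (conj_character chi) (w * of_real t) * (1 - exp (- (of_nat (q * N) * (w * of_real t)))))"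
      unfolding char_gf_partial_sum[OF prim q ne(1), symmetric]
                char_gf_partial_sum[OF primitive_character_conj[OF prim] q ne(2), symmetric] sum_product
      by (intro sum.cong refl) (simp add: conj_character_def ring_distribs exp_diff exp_minus field_simps)
  qed
  finally show ?thesis .
qed

text \<open>The truncated integrand differs from the full one by terms that are bounded by a multiple of \<open>e^(-M c t)\<close> or \<open>e^(-N c t)\<close>, whose
  integrals are of order \<open>1/M\<close> and \<open>1/N\<close>. The constant depends only on the sector and on the distance to the
  imaginary axis, which gives locally uniform convergence in \<open>z\<close>.\<close>
lemma lattice_sum_estimate:
  assumes A: "A \<ge> 0" and c: "c > 0"
  shows "\<exists>C>0. \<forall>w z M N. Re w \<ge> c \<longrightarrow> \<bar>Im w\<bar> \<le> A * Re w \<longrightarrow> Re (z * w) \<ge> c \<longrightarrow>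
           \<bar>Im (z * w)\<bar> \<le> A * Re (z * w) \<longrightarrow> M > 0 \<longrightarrow> N > 0 \<longrightarrow>
           norm (lattice_sum q chi z M N - lattice_integral q chi z w) \<le>
             C * norm w * (1 / real M + 1 / real N)"
proof -
  have pi: "0 < 2 * pi / real q" using q by simp
  define F where "F = char_gf q chi"
  define G where "G = char_gf q (conj_character chi)"
  obtain B1 where B1: "B1 > 0"
    "\<And>u. \<bar>Re u\<bar> \<ge> 1 \<or> \<bar>Im u\<bar> \<le> 0 + A * \<bar>Re u\<bar> \<Longrightarrow> norm (F u) \<le> B1 * exp (- \<bar>Re u\<bar>)"
    using char_gf_bound[OF prim q pi A] unfolding F_def by blast
  obtain B2 where B2: "B2 > 0"
    "\<And>u. \<bar>Re u\<bar> \<ge> 1 \<or> \<bar>Im u\<bar> \<le> 0 + A * \<bar>Re u\<bar> \<Longrightarrow> norm (G u) \<le> B2 * exp (- \<bar>Re u\<bar>)"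
    using char_gf_bound[OF primitive_character_conj[OF prim] q pi A] unfolding G_def by blast
  define C where "C = 2 * B1 * B2 / c"
  show ?thesis
  proof (intro exI[of _ C] conjI allI impI)
    show "C > 0" using B1 B2 c by (simp add: C_def)
  next
    fix w z and M N :: nat
    assume w: "Re w \<ge> c" "\<bar>Im w\<bar> \<le> A * Re w" and zw: "Re (z * w) \<ge> c" "\<bar>Im (z * w)\<bar> \<le> A * Re (z * w)"
      and M: "M > 0" and N: "N > 0"
    have w0: "w \<noteq> 0" using w c by auto
    define x where "x t = z * w * of_real t" for t
    define y where "y t = w * of_real t" for t
    define e1 where "e1 t = exp (- (of_nat (q * M) * x t))" for t
    define e2 where "e2 t = exp (- (of_nat (q * N) * y t))" for t
    have Rex: "Re (x t) = Re (z * w) * t" and Rey: "Re (y t) = Re w * t" for t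
      by (simp_all add: x_def y_def algebra_simps)
    have Imx: "Im (x t) = Im (z * w) * t" and Imy: "Im (y t) = Im w * t" for t
      by (simp_all add: x_def y_def algebra_simps)
    have bnd: "norm (F (x t)) \<le> B1 * exp (- (c * t))" "norm (G (y t)) \<le> B2 * exp (- (c * t))" if "t > 0" for t
    proof -
      have "\<bar>Im (x t)\<bar> \<le> 0 + A * \<bar>Re (x t)\<bar>" "\<bar>Im (y t)\<bar> \<le> 0 + A * \<bar>Re (y t)\<bar>"
        using that mult_right_mono[OF w(2), of t] mult_right_mono[OF zw(2), of t] c w zw
        by (simp_all only: Rex Rey Imx Imy) (simp_all add: abs_mult)
      then have "norm (F (x t)) \<le> B1 * exp (- \<bar>Re (x t)\<bar>)" "norm (G (y t)) \<le> B2 * exp (- \<bar>Re (y t)\<bar>)"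
        using B1(2)[of "x t"] B2(2)[of "y t"] by blast+
      moreover have "c * t \<le> \<bar>Re (x t)\<bar>" "c * t \<le> \<bar>Re (y t)\<bar>"
        using mult_right_mono[OF w(1), of t] mult_right_mono[OF zw(1), of t] that
        unfolding Rex Rey by linarith+
      then have "B1 * exp (- \<bar>Re (x t)\<bar>) \<le> B1 * exp (- (c * t))" "B2 * exp (- \<bar>Re (y t)\<bar>) \<le> B2 * exp (- (c * t))"
        using B1 B2 by (intro mult_left_mono; simp)+
      ultimately show "norm (F (x t)) \<le> B1 * exp (- (c * t))" "norm (G (y t)) \<le> B2 * exp (- (c * t))"
        by linarith+
    qed
    have bnd1: "norm (F (x t)) \<le> B1" "norm (G (y t)) \<le> B2" if "t > 0" for t
    proof -
      have "exp (- (c * t)) \<le> 1" using that c by simp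
      then have "B1 * exp (- (c * t)) \<le> B1" "B2 * exp (- (c * t)) \<le> B2"
        using B1(1) B2(1) by (simp_all add: mult_left_le)
      then show "norm (F (x t)) \<le> B1" "norm (G (y t)) \<le> B2"
        using bnd[OF that] by linarith+
    qed
    have e1: "norm (e1 t) \<le> exp (- (real M * c * t))" if "t > 0" for t
    proof -
      \<comment> \<open>the exponent contains \<open>q M\<close>; the factor \<open>q \<ge> 1\<close> is dropped\<close>
      have "1 * (real M * (c * t)) \<le> real q * (real M * (Re (z * w) * t))"
        using that zw q c M by (intro mult_mono mult_left_mono mult_right_mono) auto
      then show ?thesis
        by (simp add: e1_def Rex mult_ac del: of_nat_mult)
           (simp add: mult_ac)
    qed
    have e2: "norm (e2 t) \<le> exp (- (real N * c * t))" if "t > 0" for t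
    proof -
      have "1 * (real N * (c * t)) \<le> real q * (real N * (Re w * t))"
        using that w q c N by (intro mult_mono mult_left_mono mult_right_mono) auto
      then show ?thesis
        by (simp add: e2_def Rey mult_ac)
    qed
    have e2': "norm (1 - e2 t) \<le> 2" if "t > 0" for t
    proof -
      have "exp (- (real N * c * t)) \<le> 1" using that c by simp
      then show ?thesis
        using norm_triangle_ineq4[of 1 "e2 t"] e2[OF that] by (simp del: exp_le_one_iff)
    qed
    have contF: "continuous_on {0<..} (\<lambda>t. F (x t))"
      unfolding F_def x_def
    proof (rule continuous_on_compose2[OF holomorphic_on_imp_continuous_on[OF char_gf_holomorphic]])
      show "(\<lambda>t. z * w * complex_of_real t) ` {0<..} \<subseteq> char_gf_dom q"
        using zw c by (auto intro!: char_gf_dom_Re)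
    qed (auto intro!: continuous_intros)
    have contG: "continuous_on {0<..} (\<lambda>t. G (y t))"
      unfolding G_def y_def
    proof (rule continuous_on_compose2[OF holomorphic_on_imp_continuous_on[OF char_gf_holomorphic]])
      show "(\<lambda>t. w * complex_of_real t) ` {0<..} \<subseteq> char_gf_dom q"
        using w c by (auto intro!: char_gf_dom_Re)
    qed (auto intro!: continuous_intros)
    have int: "integrable halfline (\<lambda>t. F (x t) * G (y t))"
    proof (rule Bochner_Integration.integrable_bound)
      show "integrable halfline (\<lambda>t. B1 * B2 * exp (- (c * t)))"
        using has_bochner_integral_exp_real[OF c] by (simp add: has_bochner_integral_iff)
      show "(\<lambda>t. F (x t) * G (y t)) \<in> borel_measurable halfline"
        by (intro borel_measurable_halfline continuous_on_mult contF contG)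
      show "AE t in halfline. norm (F (x t) * G (y t)) \<le> norm (B1 * B2 * exp (- (c * t)))"
      proof (intro AE_I2)
        fix t assume "t \<in> space halfline"
        then have t: "t > 0" by simp
        have "norm (F (x t)) * norm (G (y t)) \<le> B1 * (B2 * exp (- (c * t)))"
          using bnd[OF t] bnd1[OF t] B1(1) by (intro mult_mono) auto
        then show "norm (F (x t) * G (y t)) \<le> norm (B1 * B2 * exp (- (c * t)))"
          using B1 B2 by (simp add: norm_mult abs_mult mult_ac)
      qed
    qed
    have sumint: "has_bochner_integral halfline (\<lambda>t. (F (x t) * (1 - e1 t)) * (G (y t) * (1 - e2 t)))
                    (lattice_sum q chi z M N / w)"
      using has_bochner_integral_lattice_sum[of w z M N] w zw c
      by (simp add: F_def G_def x_def y_def e1_def e2_def)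
    have "norm (lattice_sum q chi z M N / w - (\<integral>t. F (x t) * G (y t) \<partial>halfline)) =
          norm (\<integral>t. (F (x t) * (1 - e1 t)) * (G (y t) * (1 - e2 t)) - F (x t) * G (y t) \<partial>halfline)"
      using sumint int by (simp add: has_bochner_integral_iff)
    also have "\<dots> \<le> (\<integral>t. B1 * B2 * (2 * exp (- (real M * c * t)) + 1 * exp (- (real N * c * t))) \<partial>halfline)"
    proof (rule Bochner_Integration.integral_norm_bound_integral)
      show "integrable halfline (\<lambda>t. (F (x t) * (1 - e1 t)) * (G (y t) * (1 - e2 t)) - F (x t) * G (y t))"
        using sumint int by (auto simp: has_bochner_integral_iff)
      show "integrable halfline (\<lambda>t. B1 * B2 * (2 * exp (- (real M * c * t)) + 1 * exp (- (real N * c * t))))"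
        using has_bochner_integral_exp_real[of "real M * c"] has_bochner_integral_exp_real[of "real N * c"] M N c
        by (simp add: has_bochner_integral_iff)
      fix t assume "t \<in> space halfline"
      then have t: "t > 0" by simp
      have "(F (x t) * (1 - e1 t)) * (G (y t) * (1 - e2 t)) - F (x t) * G (y t) =
            (F (x t) * G (y t)) * ((- e1 t) * (1 - e2 t) + - e2 t)"
        by (simp add: algebra_simps)
      also have "norm \<dots> \<le> (B1 * B2) * (exp (- (real M * c * t)) * 2 + exp (- (real N * c * t)))"
        unfolding norm_mult
      proof (intro mult_mono)
        show "norm (- e1 t * (1 - e2 t) + - e2 t) \<le> exp (- (real M * c * t)) * 2 + exp (- (real N * c * t))"
        proof (intro norm_triangle_le add_mono)
          show "norm (- e1 t * (1 - e2 t)) \<le> exp (- (real M * c * t)) * 2"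
            unfolding norm_mult norm_minus_cancel using e1[OF t] e2'[OF t] by (intro mult_mono) auto
        qed (use e2[OF t] in simp)
      qed (use bnd1[OF t] B1(1) B2(1) in auto)
      finally show "norm ((F (x t) * (1 - e1 t)) * (G (y t) * (1 - e2 t)) - F (x t) * G (y t)) \<le>
           B1 * B2 * (2 * exp (- (real M * c * t)) + 1 * exp (- (real N * c * t)))"
        by (simp add: mult_ac)
    qed
    also have "\<dots> = B1 * B2 * (2 * (1 / (real M * c)) + 1 * (1 / (real N * c)))"
      using has_bochner_integral_exp_real[of "real M * c"] has_bochner_integral_exp_real[of "real N * c"] M N c
      by (simp add: has_bochner_integral_iff)
    also have "\<dots> \<le> B1 * B2 * (2 * (1 / (real M * c)) + 2 * (1 / (real N * c)))"
      using B1 B2 c by (intro mult_left_mono add_left_mono mult_right_mono) auto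
    also have "\<dots> = C * (1 / real M + 1 / real N)"
      using c M N by (simp add: C_def field_simps)
    finally have *: "norm (lattice_sum q chi z M N / w - (\<integral>t. F (x t) * G (y t) \<partial>halfline)) \<le>
                     C * (1 / real M + 1 / real N)" .
    have "lattice_sum q chi z M N - lattice_integral q chi z w =
          w * (lattice_sum q chi z M N / w - (\<integral>t. F (x t) * G (y t) \<partial>halfline))"
      using w0 by (simp add: lattice_integral_def F_def G_def x_def y_def field_simps)
    then show "norm (lattice_sum q chi z M N - lattice_integral q chi z w) \<le>
               C * norm w * (1 / real M + 1 / real N)"
      using mult_left_mono[OF *, of "norm w"] by (simp add: norm_mult mult_ac)
  qed
qed

lemma lattice_limit_estimate:
  assumes w: "Re w > 0" and zw: "Re (z * w) > 0"
  shows "\<exists>C. \<forall>M>0. \<forall>N>0. norm (lattice_sum q chi z M N - lattice_integral q chi z w) \<le> C * (1 / real M + 1 / real N)"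
proof -
  define c where "c = min (Re w) (Re (z * w))"
  define A where "A = max (\<bar>Im w\<bar> / Re w) (\<bar>Im (z * w)\<bar> / Re (z * w))"
  have "\<bar>Im w\<bar> / Re w \<le> A" "\<bar>Im (z * w)\<bar> / Re (z * w) \<le> A"
    by (auto simp: A_def)
  then have "\<bar>Im w\<bar> \<le> A * Re w" "\<bar>Im (z * w)\<bar> \<le> A * Re (z * w)"
    using w zw by (metis pos_divide_le_eq)+
  moreover have "A \<ge> 0"
    using w by (auto simp: A_def le_max_iff_disj)
  moreover have "c > 0" "c \<le> Re w" "c \<le> Re (z * w)"
    using w zw by (auto simp: c_def)
  ultimately show ?thesis
    using lattice_sum_estimate[of A c] by blast
qed

lemma lattice_limit_eq_integral:
  assumes w: "Re w > 0" and zw: "Re (z * w) > 0"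
  shows "lattice_limit q chi z = lattice_integral q chi z w"
proof -
  obtain C where C: "\<And>M N. M > 0 \<Longrightarrow> N > 0 \<Longrightarrow>
      norm (lattice_sum q chi z M N - lattice_integral q chi z w) \<le> C * (1 / real M + 1 / real N)"
    using lattice_limit_estimate[OF assms] by blast
  have "(\<lambda>N. C * (1 / real N + 1 / real N)) \<longlonglongrightarrow> 0"
    by real_asymp
  moreover have "eventually (\<lambda>N. norm (lattice_sum q chi z N N - lattice_integral q chi z w) \<le>
                   C * (1 / real N + 1 / real N)) sequentially"
    using eventually_gt_at_top[of 0] by eventually_elim (use C in blast)
  ultimately have "(\<lambda>N. lattice_sum q chi z N N - lattice_integral q chi z w) \<longlonglongrightarrow> 0"
    by (rule Lim_null_comparison[rotated])
  then have "(\<lambda>N. lattice_sum q chi z N N) \<longlonglongrightarrow> lattice_integral q chi z w"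
    by (simp add: LIM_zero_iff)
  then show ?thesis
    by (simp add: lattice_limit_def limI)
qed


end

text \<open>The direction \<open>w = 1/\<surd>z\<close> is admissible for every \<open>z\<close> in the slit plane.\<close>
lemma Re_csqrt_pos:
  assumes "z \<notin> \<real>\<^sub>\<le>\<^sub>0"
  shows "Re (csqrt z) > 0" "Re (1 / csqrt z) > 0" "z * (1 / csqrt z) = csqrt z"
proof -
  have "Re (csqrt z) \<noteq> 0"
  proof
    assume "Re (csqrt z) = 0"
    then have "(csqrt z)\<^sup>2 \<in> \<real>\<^sub>\<le>\<^sub>0"
      by (auto simp: complex_nonpos_Reals_iff power2_eq_square)
    then show False using assms by simp
  qed
  then show 1: "Re (csqrt z) > 0"
    using Re_csqrt[of z] by linarith
  then show "Re (1 / csqrt z) > 0"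
    by (simp add: Re_divide' zero_less_divide_iff) (auto simp: complex_eq_iff)
  have "csqrt z * csqrt z = z" "csqrt z \<noteq> 0"
    using 1 by (auto simp flip: power2_eq_square)
  then show "z * (1 / csqrt z) = csqrt z"
    by (metis nonzero_mult_div_cancel_right times_divide_eq_right mult.right_neutral)
qed

context
  fixes q :: nat and chi :: "int \<Rightarrow> complex"
  assumes prim: "primitive_character q chi" and q: "q > 1"
begin

lemma lattice_sum_lattice_limit:
  assumes "z \<notin> \<real>\<^sub>\<le>\<^sub>0"
  shows "\<exists>C. \<forall>M>0. \<forall>N>0. norm (lattice_sum q chi z M N - lattice_limit q chi z) \<le> C * (1 / real M + 1 / real N)"
  using lattice_limit_estimate[OF prim q, of "1 / csqrt z" z]
        lattice_limit_eq_integral[OF prim q, of "1 / csqrt z" z] Re_csqrt_pos[OF assms] by simp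

lemma lattice_sum_holomorphic: "(\<lambda>z. lattice_sum q chi z M N) holomorphic_on - \<real>\<^sub>\<le>\<^sub>0"
  unfolding lattice_sum_def
proof (intro holomorphic_intros)
  fix m n :: nat and z :: complex assume mn: "m \<in> {1..<q * M}" "n \<in> {1..<q * N}" and z: "z \<in> - \<real>\<^sub>\<le>\<^sub>0"
  show "of_nat m * z + of_nat n \<noteq> (0::complex)"
  proof
    assume "of_nat m * z + of_nat n = (0::complex)"
    then have "z = of_real (- (real n / real m))"
      using mn by (simp add: field_simps add_eq_0_iff2)
    also have "\<dots> \<in> \<real>\<^sub>\<le>\<^sub>0"
      unfolding nonpos_Reals_of_real_iff by simp
    finally show False using z by simp
  qed
qed

lemma uniform_limit_lattice_sum:
  assumes K: "compact K" "K \<inter> \<real>\<^sub>\<le>\<^sub>0 = {}"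
  shows "uniform_limit K (\<lambda>N z. lattice_sum q chi z N N) (lattice_limit q chi) sequentially"
proof (cases "K = {}")
  case False
  \<comment> \<open>by compactness both rays stay in one sector and away from the imaginary axis\<close>
  define R where "R z = min (Re (csqrt z)) (Re (1 / csqrt z))" for z
  define I where "I z = max \<bar>Im (csqrt z)\<bar> \<bar>Im (1 / csqrt z)\<bar>" for z
  have nz: "z \<notin> \<real>\<^sub>\<le>\<^sub>0" if "z \<in> K" for z using that K by blast
  have cont: "continuous_on K csqrt" "continuous_on K (\<lambda>z. 1 / csqrt z)"
    using nz nz[of 0] by (auto intro!: continuous_intros holomorphic_on_imp_continuous_on[OF holomorphic_on_csqrt]
                              intro: continuous_on_subset)
  have "continuous_on K R" "continuous_on K I" "continuous_on K (\<lambda>z. norm (1 / csqrt z))"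
    unfolding R_def I_def
    by (intro cont continuous_on_min continuous_on_max continuous_on_rabs continuous_on_Re
              continuous_on_Im continuous_on_norm)+
  then obtain z1 z2 z3 where z: "z1 \<in> K" "\<And>z. z \<in> K \<Longrightarrow> R z1 \<le> R z"
      "z2 \<in> K" "\<And>z. z \<in> K \<Longrightarrow> I z \<le> I z2" "z3 \<in> K" "\<And>z. z \<in> K \<Longrightarrow> norm (1 / csqrt z) \<le> norm (1 / csqrt z3)"
    using continuous_attains_inf[OF K(1) False] continuous_attains_sup[OF K(1) False] by metis
  define c where "c = R z1"
  have c: "c > 0" using Re_csqrt_pos[OF nz[OF z(1)]] by (simp add: c_def R_def)
  define A where "A = I z2 / c"
  have A: "A \<ge> 0" using c by (simp add: A_def I_def le_max_iff_disj)
  obtain C where C: "C > 0" and est: "\<And>w z M N. Re w \<ge> c \<Longrightarrow> \<bar>Im w\<bar> \<le> A * Re w \<Longrightarrow> Re (z * w) \<ge> c \<Longrightarrow>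
           \<bar>Im (z * w)\<bar> \<le> A * Re (z * w) \<Longrightarrow> M > 0 \<Longrightarrow> N > 0 \<Longrightarrow>
           norm (lattice_sum q chi z M N - lattice_integral q chi z w) \<le>
             C * norm w * (1 / real M + 1 / real N)"
    using lattice_sum_estimate[OF prim q A c] by blast
  define B where "B = C * norm (1 / csqrt z3)"
  have bound: "norm (lattice_sum q chi z N N - lattice_limit q chi z) \<le> B * (2 / real N)"
    if z': "z \<in> K" and N: "N > 0" for z N
  proof -
    note s = Re_csqrt_pos[OF nz[OF z']]
    have R: "Re (csqrt z) \<ge> c" "Re (1 / csqrt z) \<ge> c"
      using z(2)[OF z'] by (auto simp: c_def R_def)
    have "I z2 \<le> A * Re (csqrt z)" "I z2 \<le> A * Re (1 / csqrt z)"
      using R mult_left_mono[OF R(1) A] mult_left_mono[OF R(2) A] c by (auto simp: A_def)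
    moreover have "\<bar>Im (csqrt z)\<bar> \<le> I z2" "\<bar>Im (1 / csqrt z)\<bar> \<le> I z2"
      using z(4)[OF z'] by (auto simp: I_def)
    ultimately have "\<bar>Im (csqrt z)\<bar> \<le> A * Re (csqrt z)" "\<bar>Im (1 / csqrt z)\<bar> \<le> A * Re (1 / csqrt z)"
      by (meson order_trans)+
    then have "norm (lattice_sum q chi z N N - lattice_integral q chi z (1 / csqrt z)) \<le>
             C * norm (1 / csqrt z) * (1 / real N + 1 / real N)"
      using est[of "1 / csqrt z" z N N, unfolded s(3)] R N by blast
    also have "C * norm (1 / csqrt z) * (1 / real N + 1 / real N) \<le> B * (2 / real N)"
      using z(6)[OF z'] C unfolding B_def by (intro mult_mono mult_left_mono) auto
    finally show ?thesis
      using lattice_limit_eq_integral[OF prim q, of "1 / csqrt z" z] s by simp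
  qed
  have "(\<lambda>N. B * (2 / real N)) \<longlonglongrightarrow> 0"
    by real_asymp
  show ?thesis
  proof (rule uniform_limitI)
    fix e :: real assume "e > 0"
    then have "eventually (\<lambda>N. B * (2 / real N) < e) sequentially"
      using order_tendstoD(2)[OF \<open>(\<lambda>N. B * (2 / real N)) \<longlonglongrightarrow> 0\<close>] by blast
    then show "\<forall>\<^sub>F N in sequentially. \<forall>z\<in>K. dist (lattice_sum q chi z N N) (lattice_limit q chi z) < e"
      using eventually_gt_at_top[of 0]
    proof eventually_elim
      case (elim N)
      then show ?case
        using bound[of _ N] unfolding dist_norm by (meson le_less_trans)
    qed
  qed
qed auto

lemma lattice_limit_holomorphic: "lattice_limit q chi holomorphic_on - \<real>\<^sub>\<le>\<^sub>0"
proof (rule holomorphic_uniform_sequence[OF _ lattice_sum_holomorphic])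
  show "open (- \<real>\<^sub>\<le>\<^sub>0 :: complex set)" by (simp add: open_Compl)
  fix x :: complex assume "x \<in> - \<real>\<^sub>\<le>\<^sub>0"
  then obtain d where "d > 0" "cball x d \<subseteq> - \<real>\<^sub>\<le>\<^sub>0"
    using \<open>open (- \<real>\<^sub>\<le>\<^sub>0 :: complex set)\<close> open_contains_cball by blast
  moreover from this have "uniform_limit (cball x d) (\<lambda>N z. lattice_sum q chi z N N) (lattice_limit q chi) sequentially"
    by (intro uniform_limit_lattice_sum) auto
  ultimately show "\<exists>d>0. cball x d \<subseteq> - \<real>\<^sub>\<le>\<^sub>0 \<and>
      uniform_limit (cball x d) (\<lambda>N z. lattice_sum q chi z N N) (lattice_limit q chi) sequentially"
    by blast
qed

end

section \<open>The period function\<close>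

text \<open>The logarithmic derivative of the reflection formula of the Gamma function.\<close>
lemma Digamma_reflection:
  fixes z :: complex
  assumes z: "z \<notin> \<int>"
  shows "Digamma (1 - z) - Digamma z = of_real pi * cos (of_real pi * z) / sin (of_real pi * z)"
proof -
  have z': "1 - z \<notin> \<int>"
    using z by (metis Ints_1 Ints_diff diff_diff_eq2 add_diff_cancel_left')
  have nonpos: "z \<notin> \<int>\<^sub>\<le>\<^sub>0" "1 - z \<notin> \<int>\<^sub>\<le>\<^sub>0"
    using z z' nonpos_Ints_Int by blast+
  have sin0: "sin (of_real pi * z) \<noteq> 0"
    using z by (simp add: sin_eq_0) (metis Ints_of_int mult.commute mult_left_cancel of_real_eq_0_iff pi_neq_zero of_real_of_int_eq)
  have G0: "Gamma z \<noteq> 0" "Gamma (1 - z) \<noteq> 0"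
    using nonpos by (simp_all add: Gamma_eq_zero_iff)
  have "((\<lambda>z. Gamma z * Gamma (1 - z)) has_field_derivative
          Gamma z * Digamma z * Gamma (1 - z) + Gamma z * - (Gamma (1 - z) * Digamma (1 - z))) (at z)"
    using nonpos by (auto intro!: derivative_eq_intros)
  moreover have "((\<lambda>z. of_real pi / sin (of_real pi * z)) has_field_derivative
          - (of_real pi * (of_real pi * cos (of_real pi * z))) / (sin (of_real pi * z) * sin (of_real pi * z))) (at z)"
    using sin0 by (auto intro!: derivative_eq_intros)
  ultimately have "Gamma z * Digamma z * Gamma (1 - z) + Gamma z * - (Gamma (1 - z) * Digamma (1 - z)) =
     - (of_real pi * (of_real pi * cos (of_real pi * z))) / (sin (of_real pi * z) * sin (of_real pi * z))"
    by (simp only: Gamma_reflection_complex) (rule DERIV_unique)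
  moreover have "Gamma z * Digamma z * Gamma (1 - z) + Gamma z * - (Gamma (1 - z) * Digamma (1 - z)) =
      (Gamma z * Gamma (1 - z)) * (Digamma z - Digamma (1 - z))"
    by (simp add: algebra_simps)
  ultimately have "(of_real pi / sin (of_real pi * z)) * (Digamma z - Digamma (1 - z)) =
      (of_real pi / sin (of_real pi * z)) * (- (of_real pi * cos (of_real pi * z) / sin (of_real pi * z)))"
    by (simp add: Gamma_reflection_complex)
  then have "Digamma z - Digamma (1 - z) = - (of_real pi * cos (of_real pi * z) / sin (of_real pi * z))"
    using sin0 by (subst (asm) mult_cancel_left) auto
  then show ?thesis
    by (simp add: algebra_simps)
qed

lemma cot_pi_exp:
  fixes z :: complex
  assumes "z \<notin> \<int>"
  shows "of_real pi * cos (of_real pi * z) / sin (of_real pi * z) =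
           - (of_real pi * \<i>) * (1 + 2 / (exp (- (2 * of_real pi * \<i> * z)) - 1))"
proof -
  define y where "y = exp (\<i> * (of_real pi * z))"
  have y0: "y \<noteq> 0" by (simp add: y_def)
  have y2: "exp (- (2 * of_real pi * \<i> * z)) = inverse (y * y)"
    by (simp add: y_def exp_minus algebra_simps flip: exp_add)
  have "y * y \<noteq> 1"
  proof
    assume "y * y = 1"
    then have "exp (2 * of_real pi * \<i> * z) = 1"
      by (simp add: y_def algebra_simps flip: exp_add)
    then obtain n where "Re (2 * of_real pi * \<i> * z) = 0" "Im (2 * of_real pi * \<i> * z) = of_int (2 * n) * pi"
      unfolding exp_eq_1 by blast
    then have "z = of_int n" by (simp add: complex_eq_iff)
    then show False using assms by simp
  qed
  then show ?thesis
    unfolding y2 sin_exp_eq cos_exp_eq using y0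
    by (simp add: exp_minus divide_simps flip: y_def)
qed


lemma filterlim_finite_subsets_Ico:
  "filterlim (\<lambda>N. {1..<N}) (finite_subsets_at_top {1..}) (sequentially :: nat filter)"
  unfolding filterlim_finite_subsets_at_top
proof (intro allI impI)
  fix X :: "nat set" assume X: "finite X \<and> X \<subseteq> {1..}"
  show "\<forall>\<^sub>F N in sequentially. finite {1..<N} \<and> X \<subseteq> {1..<N} \<and> {1..<N} \<subseteq> {1..}"
    using eventually_gt_at_top[of "Max X"]
  proof eventually_elim
    case (elim N)
    have "x < N" if "x \<in> X" for x
      using Max_ge[of X x] X that elim by linarith
    then show ?case using X by auto
  qed
qed

text \<open>In each residue class the sum of the first \<open>N\<close> reciprocals is \<open>(ln N - Digamma + o(1)) / q\<close>. The logarithms cancel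
  because the values of the character sum to 0.\<close>
lemma dirichlet_Digamma_limit:
  assumes prim: "primitive_character q chi" and q: "q > 1" and v: "Im v \<noteq> 0"
  shows "(\<lambda>N. \<Sum>k\<in>{1..<q * N}. chi (int k) / (v + of_nat k)) \<longlonglongrightarrow>
           - (\<Sum>b<q. chi (int b) * Digamma ((v + of_nat b) / of_nat q)) / of_nat q"
proof -
  note dc = primitive_character_imp_dirichlet[OF prim]
  define x where "x b = (v + of_nat b) / of_nat q" for b :: nat
  have x0: "x b \<noteq> 0" for b
    using v q by (auto simp: x_def complex_eq_iff)
  have "(\<lambda>N. - (\<Sum>b<q. chi (int b) * (of_real (ln (real N)) - (\<Sum>j<N. inverse (x b + of_nat j)))) / of_nat q)
          \<longlonglongrightarrow> - (\<Sum>b<q. chi (int b) * Digamma (x b)) / of_nat q"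
    using q by (intro tendsto_intros Digamma_LIMSEQ x0) auto
  also have "(\<lambda>N. - (\<Sum>b<q. chi (int b) * (of_real (ln (real N)) - (\<Sum>j<N. inverse (x b + of_nat j)))) / of_nat q) =
             (\<lambda>N. \<Sum>k\<in>{1..<q * N}. chi (int k) / (v + of_nat k))"
  proof
    fix N
    have inv: "inverse (x b + of_nat j) = of_nat q * inverse (v + of_nat (b + q * j))" for b j
      using q by (simp add: x_def field_simps)
    have "- (\<Sum>b<q. chi (int b) * (of_real (ln (real N)) - (\<Sum>j<N. inverse (x b + of_nat j)))) / of_nat q =
          - ((\<Sum>b<q. chi (int b)) * of_real (ln (real N))) / of_nat q +
          (\<Sum>b<q. chi (int b) * (\<Sum>j<N. inverse (x b + of_nat j))) / of_nat q"
      by (simp add: ring_distribs sum_subtractf sum_distrib_right diff_divide_distrib)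
    also have "(\<Sum>b<q. chi (int b)) = 0"
      by (rule sum_dirichlet_nat[OF prim q])
    also have "(\<Sum>b<q. chi (int b) * (\<Sum>j<N. inverse (x b + of_nat j))) =
               of_nat q * (\<Sum>b<q. chi (int b) * (\<Sum>j<N. inverse (v + of_nat (b + q * j))))"
      unfolding inv by (simp add: sum_distrib_left mult_ac)
    also have "(\<Sum>b<q. chi (int b) * (\<Sum>j<N. inverse (v + of_nat (b + q * j)))) =
               (\<Sum>k\<in>{1..<q * N}. chi (int k) * inverse (v + of_nat k))"
      by (rule sum_dirichlet_progression[OF dc q, symmetric])
    finally show "- (\<Sum>b<q. chi (int b) * (of_real (ln (real N)) - (\<Sum>j<N. inverse (x b + of_nat j)))) / of_nat q =
             (\<Sum>k\<in>{1..<q * N}. chi (int k) / (v + of_nat k))"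
      using q by (simp add: divide_inverse)
  qed
  finally show ?thesis by (simp add: x_def)
qed

context
  fixes q :: nat and chi :: "int \<Rightarrow> complex"
  assumes prim: "primitive_character q chi" and q: "q > 1"
begin

text \<open>The sum over all nonzero integers of \<open>cnj(\<chi>(k)) / (v + k)\<close>, with \<open>k\<close> and \<open>-k\<close> taken together. The two halves are Digamma
  values at \<open>x\<close> and \<open>1 - x\<close>, so the reflection formula gives a finite sum of cotangents, which is \<open>char_gf\<close>.\<close>
lemma char_gf_partial_fractions:
  assumes v: "Im v \<noteq> 0"
  shows "(\<lambda>N. \<Sum>k\<in>{1..<q * N}. cnj (chi (int k)) * (1 / (v + of_nat k) - chi (- 1) / (- v + of_nat k))) \<longlonglongrightarrow>
           - (2 * of_real pi * \<i> / of_nat q) * gauss_sum q (conj_character chi) *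
             char_gf q chi (- (2 * of_real pi * \<i> * v / of_nat q))"
proof -
  note dc = primitive_character_imp_dirichlet[OF prim]
  note prim' = primitive_character_conj[OF prim]
  have chi0: "chi 0 = 0" using q by (simp add: dirichlet_eq_0_iff[OF dc])
  define x where "x b = (v + of_nat b) / of_nat q" for b :: nat
  have nonint: "x b \<notin> \<int>" for b
    using v q by (auto simp: x_def elim!: Ints_cases simp: complex_eq_iff)
  have lim: "(\<lambda>N. (\<Sum>k\<in>{1..<q * N}. conj_character chi (int k) / (v + of_nat k)) -
             chi (- 1) * (\<Sum>k\<in>{1..<q * N}. conj_character chi (int k) / (- v + of_nat k))) \<longlonglongrightarrow>
        - (\<Sum>b<q. conj_character chi (int b) * Digamma ((v + of_nat b) / of_nat q)) / of_nat q -
        chi (- 1) * (- (\<Sum>b<q. conj_character chi (int b) * Digamma ((- v + of_nat b) / of_nat q)) / of_nat q)"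
    using v by (intro tendsto_intros dirichlet_Digamma_limit[OF prim' q]) auto
  have "(\<Sum>b<q. conj_character chi (int b) * Digamma ((- v + of_nat b) / of_nat q)) =
        (\<Sum>b\<in>{1..<q}. cnj (chi (int b)) * Digamma ((- v + of_nat b) / of_nat q))"
    unfolding conj_character_def using chi0
    by (intro sum.mono_neutral_right) (auto simp: not_le)
  also have "\<dots> = (\<Sum>b\<in>{1..<q}. chi (- 1) * cnj (chi (int b)) * Digamma (1 - x b))"
  proof (rule sum.reindex_bij_witness[of _ "\<lambda>b. q - b" "\<lambda>b. q - b"])
    fix b assume b: "b \<in> {1..<q}"
    have "chi (int (q - b)) = chi (- int b)"
      using b by (intro dirichlet_cong[OF dc]) (simp add: cong_iff_dvd_diff of_nat_diff)
    also have "\<dots> = chi (- 1) * chi (int b)"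
      by (rule dirichlet_minus[OF dc])
    finally have "chi (- 1) * cnj (chi (int (q - b))) = chi (- 1) * chi (- 1) * cnj (chi (int b))"
      by (simp add: dirichlet_minus_1_real[OF dc])
    then have *: "chi (- 1) * cnj (chi (int (q - b))) = cnj (chi (int b))"
      by (simp add: dirichlet_minus_1_square[OF dc])
    have "1 - x (q - b) = (- v + of_nat b) / of_nat q"
      using b q by (simp add: x_def of_nat_diff field_simps)
    with * show "chi (- 1) * cnj (chi (int (q - b))) * Digamma (1 - x (q - b)) =
          cnj (chi (int b)) * Digamma ((- v + of_nat b) / of_nat q)"
      by simp
  qed auto
  also have "\<dots> = chi (- 1) * (\<Sum>b\<in>{1..<q}. cnj (chi (int b)) * Digamma (1 - x b))"
    by (simp add: sum_distrib_left mult_ac)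
  finally have second: "(\<Sum>b<q. conj_character chi (int b) * Digamma ((- v + of_nat b) / of_nat q)) =
      chi (- 1) * (\<Sum>b\<in>{1..<q}. cnj (chi (int b)) * Digamma (1 - x b))" .
  have first: "(\<Sum>b<q. conj_character chi (int b) * Digamma ((v + of_nat b) / of_nat q)) =
        (\<Sum>b\<in>{1..<q}. cnj (chi (int b)) * Digamma (x b))"
    unfolding conj_character_def x_def using chi0
    by (intro sum.mono_neutral_right) (auto simp: not_le)
  have "- (\<Sum>b<q. conj_character chi (int b) * Digamma ((v + of_nat b) / of_nat q)) / of_nat q -
        chi (- 1) * (- (\<Sum>b<q. conj_character chi (int b) * Digamma ((- v + of_nat b) / of_nat q)) / of_nat q) =
        (\<Sum>b\<in>{1..<q}. cnj (chi (int b)) * (Digamma (1 - x b) - Digamma (x b))) / of_nat q"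
    unfolding first second
    by (simp add: mult.assoc[symmetric] dirichlet_minus_1_square[OF dc] ring_distribs sum_subtractf
                  diff_divide_distrib)
  also have "(\<Sum>b\<in>{1..<q}. cnj (chi (int b)) * (Digamma (1 - x b) - Digamma (x b))) =
        (\<Sum>b\<in>{1..<q}. - (of_real pi * \<i>) * cnj (chi (int b)) + - (2 * of_real pi * \<i>) *
          (cnj (chi (int b)) / (exp (- (2 * of_real pi * \<i> * x b)) - 1)))"
    by (intro sum.cong refl) (simp add: Digamma_reflection nonint cot_pi_exp ring_distribs)
  also have "\<dots> = - (of_real pi * \<i>) * (\<Sum>b\<in>{1..<q}. cnj (chi (int b))) + - (2 * of_real pi * \<i>) *
         (\<Sum>b\<in>{1..<q}. cnj (chi (int b)) / (exp (- (2 * of_real pi * \<i> * x b)) - 1))"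
    unfolding sum.distrib sum_distrib_left ..
  also have "(\<Sum>b\<in>{1..<q}. cnj (chi (int b))) = (\<Sum>k\<in>{1..<int q}. cnj (chi k))"
    by (rule sum.reindex_bij_witness[of _ nat int]) auto
  also have "\<dots> = 0"
    by (rule sum_cnj_char_eq_0[OF prim q])
  also have "(\<Sum>b\<in>{1..<q}. cnj (chi (int b)) / (exp (- (2 * of_real pi * \<i> * x b)) - 1)) =
             (\<Sum>k\<in>{1..<int q}. cnj (chi k) /
                (exp (- (2 * of_real pi * \<i> * v / of_nat q)) * add_char q (- k) - 1))"
  proof (rule sum.reindex_bij_witness[of _ nat int])
    fix b assume "b \<in> {1..<q}"
    have "- (2 * of_real pi * \<i> * x b) = - (2 * of_real pi * \<i> * v / of_nat q) - gf_pole q (int b)"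
      using q by (simp add: x_def gf_pole_def field_simps)
    then show "cnj (chi (int b)) / (exp (- (2 * of_real pi * \<i> * v / of_nat q)) * add_char q (- int b) - 1) =
        cnj (chi (int b)) / (exp (- (2 * of_real pi * \<i> * x b)) - 1)"
      by (simp only: exp_mult_add_char_minus)
  qed auto
  also have "\<dots> = gauss_sum q (conj_character chi) * char_gf q chi (- (2 * of_real pi * \<i> * v / of_nat q))"
    using gauss_sum_neq_0[OF prim' q] by (simp add: char_gf_def)
  finally have val: "- (\<Sum>b<q. conj_character chi (int b) * Digamma ((v + of_nat b) / of_nat q)) / of_nat q -
        chi (- 1) * (- (\<Sum>b<q. conj_character chi (int b) * Digamma ((- v + of_nat b) / of_nat q)) / of_nat q) =
        - (2 * of_real pi * \<i> / of_nat q) * gauss_sum q (conj_character chi) *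
             char_gf q chi (- (2 * of_real pi * \<i> * v / of_nat q))"
    by simp
  have "(\<Sum>k\<in>{1..<q * N}. conj_character chi (int k) / (v + of_nat k)) -
             chi (- 1) * (\<Sum>k\<in>{1..<q * N}. conj_character chi (int k) / (- v + of_nat k)) =
        (\<Sum>k\<in>{1..<q * N}. cnj (chi (int k)) * (1 / (v + of_nat k) - chi (- 1) / (- v + of_nat k)))" for N
    unfolding sum_distrib_left sum_subtractf[symmetric]
    by (intro sum.cong refl) (simp add: conj_character_def algebra_simps)
  with lim show ?thesis
    unfolding val by simp
qed

text \<open>The series converges absolutely, so its value is the limit of the partial sums over whole periods.\<close>
lemma char_gf_has_sum:
  assumes u: "Re u > 0"
  shows "((\<lambda>k. chi (int k) * exp (- (of_nat k * u))) has_sum char_gf q chi u) {1..}"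
proof -
  note dc = primitive_character_imp_dirichlet[OF prim]
  have summ: "(\<lambda>k. norm (chi (int k) * exp (- (of_nat k * u)))) summable_on {1..}"
  proof (rule summable_on_comparison_test)
    have "(\<lambda>k. exp (- Re u) ^ k) summable_on (UNIV :: nat set)"
      using u by (intro norm_summable_imp_summable_on) (auto simp: summable_geometric)
    then show "(\<lambda>k. exp (- Re u) ^ k) summable_on {1::nat..}"
      by (rule summable_on_subset_banach) auto
    show "norm (chi (int k) * exp (- (of_nat k * u))) \<le> exp (- Re u) ^ k" for k
    proof -
      have "norm (exp (- (of_nat k * u))) = exp (- Re u) ^ k"
        unfolding exp_of_nat_mult[symmetric] norm_exp_eq_Re by simp
      then show ?thesis
        using norm_dirichlet_le[OF dc, of "int k"] by (simp add: norm_mult mult_left_le_one_le)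
    qed
  qed auto
  then obtain S where S: "((\<lambda>k. chi (int k) * exp (- (of_nat k * u))) has_sum S) {1..}"
    using abs_summable_summable[OF summ] by (auto simp: summable_on_def)
  have "(\<lambda>N. \<Sum>k\<in>{1..<N}. chi (int k) * exp (- (of_nat k * u))) \<longlonglongrightarrow> S"
    using S unfolding has_sum_def
    by (rule filterlim_compose) (rule filterlim_finite_subsets_Ico)
  moreover have "filterlim (\<lambda>N. q * N) at_top sequentially"
    using q by (intro mult_nat_left_at_top) auto
  ultimately have "(\<lambda>N. \<Sum>k\<in>{1..<q*N}. chi (int k) * exp (- (of_nat k * u))) \<longlonglongrightarrow> S"
    by (rule filterlim_compose)
  moreover have "(\<lambda>N. \<Sum>k\<in>{1..<q*N}. chi (int k) * exp (- (of_nat k * u))) \<longlonglongrightarrow> char_gf q chi u * (1 - 0)"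
  proof -
    have "exp (of_nat q * u) \<noteq> 1"
      using u q exp_neq_1_Re[of "of_nat q * u"] by simp
    then have eq: "(\<lambda>N. \<Sum>k\<in>{1..<q*N}. chi (int k) * exp (- (of_nat k * u))) =
            (\<lambda>N. char_gf q chi u * (1 - exp (- (of_nat (q * N) * u))))"
      using char_gf_partial_sum[OF prim q] by blast
    have "(\<lambda>N. exp (- (real (q * N) * Re u))) \<longlonglongrightarrow> 0"
      using u q by real_asymp
    then have "(\<lambda>N. exp (- (of_nat (q * N) * u))) \<longlonglongrightarrow> 0"
      by (rule Lim_null_comparison[rotated]) auto
    then show ?thesis
      unfolding eq by (intro tendsto_intros)
  qed
  ultimately have "S = char_gf q chi u"
    using LIMSEQ_unique by fastforce
  with S show ?thesis by simp
qed

text \<open>As \<open>d(n)\<close> counts the factorisations \<open>n = m k\<close>, the series of \<open>E_chi\<close> is an absolutely convergent double series over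
  \<open>m\<close> and \<open>k\<close>. Its inner sums over \<open>k\<close> are values of \<open>char_gf\<close>.\<close>
lemma E_chi_limit:
  assumes z: "Im z > 0"
  shows "(\<lambda>M. \<Sum>m\<in>{1..<q * M}. chi (int m) * char_gf q chi (- (2 * of_real pi * \<i> * (of_nat m * z) / of_nat q))) \<longlonglongrightarrow>
           gauss_sum q chi * E_chi q chi z"
proof -
  note dc = primitive_character_imp_dirichlet[OF prim]
  define u where "u m = - (2 * of_real pi * \<i> * (of_nat m * z) / of_nat q)" for m :: nat
  define r where "r = exp (- (2 * pi * Im z / real q))"
  have r: "0 < r" "r < 1" using z q by (auto simp: r_def)
  define f where "f = (\<lambda>(m, k). chi (int m) * (chi (int k) * exp (- (of_nat k * u m))))"
  define g where "g = (\<lambda>(n, d :: nat). chi (int n) * expi (of_nat n * z / of_nat q))"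
  have exp_u: "exp (- (of_nat k * u m)) = expi (of_nat (m * k) * z / of_nat q)" for m k
    by (simp add: u_def expi_def mult_ac)
  have norm_exp_u: "norm (exp (- (of_nat k * u m))) = r ^ (m * k)" for m k
    unfolding r_def exp_of_nat_mult[symmetric] norm_exp_eq_Re by (simp add: u_def mult_ac)
  have summ: "f summable_on {1..} \<times> {1..}"
  proof -
    have geo: "(\<lambda>k. r ^ k) summable_on (UNIV :: nat set)"
      using r by (intro norm_summable_imp_summable_on) (auto simp: summable_geometric)
    have "(\<lambda>(m, k). r ^ m * r ^ k) summable_on (UNIV :: nat set) \<times> (UNIV :: nat set)"
    proof (rule summable_on_SigmaI)
      fix m :: nat
      have "((\<lambda>k. r ^ k) has_sum infsum (\<lambda>k. r ^ k) (UNIV :: nat set)) UNIV"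
        using geo by (rule has_sum_infsum)
      from has_sum_cmult_right[OF this, of "r ^ m"]
      show "((\<lambda>k. case (m, k) of (m, k) \<Rightarrow> r ^ m * r ^ k) has_sum
               r ^ m * infsum (\<lambda>k. r ^ k) (UNIV :: nat set)) UNIV"
        by simp
    next
      show "(\<lambda>m. r ^ m * infsum (\<lambda>k. r ^ k) (UNIV :: nat set)) summable_on UNIV"
        using geo by (rule summable_on_cmult_left)
    qed (use r in auto)
    then have "(\<lambda>x. inverse r * (case x of (m, k) \<Rightarrow> r ^ m * r ^ k)) summable_on (UNIV :: nat set) \<times> (UNIV :: nat set)"
      by (rule summable_on_cmult_right)
    then have "(\<lambda>x. inverse r * (case x of (m, k) \<Rightarrow> r ^ m * r ^ k)) summable_on {1::nat..} \<times> {1::nat..}"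
      by (rule summable_on_subset_banach) auto
    then have "(\<lambda>x. norm (f x)) summable_on {1..} \<times> {1..}"
    proof (rule summable_on_comparison_test)
      fix x :: "nat \<times> nat" assume "x \<in> {1..} \<times> {1..}"
      then obtain m k where x: "x = (Suc m, Suc k)"
        by (cases x) (auto simp: Suc_le_eq gr0_conv_Suc)
      have "norm (f x) \<le> 1 * (1 * r ^ (Suc m * Suc k))"
        unfolding f_def x prod.case norm_mult norm_exp_u using r
        by (intro mult_mono norm_dirichlet_le[OF dc]) auto
      also have "r ^ (Suc m * Suc k) \<le> r ^ (m + Suc k)"
        using r by (intro power_decreasing) auto
      also have "r ^ (m + Suc k) = inverse r * (r ^ Suc m * r ^ Suc k)"
        using r by (simp add: power_add)
      finally show "norm (f x) \<le> inverse r * (case x of (m, k) \<Rightarrow> r ^ m * r ^ k)"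
        by (simp add: x)
    qed auto
    then show ?thesis
      by (rule abs_summable_summable)
  qed
  define S where "S = infsum f ({1..} \<times> {1..})"
  have S: "(f has_sum S) ({1..} \<times> {1..})"
    using summ by (simp add: S_def)
  have "((\<lambda>m. chi (int m) * char_gf q chi (u m)) has_sum S) {1..}"
  proof (rule has_sum_SigmaD[OF S])
    fix m :: nat assume m: "m \<in> {1..}"
    have "Re (u m) > 0"
      using m z q by (simp add: u_def)
    then show "((\<lambda>k. f (m, k)) has_sum chi (int m) * char_gf q chi (u m)) {1..}"
      unfolding f_def prod.case by (intro has_sum_cmult_right char_gf_has_sum)
  qed
  then have "(\<lambda>N. \<Sum>m\<in>{1..<N}. chi (int m) * char_gf q chi (u m)) \<longlonglongrightarrow> S"
    unfolding has_sum_def by (rule filterlim_compose) (rule filterlim_finite_subsets_Ico)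
  moreover have "filterlim (\<lambda>N. q * N) at_top sequentially"
    using q by (intro mult_nat_left_at_top) auto
  ultimately have lim: "(\<lambda>M. \<Sum>m\<in>{1..<q * M}. chi (int m) * char_gf q chi (u m)) \<longlonglongrightarrow> S"
    by (rule filterlim_compose)
  have "(g has_sum S) (Sigma {1..} (\<lambda>n. {d. d dvd n}))"
  proof (subst has_sum_reindex_bij_witness[of _ "\<lambda>(m, k). (m * k, m)" "\<lambda>(n, d). (d, n div d)" "{1..} \<times> {1..}" f g S S])
    fix x :: "nat \<times> nat" assume "x \<in> Sigma {1..} (\<lambda>n. {d. d dvd n})"
    then obtain d k where x: "x = (d * k, d)" "d > 0" "k > 0"
      by (cases x) (auto elim!: dvdE)
    then show "(case (case x of (n, d) \<Rightarrow> (d, n div d)) of (m, k) \<Rightarrow> (m * k, m)) = x"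
              "(case x of (n, d) \<Rightarrow> (d, n div d)) \<in> {1..} \<times> {1..}"
              "f (case x of (n, d) \<Rightarrow> (d, n div d)) = g x"
      by (auto simp: f_def g_def exp_u dirichlet_mult[OF dc] mult_ac)
  next
    fix y :: "nat \<times> nat" assume "y \<in> {1..} \<times> {1..}"
    then show "(case (case y of (m, k) \<Rightarrow> (m * k, m)) of (n, d) \<Rightarrow> (d, n div d)) = y"
              "(case y of (m, k) \<Rightarrow> (m * k, m)) \<in> (SIGMA n:{1..}. {d. d dvd n})"
      by auto
  qed (use S in auto)
  then have "((\<lambda>n. chi (int n) * of_nat (divisor_count n) * expi (of_nat n * z / of_nat q)) has_sum S) {1..}"
  proof (rule has_sum_SigmaD)
    fix n :: nat assume n: "n \<in> {1..}"
    have "((\<lambda>d. g (n, d)) has_sum (\<Sum>d\<in>{d. d dvd n}. g (n, d))) {d. d dvd n}"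
      using n by (intro has_sum_finite) auto
    then show "((\<lambda>d. g (n, d)) has_sum chi (int n) * of_nat (divisor_count n) * expi (of_nat n * z / of_nat q)) {d. d dvd n}"
      by (simp add: g_def divisor_count_def mult_ac)
  qed
  then have "E_chi q chi z = 1 / gauss_sum q chi * S"
    by (simp add: E_chi_def infsumI)
  then show ?thesis
    using lim gauss_sum_neq_0[OF prim q] by (simp add: u_def)
qed

text \<open>Let first \<open>N\<close> and then \<open>M\<close> tend to infinity in the sum over \<open>m < q M\<close> and \<open>0 < |k| < q N\<close>. The first limit is a sum of
  partial fraction expansions, the second is \<open>E_chi_limit\<close>. That the iterated limit agrees with
  the limit along \<open>M = N\<close> follows from the error bound \<open>O(1/M + 1/N)\<close>.\<close>
lemma E_chi_eq_lattice_limit: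
  assumes z: "Im z > 0"
  shows "E_chi q chi z = chi (- 1) * \<i> / (2 * of_real pi) * (lattice_limit q chi z - chi (- 1) * lattice_limit q chi (- z))"
proof -
  note dc = primitive_character_imp_dirichlet[OF prim]
  define T where "T = gauss_sum q (conj_character chi)"
  define L where "L = lattice_limit q chi z - chi (- 1) * lattice_limit q chi (- z)"
  \<comment> \<open>multiplied by \<open>-\<chi>(-1)\<close>, the terms of \<open>L(-z)\<close> with index \<open>k\<close> are those of the series for \<open>E_chi\<close> with index \<open>-k\<close>\<close>
  define D where "D M N = lattice_sum q chi z M N - chi (- 1) * lattice_sum q chi (- z) M N" for M N
  define c where "c = - (2 * of_real pi * \<i> / of_nat q) * T"
  define H where "H M = (\<Sum>m\<in>{1..<q * M}. chi (int m) * char_gf q chi (- (2 * of_real pi * \<i> * (of_nat m * z) / of_nat q)))" for M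
  have nz: "z \<notin> \<real>\<^sub>\<le>\<^sub>0" "- z \<notin> \<real>\<^sub>\<le>\<^sub>0"
    using z by (auto simp: complex_nonpos_Reals_iff)
  obtain C1 where C1: "\<And>M N. M > 0 \<Longrightarrow> N > 0 \<Longrightarrow> norm (lattice_sum q chi z M N - lattice_limit q chi z) \<le> C1 * (1 / real M + 1 / real N)"
    using lattice_sum_lattice_limit[OF prim q nz(1)] by blast
  obtain C2 where C2: "\<And>M N. M > 0 \<Longrightarrow> N > 0 \<Longrightarrow> norm (lattice_sum q chi (- z) M N - lattice_limit q chi (- z)) \<le> C2 * (1 / real M + 1 / real N)"
    using lattice_sum_lattice_limit[OF prim q nz(2)] by blast
  have D: "norm (D M N - L) \<le> (C1 + C2) * (1 / real M + 1 / real N)" if "M > 0" "N > 0" for M N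
  proof -
    have "D M N - L = (lattice_sum q chi z M N - lattice_limit q chi z) -
                      chi (- 1) * (lattice_sum q chi (- z) M N - lattice_limit q chi (- z))"
      by (simp add: D_def L_def algebra_simps)
    also have "norm \<dots> \<le> norm (lattice_sum q chi z M N - lattice_limit q chi z) +
                        norm (lattice_sum q chi (- z) M N - lattice_limit q chi (- z))"
      using norm_triangle_ineq4 by (simp add: norm_dirichlet[OF dc] norm_mult order_trans[OF norm_triangle_ineq4])
    also have "\<dots> \<le> (C1 + C2) * (1 / real M + 1 / real N)"
      using C1[OF that] C2[OF that] by (simp add: ring_distribs add_divide_distrib)
    finally show ?thesis .
  qed
  have inner: "(\<lambda>N. D M N) \<longlonglongrightarrow> c * H M" for M
  proof -
    have "D M N = (\<Sum>m\<in>{1..<q * M}. chi (int m) * (\<Sum>k\<in>{1..<q * N}. cnj (chi (int k)) *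
            (1 / (of_nat m * z + of_nat k) - chi (- 1) / (- (of_nat m * z) + of_nat k))))" for N
      unfolding D_def lattice_sum_def sum_distrib_left sum_subtractf[symmetric]
      by (intro sum.cong refl) (simp add: ring_distribs)
    moreover have "(\<lambda>N. \<Sum>m\<in>{1..<q * M}. chi (int m) * (\<Sum>k\<in>{1..<q * N}. cnj (chi (int k)) *
            (1 / (of_nat m * z + of_nat k) - chi (- 1) / (- (of_nat m * z) + of_nat k)))) \<longlonglongrightarrow>
          (\<Sum>m\<in>{1..<q * M}. chi (int m) * (- (2 * of_real pi * \<i> / of_nat q) * gauss_sum q (conj_character chi) *
             char_gf q chi (- (2 * of_real pi * \<i> * (of_nat m * z) / of_nat q))))"
      using z by (intro tendsto_sum tendsto_mult tendsto_const char_gf_partial_fractions) auto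
    moreover have "(\<Sum>m\<in>{1..<q * M}. chi (int m) * (- (2 * of_real pi * \<i> / of_nat q) * gauss_sum q (conj_character chi) *
             char_gf q chi (- (2 * of_real pi * \<i> * (of_nat m * z) / of_nat q)))) = c * H M"
      unfolding H_def c_def T_def sum_distrib_left by (simp add: mult_ac)
    ultimately show ?thesis by simp
  qed
  have HL: "norm (c * H M - L) \<le> (C1 + C2) * (1 / real M)" if M: "M > 0" for M
  proof (rule LIMSEQ_le)
    show "(\<lambda>N. norm (D M N - L)) \<longlonglongrightarrow> norm (c * H M - L)"
      by (intro tendsto_intros inner)
    have "(\<lambda>N. (C1 + C2) * (1 / real M + 1 / real N)) \<longlonglongrightarrow> (C1 + C2) * (1 / real M + 0)"
      by (intro tendsto_intros lim_1_over_n)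
    then show "(\<lambda>N. (C1 + C2) * (1 / real M + 1 / real N)) \<longlonglongrightarrow> (C1 + C2) * (1 / real M)"
      by simp
    show "\<exists>N0. \<forall>N\<ge>N0. norm (D M N - L) \<le> (C1 + C2) * (1 / real M + 1 / real N)"
      using D[OF M] by (intro exI[of _ 1]) auto
  qed
  have "(\<lambda>M. (C1 + C2) * (1 / real M)) \<longlonglongrightarrow> 0"
    by real_asymp
  then have "(\<lambda>M. c * H M - L) \<longlonglongrightarrow> 0"
    by (rule Lim_null_comparison[rotated])
       (use HL in \<open>auto intro!: eventually_mono[OF eventually_gt_at_top[of 0]]\<close>)
  then have "(\<lambda>M. c * H M) \<longlonglongrightarrow> L"
    by (simp add: LIM_zero_iff)
  moreover have "(\<lambda>M. c * H M) \<longlonglongrightarrow> c * (gauss_sum q chi * E_chi q chi z)"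
    unfolding H_def by (intro tendsto_intros E_chi_limit z)
  ultimately have "L = c * (gauss_sum q chi * E_chi q chi z)"
    by (rule LIMSEQ_unique)
  also have "\<dots> = - (2 * of_real pi * \<i> / of_nat q) * (gauss_sum q chi * T) * E_chi q chi z"
    by (simp add: c_def)
  also have "gauss_sum q chi * T = chi (- 1) * of_nat q"
    unfolding T_def by (rule gauss_sum_mult_conj[OF prim q])
  finally have "L = - (2 * of_real pi * \<i>) * chi (- 1) * E_chi q chi z"
    using q by simp
  then have "chi (- 1) * \<i> / (2 * of_real pi) * L = (chi (- 1) * chi (- 1)) * E_chi q chi z"
    by (simp add: field_simps)
  then show ?thesis
    by (simp add: L_def dirichlet_minus_1_square[OF dc])
qed

lemma lattice_sum_tendsto:
  assumes "z \<notin> \<real>\<^sub>\<le>\<^sub>0"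
  shows "(\<lambda>N. lattice_sum q chi z N N) \<longlonglongrightarrow> lattice_limit q chi z"
proof -
  have "uniform_limit {z} (\<lambda>N z. lattice_sum q chi z N N) (lattice_limit q chi) sequentially"
    using assms by (intro uniform_limit_lattice_sum[OF prim q]) auto
  then show ?thesis
    by (rule tendsto_uniform_limitI) auto
qed

end

lemma lattice_sum_reciprocal:
  assumes z: "z \<noteq> 0"
  shows "lattice_sum q (conj_character chi) (1 / z) N N = z * lattice_sum q chi z N N"
proof -
  have "lattice_sum q (conj_character chi) (1 / z) N N =
        (\<Sum>m\<in>{1..<q * N}. \<Sum>n\<in>{1..<q * N}. z * (chi (int n) * cnj (chi (int m)) / (of_nat n * z + of_nat m)))"
    unfolding lattice_sum_def
  proof (intro sum.cong refl)
    fix m n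
    have "of_nat m * (1 / z) + of_nat n = (of_nat n * z + of_nat m) / z"
      using z by (simp add: field_simps)
    then show "conj_character chi (int m) * cnj (conj_character chi (int n)) / (of_nat m * (1 / z) + of_nat n) =
               z * (chi (int n) * cnj (chi (int m)) / (of_nat n * z + of_nat m))"
      by (simp add: conj_character_def)
  qed
  also have "\<dots> = z * lattice_sum q chi z N N"
    by (subst sum.swap) (simp add: lattice_sum_def sum_distrib_left)
  finally show ?thesis .
qed

lemma lattice_limit_reciprocal:
  assumes prim: "primitive_character q chi" and q: "q > 1" and z: "z \<notin> \<real>\<^sub>\<le>\<^sub>0"
  shows "lattice_limit q (conj_character chi) (1 / z) = z * lattice_limit q chi z"
proof -
  have z0: "z \<noteq> 0" using z by auto
  have "1 / z \<notin> \<real>\<^sub>\<le>\<^sub>0"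
  proof
    assume "1 / z \<in> \<real>\<^sub>\<le>\<^sub>0"
    then obtain r where r: "r \<le> 0" "1 / z = of_real r"
      by (auto elim!: nonpos_Reals_cases)
    have "z = 1 / (1 / z)" by simp
    also have "\<dots> = of_real (1 / r)" unfolding r(2) by simp
    finally have "z = of_real (1 / r)" .
    moreover have "1 / r \<le> 0" using r(1) by simp
    ultimately show False
      using z by (metis nonpos_Reals_of_real_iff)
  qed
  then have "(\<lambda>N. lattice_sum q (conj_character chi) (1 / z) N N) \<longlonglongrightarrow> lattice_limit q (conj_character chi) (1 / z)"
    by (rule lattice_sum_tendsto[OF primitive_character_conj[OF prim] q])
  moreover have "(\<lambda>N. lattice_sum q (conj_character chi) (1 / z) N N) \<longlonglongrightarrow> z * lattice_limit q chi z"
    unfolding lattice_sum_reciprocal[OF z0]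
    by (intro tendsto_intros lattice_sum_tendsto[OF prim q z])
  ultimately show ?thesis
    by (rule LIMSEQ_unique)
qed

context
  fixes q :: nat and chi :: "int \<Rightarrow> complex"
  assumes prim: "primitive_character q chi" and q: "q > 1"
begin

text \<open>The symmetry of \<open>L\<close> under \<open>z \<mapsto> 1/z\<close> expresses \<open>E_chi\<close> of the conjugate character at \<open>-1/z\<close> through \<open>L(z)\<close> and
  \<open>L(-z)\<close> again; the contributions of \<open>L(-z)\<close> cancel.\<close>
lemma psi_upper_eq:
  assumes z: "Im z > 0"
  shows "psi_upper q chi z = chi (- 1) * \<i> / of_real pi * lattice_limit q chi z"
proof -
  note dc = primitive_character_imp_dirichlet[OF prim]
  note prim' = primitive_character_conj[OF prim]
  have nz: "z \<notin> \<real>\<^sub>\<le>\<^sub>0" "- z \<notin> \<real>\<^sub>\<le>\<^sub>0" and z0: "z \<noteq> 0"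
    using z by (auto simp: complex_nonpos_Reals_iff)
  have conj1: "conj_character chi (- 1) = chi (- 1)"
    by (simp add: conj_character_def dirichlet_minus_1_real[OF dc])
  have "Im (- (1 / z)) > 0"
    using z by (simp add: Im_divide power2_eq_square sum_power2_gt_zero_iff) (auto intro!: divide_pos_pos simp: add_pos_nonneg sum_squares_gt_zero_iff)
  from E_chi_eq_lattice_limit[OF prim' q this]
  have E2: "E_chi q (conj_character chi) (- (1 / z)) =
        chi (- 1) * \<i> / (2 * of_real pi) * (lattice_limit q (conj_character chi) (1 / (- z)) -
          chi (- 1) * lattice_limit q (conj_character chi) (1 / z))"
    by (simp add: conj1)
  have alg: "e * \<i> / (2 * of_real pi) * (x - e * y) - e / z * (e * \<i> / (2 * of_real pi) * (- z * y - e * (z * x))) =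
      e * \<i> / of_real pi * x" if "e * e = 1" for e x y :: complex
  proof -
    define k where "k = \<i> / (2 * complex_of_real pi)"
    have "e * k * (x - e * y) - e / z * (e * k * (- z * y - e * (z * x))) = e * k * x + (e * e) * (e * k * x)"
      using z0 by (simp add: field_simps)
    then show ?thesis
      using that by (simp add: k_def)
  qed
  show ?thesis
    unfolding psi_upper_def E2 E_chi_eq_lattice_limit[OF prim q z]
      lattice_limit_reciprocal[OF prim q nz(1)] lattice_limit_reciprocal[OF prim q nz(2)]
    by (rule alg) (rule dirichlet_minus_1_square[OF dc])
qed

text \<open>The chosen continuation and the one at hand agree on the upper half-plane, hence on the connected slit plane.\<close>
lemma psi_chi_eq:
  assumes z: "z \<notin> \<real>\<^sub>\<le>\<^sub>0"
  shows "psi_chi q chi z = chi (- 1) * \<i> / of_real pi * lattice_limit q chi z"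
proof -
  define L where "L z = chi (- 1) * \<i> / of_real pi * lattice_limit q chi z" for z
  define P where "P f \<longleftrightarrow> f holomorphic_on (- \<real>\<^sub>\<le>\<^sub>0) \<and> (\<forall>z. Im z > 0 \<longrightarrow> f z = psi_upper q chi z)" for f
  have L: "L holomorphic_on (- \<real>\<^sub>\<le>\<^sub>0)"
    unfolding L_def by (intro holomorphic_intros lattice_limit_holomorphic[OF prim q]) auto
  have "P L"
    using L psi_upper_eq by (simp add: P_def L_def)
  then have "P (SOME f. P f)"
    by (rule someI[of P])
  then have psi: "P (psi_chi q chi)"
    by (simp add: P_def psi_chi_def)
  have "psi_chi q chi z = L z"
  proof (rule analytic_continuation_open[where s = "{z. Im z > 0}" and s' = "- \<real>\<^sub>\<le>\<^sub>0"
                                             and f = "psi_chi q chi" and g = L and z = z])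
    show "open {z. Im z > 0}" "open (- \<real>\<^sub>\<le>\<^sub>0 :: complex set)"
      by (auto intro!: open_Collect_less continuous_intros simp: open_Compl)
    have "\<i> \<in> {z. Im z > 0}" by simp
    then show "{z. Im z > 0} \<noteq> {}" by blast
    have "\<real>\<^sub>\<le>\<^sub>0 = complex_of_real ` {..0}"
      by (auto simp: nonpos_Reals_def)
    then have "starlike (- \<real>\<^sub>\<le>\<^sub>0 :: complex set)"
      using starlike_slotted_complex_plane_left[of 0] by simp
    then show "connected (- \<real>\<^sub>\<le>\<^sub>0 :: complex set)"
      by (rule starlike_imp_connected)
    show "{z. Im z > 0} \<subseteq> - \<real>\<^sub>\<le>\<^sub>0"
      by (auto simp: complex_nonpos_Reals_iff)
  qed (use psi \<open>P L\<close> z in \<open>auto simp: P_def\<close>)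
  then show ?thesis by (simp add: L_def)
qed

end

section \<open>Taylor coefficients as integrals over the real line\<close>

text \<open>Cauchy's inequality on a circle of radius between \<open>|s|\<close> and \<open>r\<close> dominates the Taylor series of \<open>g t\<close> by \<open>B t\<close> times
  a geometric series, so it may be integrated term by term.\<close>
lemma integral_power_series:
  fixes g :: "real \<Rightarrow> complex \<Rightarrow> complex" and B :: "real \<Rightarrow> real"
  assumes hol: "\<And>t. g t holomorphic_on ball 0 r"
    and bound: "\<And>t s. s \<in> ball 0 r \<Longrightarrow> norm (g t s) \<le> B t"
    and B: "integrable lborel B"
    and meas: "\<And>j. (\<lambda>t. (deriv ^^ j) (g t) 0) \<in> borel_measurable lborel"
    and s: "s \<in> ball 0 r"
  shows "(\<lambda>j. (\<integral>t. (deriv ^^ j) (g t) 0 \<partial>lborel) / fact j * s ^ j) sums (\<integral>t. g t s \<partial>lborel)"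
proof -
  define \<rho> where "\<rho> = (norm s + r) / 2"
  have \<rho>: "norm s < \<rho>" "\<rho> < r" "0 < \<rho>"
  proof -
    have "norm s < r" using s by simp
    then show "norm s < \<rho>" "\<rho> < r" unfolding \<rho>_def by simp_all
    then show "0 < \<rho>" using norm_ge_zero[of s] by linarith
  qed
  define f where "f j t = (deriv ^^ j) (g t) 0 / fact j * s ^ j" for j t
  have fB: "norm (f j t) \<le> B t * (norm s / \<rho>) ^ j" for j t
  proof -
    have "cball 0 \<rho> \<subseteq> ball 0 r" "ball 0 \<rho> \<subseteq> ball (0::complex) r"
      using \<rho> by auto
    then have "norm ((deriv ^^ j) (g t) 0) \<le> fact j * B t / \<rho> ^ j"
      using \<rho> by (intro Cauchy_inequality holomorphic_on_imp_continuous_on bound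
                     holomorphic_on_subset[OF hol]) auto
    then have "norm ((deriv ^^ j) (g t) 0) / fact j * norm s ^ j \<le> (fact j * B t / \<rho> ^ j) / fact j * norm s ^ j"
      by (intro mult_right_mono divide_right_mono) auto
    also have "\<dots> = B t * (norm s / \<rho>) ^ j"
      by (simp add: power_divide)
    finally show ?thesis
      by (simp add: f_def norm_mult norm_divide norm_power)
  qed
  have Bpos: "B t \<ge> 0" for t
    using order_trans[OF norm_ge_zero bound[OF s]] .
  have int: "integrable lborel (f j)" for j
  proof (rule Bochner_Integration.integrable_bound)
    show "integrable lborel (\<lambda>t. B t * (norm s / \<rho>) ^ j)"
      using B by simp
    show "f j \<in> borel_measurable lborel"
      using meas[of j] unfolding f_def by simp
    show "AE t in lborel. norm (f j t) \<le> norm (B t * (norm s / \<rho>) ^ j)"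
      using fB Bpos \<rho> by (intro AE_I2) (simp add: abs_mult)
  qed
  have geo: "summable (\<lambda>j. (norm s / \<rho>) ^ j)"
    using \<rho> by (intro summable_geometric) auto
  have series: "(\<lambda>j. f j t) sums g t s" for t
    using holomorphic_power_series[OF hol s, of t] by (simp add: f_def)
  have "(\<lambda>j. integral\<^sup>L lborel (f j)) sums (\<integral>t. (\<Sum>j. f j t) \<partial>lborel)"
  proof (rule sums_integral[OF int])
    have "summable (\<lambda>j. norm (f j t))" for t
      using summable_mult[OF geo, of "B t"] by (rule summable_comparison_test') (use fB in auto)
    then show "AE t in lborel. summable (\<lambda>j. norm (f j t))"
      by simp
    have "norm (\<integral>t. norm (f j t) \<partial>lborel) \<le> integral\<^sup>L lborel B * (norm s / \<rho>) ^ j" for j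
    proof -
      have "(\<integral>t. norm (f j t) \<partial>lborel) \<le> (\<integral>t. B t * (norm s / \<rho>) ^ j \<partial>lborel)"
        using int[of j] B fB[of j] by (intro integral_mono) auto
      then show ?thesis by simp
    qed
    with summable_mult[OF geo, of "integral\<^sup>L lborel B"] show "summable (\<lambda>j. \<integral>t. norm (f j t) \<partial>lborel)"
      by (rule summable_comparison_test'[where N = 0])
  qed
  also have "(\<lambda>t. \<Sum>j. f j t) = (\<lambda>t. g t s)"
    using series[THEN sums_unique] by simp
  finally show ?thesis
    by (simp add: f_def)
qed

lemma even_integral_lborel:
  fixes f :: "real \<Rightarrow> 'a :: {banach, second_countable_topology}"
  assumes meas: "f \<in> borel_measurable lborel"
    and even: "\<And>t. t > 0 \<Longrightarrow> f (- t) = f t"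
    and int: "integrable halfline f"
  shows "has_bochner_integral lborel f (2 *\<^sub>R integral\<^sup>L halfline f)"
proof -
  define h where "h t = indicator {0<..} t *\<^sub>R f t" for t
  have h: "has_bochner_integral lborel h (integral\<^sup>L halfline f)"
    using int unfolding h_def by (simp add: has_bochner_integral_iff integrable_restrict_space integral_restrict_space)
  have "integrable lborel h" using h by (simp add: has_bochner_integral_iff)
  then have "integrable lborel (\<lambda>t. h (0 + (- 1) * t))"
    by (rule lborel_integrable_real_affine) simp
  moreover have "integral\<^sup>L lborel h = (\<integral>t. h (0 + (- 1) * t) \<partial>lborel)"
    by (subst lborel_integral_real_affine[of "- 1" h 0]) auto
  ultimately have h': "has_bochner_integral lborel (\<lambda>t. h (- t)) (integral\<^sup>L halfline f)"
    using h by (simp add: has_bochner_integral_iff)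
  have "has_bochner_integral lborel (\<lambda>t. h t + h (- t)) (integral\<^sup>L halfline f + integral\<^sup>L halfline f)"
    by (intro has_bochner_integral_add h h')
  also have "?this \<longleftrightarrow> has_bochner_integral lborel f (integral\<^sup>L halfline f + integral\<^sup>L halfline f)"
  proof (rule has_bochner_integral_cong_AE)
    show "(\<lambda>t. h t + h (- t)) \<in> borel_measurable lborel"
      using h h' by (auto simp: has_bochner_integral_iff intro!: borel_measurable_add)
    have "AE t in lborel. t \<noteq> (0 :: real)"
      by (rule AE_lborel_singleton)
    then show "AE t in lborel. h t + h (- t) = f t"
    proof eventually_elim
      case (elim t)
      then show ?case
        using even[of t] even[of "- t"] by (cases "t > 0") (auto simp: h_def)
    qed
  qed fact
  finally show ?thesis
    by (simp add: scaleR_2)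
qed

lemma integrable_exp_abs:
  assumes "c > 0"
  shows "integrable lborel (\<lambda>t :: real. exp (- (c * \<bar>t\<bar>)))"
proof -
  have "integrable halfline (\<lambda>t. exp (- (c * \<bar>t\<bar>)))"
    using has_bochner_integral_exp_real[OF assms]
    by (subst Bochner_Integration.integrable_cong[OF refl, of _ _ "\<lambda>t. exp (- (c * t))"])
       (auto simp: has_bochner_integral_iff)
  then have "has_bochner_integral lborel (\<lambda>t. exp (- (c * \<bar>t\<bar>))) (2 *\<^sub>R integral\<^sup>L halfline (\<lambda>t. exp (- (c * \<bar>t\<bar>))))"
    by (intro even_integral_lborel) auto
  then show ?thesis
    by (simp add: has_bochner_integral_iff)
qed

lemma power_le_fact_exp:
  fixes x :: real
  assumes "x \<ge> 0"
  shows "x ^ n \<le> fact n * exp x"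
proof -
  have "(\<lambda>j. x ^ j / fact j) sums exp x"
    using exp_converges[of x] by (simp add: divide_inverse mult.commute)
  then have "x ^ n / fact n \<le> exp x"
    using sum_le_suminf[of "\<lambda>j. x ^ j / fact j" "{n}"] assms by (auto simp: sums_iff)
  then show ?thesis
    by (simp add: field_simps)
qed

definition moment_integral :: "nat \<Rightarrow> (int \<Rightarrow> complex) \<Rightarrow> nat \<Rightarrow> complex \<Rightarrow> complex" where
  "moment_integral q chi n s =
     (\<integral>t. of_real t ^ n * char_gf q chi (of_real t + s) * char_gf q (conj_character chi) (of_real t) \<partial>lborel)"

context
  fixes q :: nat and chi :: "int \<Rightarrow> complex"
  assumes prim: "primitive_character q chi" and q: "q > 1"
begin

lemma char_gf_dom_of_real: "of_real t \<in> char_gf_dom q"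
  using q by (intro char_gf_dom_Im) auto

lemma continuous_on_higher_deriv_char_gf:
  "continuous_on UNIV (\<lambda>t :: real. (deriv ^^ j) (char_gf q chi) (of_real t))"
  by (rule continuous_on_compose2[OF holomorphic_on_imp_continuous_on[OF
        holomorphic_higher_deriv[OF char_gf_holomorphic open_char_gf_dom]]])
     (auto intro!: continuous_intros char_gf_dom_of_real)

end

context
  fixes q :: nat and chi :: "int \<Rightarrow> complex"
  assumes prim: "primitive_character q chi" and q: "q > 1"
begin

lemma measurable_higher_deriv_char_gf [measurable]:
  "(\<lambda>t. (deriv ^^ j) (char_gf q chi) (of_real t)) \<in> borel_measurable borel"
  "(\<lambda>t. char_gf q chi (of_real t)) \<in> borel_measurable borel"
  "(\<lambda>t. char_gf q (conj_character chi) (of_real t)) \<in> borel_measurable borel"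
  using continuous_on_higher_deriv_char_gf[OF prim q, of j]
        continuous_on_higher_deriv_char_gf[OF prim q, of 0]
        continuous_on_higher_deriv_char_gf[OF primitive_character_conj[OF prim] q, of 0]
  by (auto intro!: borel_measurable_continuous_onI)

text \<open>\<open>F\<close> and \<open>G\<close> are both even or both odd, since \<open>\<chi>(-1)\<close> is real; so \<open>F(z t) G(t)\<close> is an even function of \<open>t\<close>.\<close>
lemma lattice_limit_line_integral:
  assumes z: "Re z > 0"
  shows "lattice_limit q chi z =
           (\<integral>t. char_gf q chi (z * of_real t) * char_gf q (conj_character chi) (of_real t) \<partial>lborel) / 2"
proof -
  note dc = primitive_character_imp_dirichlet[OF prim]
  note prim' = primitive_character_conj[OF prim]
  define F where "F = char_gf q chi"
  define G where "G = char_gf q (conj_character chi)"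
  define f where "f t = F (z * of_real t) * G (of_real t)" for t :: real
  have pi: "0 < 2 * pi / real q" using q by simp
  define A where "A = \<bar>Im z\<bar> / Re z"
  have A: "A \<ge> 0" "\<bar>Im z\<bar> = A * Re z" using z by (auto simp: A_def)
  obtain C1 where C1: "C1 > 0"
    "\<And>u. \<bar>Re u\<bar> \<ge> 1 \<or> \<bar>Im u\<bar> \<le> 0 + A * \<bar>Re u\<bar> \<Longrightarrow> norm (F u) \<le> C1 * exp (- \<bar>Re u\<bar>)"
    using char_gf_bound[OF prim q pi A(1)] unfolding F_def by auto
  obtain C2 where C2: "C2 > 0"
    "\<And>u. \<bar>Re u\<bar> \<ge> 1 \<or> \<bar>Im u\<bar> \<le> 0 + A * \<bar>Re u\<bar> \<Longrightarrow> norm (G u) \<le> C2 * exp (- \<bar>Re u\<bar>)"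
    using char_gf_bound[OF prim' q pi A(1)] unfolding G_def by auto
  have dom: "z * of_real t \<in> char_gf_dom q" for t
    using z char_gf_dom_of_real[OF prim q, of 0] by (cases "t = 0") (auto intro!: char_gf_dom_Re)
  have "continuous_on UNIV (\<lambda>t. F (z * of_real t))"
    unfolding F_def
    by (rule continuous_on_compose2[OF holomorphic_on_imp_continuous_on[OF char_gf_holomorphic]])
       (use dom in \<open>auto intro!: continuous_intros\<close>)
  moreover have "continuous_on UNIV (\<lambda>t :: real. G (of_real t))"
    using continuous_on_higher_deriv_char_gf[OF prim' q, of 0] by (simp add: G_def)
  ultimately have cont: "continuous_on UNIV f"
    unfolding f_def by (intro continuous_on_mult)
  have conj1: "conj_character chi (- 1) = chi (- 1)"
    by (simp add: conj_character_def dirichlet_minus_1_real[OF dc])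
  have even: "f (- t) = f t" for t
  proof -
    have "f (- t) = F (- (z * of_real t)) * G (- of_real t)"
      by (simp add: f_def)
    also have "\<dots> = (chi (- 1) * chi (- 1)) * f t"
      using char_gf_minus[OF prim q dom[of t]] char_gf_minus[OF prim' q char_gf_dom_of_real[OF prim q, of t]]
      by (simp add: F_def G_def conj1 f_def)
    finally show ?thesis
      by (simp add: dirichlet_minus_1_square[OF dc])
  qed
  have int: "integrable halfline f"
  proof (rule Bochner_Integration.integrable_bound)
    show "integrable halfline (\<lambda>t. C1 * C2 * exp (- (1 * t)))"
      using has_bochner_integral_exp_real[of 1] by (simp add: has_bochner_integral_iff)
    show "f \<in> borel_measurable halfline"
      using cont by (intro borel_measurable_halfline) (rule continuous_on_subset, auto)
    show "AE t in halfline. norm (f t) \<le> norm (C1 * C2 * exp (- (1 * t)))"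
    proof (intro AE_I2)
      fix t assume "t \<in> space halfline"
      then have t: "t > 0" by simp
      have "\<bar>Im (z * of_real t)\<bar> \<le> 0 + A * \<bar>Re (z * of_real t)\<bar>"
        using t z A by (simp add: abs_mult)
      then have "norm (F (z * of_real t)) \<le> C1 * exp (- \<bar>Re (z * of_real t)\<bar>)"
        using C1(2) by blast
      also have "\<dots> \<le> C1"
        using C1(1) by (simp add: mult_left_le)
      finally have 1: "norm (F (z * of_real t)) \<le> C1" .
      have 2: "norm (G (of_real t)) \<le> C2 * exp (- (1 * t))"
        using C2(2)[of "of_real t"] t A by simp
      have "norm (f t) \<le> C1 * (C2 * exp (- (1 * t)))"
        unfolding f_def norm_mult using C1(1) C2(1) by (intro mult_mono 1 2) auto
      then show "norm (f t) \<le> norm (C1 * C2 * exp (- (1 * t)))"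
        using C1(1) C2(1) by (simp add: mult.assoc)
    qed
  qed
  have "has_bochner_integral lborel f (2 *\<^sub>R integral\<^sup>L halfline f)"
    using cont even int by (intro even_integral_lborel) (auto intro!: borel_measurable_continuous_onI)
  moreover have "lattice_limit q chi z = integral\<^sup>L halfline f"
    using lattice_limit_eq_integral[OF prim q, of 1 z] z
    by (simp add: lattice_integral_def f_def[abs_def] F_def G_def)
  ultimately show ?thesis
    by (simp add: has_bochner_integral_iff f_def[abs_def] F_def G_def scaleR_conv_of_real)
qed

text \<open>Differentiating \<open>F(t + t w)\<close> with respect to \<open>w\<close> produces a factor \<open>t\<close> each time. For \<open>|w| < 1/2\<close> the argument stays
  in a fixed sector around the real axis, at distance at least \<open>|t|/2\<close> from the imaginary axis.\<close>
lemma lattice_limit_fps: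
  "(\<lambda>w. lattice_limit q chi (1 + w)) has_fps_expansion
     Abs_fps (\<lambda>j. (\<integral>t. of_real t ^ j * (deriv ^^ j) (char_gf q chi) (of_real t) *
                     char_gf q (conj_character chi) (of_real t) \<partial>lborel) / fact j / 2)"
proof (rule has_fps_expansionI)
  define F where "F = char_gf q chi"
  define G where "G = char_gf q (conj_character chi)"
  define g where "g t w = G (of_real t) * F (of_real t * w + of_real t)" for t :: real and w
  have pi: "0 < 2 * pi / real q" using q by simp
  obtain C1 where C1: "C1 > 0"
    "\<And>u. \<bar>Re u\<bar> \<ge> 1 \<or> \<bar>Im u\<bar> \<le> 0 + 1 * \<bar>Re u\<bar> \<Longrightarrow> norm (F u) \<le> C1 * exp (- \<bar>Re u\<bar>)"
    using char_gf_bound[OF prim q pi, of 1] unfolding F_def by auto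
  obtain C2 where C2: "C2 > 0"
    "\<And>u. \<bar>Re u\<bar> \<ge> 1 \<or> \<bar>Im u\<bar> \<le> 0 + 1 * \<bar>Re u\<bar> \<Longrightarrow> norm (G u) \<le> C2 * exp (- \<bar>Re u\<bar>)"
    using char_gf_bound[OF primitive_character_conj[OF prim] q pi, of 1] unfolding G_def by auto
  have Re_Im: "\<bar>Re (of_real t * w + of_real t)\<bar> \<ge> \<bar>t\<bar> / 2" "\<bar>Im (of_real t * w + of_real t)\<bar> \<le> \<bar>t\<bar> / 2"
    if "w \<in> ball 0 (1/2)" for t w
  proof -
    have "\<bar>Re w\<bar> \<le> 1/2" "\<bar>Im w\<bar> \<le> 1/2"
      using that abs_Re_le_cmod[of w] abs_Im_le_cmod[of w] by auto
    then have "\<bar>t\<bar> * (1/2) \<le> \<bar>t\<bar> * \<bar>1 + Re w\<bar>" "\<bar>t\<bar> * \<bar>Im w\<bar> \<le> \<bar>t\<bar> * (1/2)"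
      by (intro mult_left_mono; linarith)+
    moreover have "Re (of_real t * w + of_real t) = t * (1 + Re w)" "Im (of_real t * w + of_real t) = t * Im w"
      by (simp_all add: algebra_simps)
    ultimately show "\<bar>Re (of_real t * w + of_real t)\<bar> \<ge> \<bar>t\<bar> / 2" "\<bar>Im (of_real t * w + of_real t)\<bar> \<le> \<bar>t\<bar> / 2"
      by (simp_all only: abs_mult)
  qed
  have dom: "of_real t * w + of_real t \<in> char_gf_dom q" if "w \<in> ball 0 (1/2)" for t w
  proof (cases "t = 0")
    case True
    then show ?thesis using char_gf_dom_of_real[OF prim q, of 0] by simp
  next
    case False
    then show ?thesis using Re_Im(1)[OF that, of t] by (intro char_gf_dom_Re) auto
  qed
  have hol: "g t holomorphic_on ball 0 (1/2)" for t
    unfolding g_def F_def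
    by (intro holomorphic_intros holomorphic_on_compose_gen[OF _ char_gf_holomorphic, unfolded o_def])
       (use dom in auto)
  have bound: "norm (g t w) \<le> C2 * C1 * exp (- (1/2 * \<bar>t\<bar>))" if w: "w \<in> ball 0 (1/2)" for t w
  proof -
    have "\<bar>Im (of_real t * w + of_real t)\<bar> \<le> 0 + 1 * \<bar>Re (of_real t * w + of_real t)\<bar>"
      using Re_Im[OF w, of t] by linarith
    then have "norm (F (of_real t * w + of_real t)) \<le> C1 * exp (- \<bar>Re (of_real t * w + of_real t)\<bar>)"
      using C1(2) by blast
    also have "\<dots> \<le> C1 * exp (- (1/2 * \<bar>t\<bar>))"
      using C1(1) Re_Im(1)[OF w, of t] by (intro mult_left_mono) auto
    finally have 1: "norm (F (of_real t * w + of_real t)) \<le> C1 * exp (- (1/2 * \<bar>t\<bar>))" .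
    have "norm (G (of_real t)) \<le> C2 * exp (- \<bar>t\<bar>)"
      using C2(2)[of "of_real t"] by simp
    also have "\<dots> \<le> C2"
      using C2(1) by (simp add: mult_left_le)
    finally show ?thesis
      using 1 C1 C2 unfolding g_def norm_mult mult.assoc by (intro mult_mono) auto
  qed
  have deriv: "(deriv ^^ j) (g t) 0 = G (of_real t) * (of_real t ^ j * (deriv ^^ j) F (of_real t))" for j t
  proof -
    have "(deriv ^^ j) (g t) 0 = G (of_real t) * (deriv ^^ j) (\<lambda>w. F (of_real t * w + of_real t)) 0"
      unfolding g_def
    proof (rule higher_deriv_cmult[where A = "ball 0 (1/2)"])
      show "(\<lambda>w. F (of_real t * w + of_real t)) holomorphic_on ball 0 (1/2)"
        unfolding F_def
        by (intro holomorphic_intros holomorphic_on_compose_gen[OF _ char_gf_holomorphic, unfolded o_def])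
           (use dom in auto)
    qed auto
    also have "(deriv ^^ j) (\<lambda>w. F (of_real t * w + of_real t)) 0 =
               of_real t ^ j * (deriv ^^ j) F (of_real t * 0 + of_real t)"
      unfolding F_def
      by (rule higher_deriv_compose_linear'[OF char_gf_holomorphic open_ball[of 0 "1/2"] open_char_gf_dom])
         (use dom in auto)
    finally show ?thesis by simp
  qed
  have series: "(\<lambda>j. (\<integral>t. (deriv ^^ j) (g t) 0 \<partial>lborel) / fact j * w ^ j) sums (\<integral>t. g t w \<partial>lborel)"
    if "w \<in> ball 0 (1/2)" for w
  proof (rule integral_power_series[OF hol bound _ _ that])
    show "integrable lborel (\<lambda>t. C2 * C1 * exp (- (1/2 * \<bar>t\<bar>)))"
      by (intro integrable_mult_right integrable_exp_abs) auto
    show "(\<lambda>t. (deriv ^^ j) (g t) 0) \<in> borel_measurable lborel" for j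
      unfolding deriv F_def G_def by measurable
  qed
  have "eventually (\<lambda>w. w \<in> ball 0 (1/2)) (nhds (0::complex))"
    by (intro eventually_nhds_in_open) auto
  then show "\<forall>\<^sub>F w in nhds 0. (\<lambda>j. fps_nth (Abs_fps (\<lambda>j. (\<integral>t. of_real t ^ j * (deriv ^^ j) (char_gf q chi) (of_real t) *
                     char_gf q (conj_character chi) (of_real t) \<partial>lborel) / fact j / 2)) j * w ^ j) sums
               lattice_limit q chi (1 + w)"
  proof eventually_elim
    case (elim w)
    then have "\<bar>Re w\<bar> < 1"
      using abs_Re_le_cmod[of w] by auto
    then have "Re (1 + w) > 0" by simp
    then have eq: "lattice_limit q chi (1 + w) = (\<integral>t. g t w \<partial>lborel) / 2"
      by (simp add: lattice_limit_line_integral g_def F_def G_def ring_distribs mult_ac add_ac)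
    show ?case
      unfolding eq using sums_divide[OF series[OF elim], of 2] by (simp add: deriv F_def G_def mult_ac)
  qed
qed

text \<open>The factor \<open>e^|t|\<close> that is lost to the power \<open>t^n\<close> is regained from the decay of one of the two generating functions.\<close>
lemma moment_integrand_bound:
  "\<exists>C. \<forall>t s. norm s < pi / real q \<longrightarrow>
     norm (of_real t ^ n * char_gf q (conj_character chi) (of_real t) * char_gf q chi (s + of_real t)) \<le>
       C * exp (- \<bar>t\<bar>)"
proof -
  define F where "F = char_gf q chi"
  define G where "G = char_gf q (conj_character chi)"
  define r where "r = pi / real q"
  have r: "r > 0" "r < 2 * pi / real q" using q by (auto simp: r_def field_simps)
  obtain C1 where C1: "C1 > 0"
    "\<And>u. \<bar>Re u\<bar> \<ge> 1 \<or> \<bar>Im u\<bar> \<le> r + 0 * \<bar>Re u\<bar> \<Longrightarrow> norm (F u) \<le> C1 * exp (- \<bar>Re u\<bar>)"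
    using char_gf_bound[OF prim q r(2), of 0] unfolding F_def by auto
  obtain C2 where C2: "C2 > 0"
    "\<And>u. \<bar>Re u\<bar> \<ge> 1 \<or> \<bar>Im u\<bar> \<le> r + 0 * \<bar>Re u\<bar> \<Longrightarrow> norm (G u) \<le> C2 * exp (- \<bar>Re u\<bar>)"
    using char_gf_bound[OF primitive_character_conj[OF prim] q r(2), of 0] unfolding G_def by auto
  have "norm (of_real t ^ n * G (of_real t) * F (s + of_real t)) \<le> fact n * C2 * C1 * exp r * exp (- \<bar>t\<bar>)"
    if s: "norm s < r" for t s
  proof -
    have Im: "\<bar>Im (s + of_real t)\<bar> < r" and Re: "\<bar>t\<bar> - r \<le> \<bar>Re (s + of_real t)\<bar>"
      using s abs_Im_le_cmod[of s] abs_Re_le_cmod[of s] by auto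
    have "norm (F (s + of_real t)) \<le> C1 * exp (- \<bar>Re (s + of_real t)\<bar>)"
      using C1(2)[of "s + of_real t"] Im by linarith
    also have "\<dots> \<le> C1 * exp (r - \<bar>t\<bar>)"
      using C1(1) Re by (intro mult_left_mono) auto
    finally have 1: "norm (F (s + of_real t)) \<le> C1 * exp (r - \<bar>t\<bar>)" .
    have 2: "norm (G (of_real t)) \<le> C2 * exp (- \<bar>t\<bar>)"
      using C2(2)[of "of_real t"] r by simp
    have "norm (of_real t :: complex) ^ n \<le> fact n * exp (norm (of_real t :: complex))"
      by (rule power_le_fact_exp) auto
    then have 3: "norm (of_real t ^ n :: complex) \<le> fact n * exp \<bar>t\<bar>"
      by (simp add: norm_power)
    have "norm (of_real t ^ n * G (of_real t) * F (s + of_real t)) \<le>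
          ((fact n * exp \<bar>t\<bar>) * (C2 * exp (- \<bar>t\<bar>))) * (C1 * exp (r - \<bar>t\<bar>))"
      unfolding norm_mult[of _ "F _"] norm_mult[of _ "G _"] using C1 C2 by (intro mult_mono 1 2 3) auto
    also have "\<dots> = fact n * C2 * C1 * exp r * exp (- \<bar>t\<bar>)"
      by (simp add: exp_diff exp_minus field_simps)
    finally show ?thesis .
  qed
  then show ?thesis
    unfolding F_def G_def r_def by blast
qed

lemma moment_integrand_dom:
  assumes "norm s < pi / real q"
  shows "s + of_real t \<in> char_gf_dom q"
proof (rule char_gf_dom_Im)
  have "\<bar>Im (s + of_real t)\<bar> < pi / real q"
    using abs_Im_le_cmod[of s] assms by simp
  also have "\<dots> < 2 * pi / real q"
    using q by (simp add: field_simps)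
  finally show "\<bar>Im (s + of_real t)\<bar> < 2 * pi / real q" .
qed (use q in auto)

lemma moment_integrand_integrable:
  assumes s: "norm s < pi / real q"
  shows "integrable lborel (\<lambda>t. of_real t ^ n * char_gf q (conj_character chi) (of_real t) * char_gf q chi (s + of_real t))"
proof -
  obtain C where C: "\<And>t s. norm s < pi / real q \<Longrightarrow>
     norm (of_real t ^ n * char_gf q (conj_character chi) (of_real t) * char_gf q chi (s + of_real t)) \<le> C * exp (- \<bar>t\<bar>)"
    using moment_integrand_bound by blast
  show ?thesis
  proof (rule Bochner_Integration.integrable_bound)
    show "integrable lborel (\<lambda>t. C * exp (- \<bar>t\<bar>))"
      using integrable_exp_abs[of 1] by simp
    have "continuous_on UNIV (\<lambda>t. char_gf q chi (s + of_real t))"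
      by (rule continuous_on_compose2[OF holomorphic_on_imp_continuous_on[OF char_gf_holomorphic]])
         (use moment_integrand_dom[OF s] in \<open>auto intro!: continuous_intros\<close>)
    then have [measurable]: "(\<lambda>t. char_gf q chi (s + of_real t)) \<in> borel_measurable borel"
      by (rule borel_measurable_continuous_onI)
    show "(\<lambda>t. of_real t ^ n * char_gf q (conj_character chi) (of_real t) * char_gf q chi (s + of_real t)) \<in>
            borel_measurable lborel"
      by measurable
    show "AE t in lborel. norm (of_real t ^ n * char_gf q (conj_character chi) (of_real t) * char_gf q chi (s + of_real t)) \<le>
            norm (C * exp (- \<bar>t\<bar>))"
      unfolding real_norm_def using C[OF s] by (intro AE_I2 order_trans[OF _ abs_ge_self])
  qed
qed

lemma moment_integral_fps:
  "moment_integral q chi n has_fps_expansion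
     Abs_fps (\<lambda>j. (\<integral>t. of_real t ^ n * (deriv ^^ j) (char_gf q chi) (of_real t) *
                     char_gf q (conj_character chi) (of_real t) \<partial>lborel) / fact j)"
proof (rule has_fps_expansionI)
  define F where "F = char_gf q chi"
  define G where "G = char_gf q (conj_character chi)"
  define g where "g t s = of_real t ^ n * G (of_real t) * F (1 * s + of_real t)" for t :: real and s
  define r where "r = pi / real q"
  have r: "r > 0" using q by (simp add: r_def)
  have dom: "1 * s + of_real t \<in> char_gf_dom q" if "s \<in> ball 0 r" for t s
    using that moment_integrand_dom[of s t] by (simp add: r_def)
  have hol: "g t holomorphic_on ball 0 r" for t
    unfolding g_def F_def
    by (intro holomorphic_intros holomorphic_on_compose_gen[OF _ char_gf_holomorphic, unfolded o_def])
       (use dom in auto)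
  obtain C where C: "\<And>t s. norm s < r \<Longrightarrow> norm (of_real t ^ n * G (of_real t) * F (s + of_real t)) \<le> C * exp (- \<bar>t\<bar>)"
    using moment_integrand_bound unfolding F_def G_def r_def by blast
  have bound: "norm (g t s) \<le> C * exp (- (1 * \<bar>t\<bar>))" if "s \<in> ball 0 r" for t s
    using C[of s t] that by (simp add: g_def)
  have deriv: "(deriv ^^ j) (g t) 0 = of_real t ^ n * G (of_real t) * (deriv ^^ j) F (of_real t)" for j t
  proof -
    have "(deriv ^^ j) (g t) 0 = of_real t ^ n * G (of_real t) * (deriv ^^ j) (\<lambda>s. F (1 * s + of_real t)) 0"
      unfolding g_def
    proof (rule higher_deriv_cmult[where A = "ball 0 r"])
      show "(\<lambda>s. F (1 * s + of_real t)) holomorphic_on ball 0 r"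
        unfolding F_def
        by (intro holomorphic_intros holomorphic_on_compose_gen[OF _ char_gf_holomorphic, unfolded o_def])
           (use dom in auto)
    qed (use r in auto)
    also have "(deriv ^^ j) (\<lambda>s. F (1 * s + of_real t)) 0 = 1 ^ j * (deriv ^^ j) F (1 * 0 + of_real t)"
      unfolding F_def
      by (rule higher_deriv_compose_linear'[OF char_gf_holomorphic open_ball[of 0 r] open_char_gf_dom])
         (use dom r in auto)
    finally show ?thesis by simp
  qed
  have series: "(\<lambda>j. (\<integral>t. (deriv ^^ j) (g t) 0 \<partial>lborel) / fact j * s ^ j) sums (\<integral>t. g t s \<partial>lborel)"
    if "s \<in> ball 0 r" for s
  proof (rule integral_power_series[OF hol bound _ _ that])
    show "integrable lborel (\<lambda>t. C * exp (- (1 * \<bar>t\<bar>)))"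
      by (intro integrable_mult_right integrable_exp_abs) auto
    show "(\<lambda>t. (deriv ^^ j) (g t) 0) \<in> borel_measurable lborel" for j
      unfolding deriv F_def G_def by measurable
  qed
  have "eventually (\<lambda>s. s \<in> ball 0 r) (nhds (0::complex))"
    using r by (intro eventually_nhds_in_open) auto
  then show "\<forall>\<^sub>F s in nhds 0. (\<lambda>j. fps_nth (Abs_fps (\<lambda>j. (\<integral>t. of_real t ^ n * (deriv ^^ j) (char_gf q chi) (of_real t) *
                     char_gf q (conj_character chi) (of_real t) \<partial>lborel) / fact j)) j * s ^ j) sums
               moment_integral q chi n s"
  proof eventually_elim
    case (elim s)
    have "moment_integral q chi n s = (\<integral>t. g t s \<partial>lborel)"
      by (simp add: moment_integral_def g_def F_def G_def mult_ac add_ac)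
    then show ?case
      using series[OF elim] by (simp add: deriv F_def G_def mult_ac)
  qed
qed

text \<open>The factor \<open>t^j\<close> in the expansion of \<open>L\<close> at 1 varies with the coefficient, whereas the moment integral has the fixed factor \<open>t^n\<close>;
  the \<open>n\<close>-th coefficients agree up to the factor 1/2 from the passage to the whole real line.\<close>
lemma psi_chi_taylor:
  assumes "moment_integral q chi n has_fps_expansion A"
  shows "(deriv ^^ n) (psi_chi q chi) 1 / fact n = chi (- 1) * \<i> / (2 * of_real pi) * fps_nth A n"
proof -
  define I where "I = (\<integral>t. of_real t ^ n * (deriv ^^ n) (char_gf q chi) (of_real t) *
                     char_gf q (conj_character chi) (of_real t) \<partial>lborel) / fact n"
  define c where "c = chi (- 1) * \<i> / of_real pi"
  have "fps_nth A n = I"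
    using fps_expansion_unique_complex[OF assms moment_integral_fps] by (simp add: I_def)
  moreover have "(deriv ^^ n) (\<lambda>w. lattice_limit q chi (1 + w)) 0 / fact n = I / 2"
    using fps_nth_fps_expansion[OF lattice_limit_fps, of n] by (simp add: I_def)
  moreover have "(deriv ^^ n) (psi_chi q chi) 1 = c * (deriv ^^ n) (\<lambda>w. lattice_limit q chi (1 + w)) 0"
  proof -
    have S: "open (- \<real>\<^sub>\<le>\<^sub>0 :: complex set)" "1 \<in> (- \<real>\<^sub>\<le>\<^sub>0 :: complex set)"
      by (auto simp: open_Compl)
    have "(deriv ^^ n) (psi_chi q chi) 1 = (deriv ^^ n) (\<lambda>z. c * lattice_limit q chi z) 1"
    proof (rule higher_deriv_cong_ev)
      have "eventually (\<lambda>z. z \<in> - \<real>\<^sub>\<le>\<^sub>0) (nhds (1::complex))"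
        using S by (intro eventually_nhds_in_open)
      then show "\<forall>\<^sub>F z in nhds 1. psi_chi q chi z = c * lattice_limit q chi z"
        by eventually_elim (simp add: psi_chi_eq[OF prim q] c_def)
    qed auto
    also have "\<dots> = c * (deriv ^^ n) (lattice_limit q chi) 1"
      by (rule higher_deriv_cmult[OF lattice_limit_holomorphic[OF prim q] S(2,1)])
    also have "(deriv ^^ n) (lattice_limit q chi) 1 = (deriv ^^ n) (\<lambda>w. lattice_limit q chi (1 * w + 1)) 0"
    proof (subst higher_deriv_compose_linear'[OF lattice_limit_holomorphic[OF prim q] open_ball[of 0 1] S(1)])
      show "1 * w + 1 \<in> - \<real>\<^sub>\<le>\<^sub>0" if "w \<in> ball 0 1" for w :: complex
        using that abs_Re_le_cmod[of w] by (auto simp: complex_nonpos_Reals_iff)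
    qed auto
    finally show ?thesis by (simp add: add.commute)
  qed
  ultimately have "(deriv ^^ n) (psi_chi q chi) 1 / fact n = c * (fps_nth A n / 2)"
    by (metis times_divide_eq_right)
  then show ?thesis
    by (simp add: c_def)
qed

end

section \<open>Evaluation of the moment integrals by residues\<close>

text \<open>Integrate over the rectangle with vertices \<open>\<plusminus>R\<close> and \<open>\<plusminus>R + 2\<pi>i\<close>. The horizontal sides together give minus the integral of \<open>h\<close>,
  and the vertical sides vanish in the limit.\<close>
lemma integral_periodic_strip_residues:
  fixes f :: "complex \<Rightarrow> complex" and h :: "real \<Rightarrow> complex"
  assumes \<rho>: "\<rho> > 0" and pts: "finite pts" "\<And>p. p \<in> pts \<Longrightarrow> 0 < Im p \<and> Im p < 2 * pi"
    and hol: "f holomorphic_on {u. - \<rho> < Im u \<and> Im u < 2 * pi + \<rho>} - pts"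
    and decay: "\<And>u. \<bar>Re u\<bar> \<ge> M \<Longrightarrow> 0 \<le> Im u \<Longrightarrow> Im u \<le> 2 * pi \<Longrightarrow> norm (f u) \<le> D * exp (- \<bar>Re u\<bar>)"
    and diff: "\<And>t. f (of_real t + 2 * of_real pi * \<i>) - f (of_real t) = h t"
    and int: "integrable lborel h"
  shows "integral\<^sup>L lborel h = - 2 * of_real pi * \<i> * (\<Sum>p\<in>pts. residue f p)"
proof -
  define S where "S = {u. - \<rho> < Im u \<and> Im u < 2 * pi + \<rho>}"
  define R1 where "R1 = Max (insert (max 1 M) ((\<lambda>p. \<bar>Re p\<bar>) ` pts))"
  have R1: "R1 \<ge> 1" "R1 \<ge> M" "\<And>p. p \<in> pts \<Longrightarrow> \<bar>Re p\<bar> \<le> R1"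
  proof -
    have le: "x \<le> R1" if "x \<in> insert (max 1 M) ((\<lambda>p. \<bar>Re p\<bar>) ` pts)" for x
      using that pts(1) unfolding R1_def by (intro Max_ge) auto
    show "R1 \<ge> 1" "R1 \<ge> M"
      using le[of "max 1 M"] by auto
    show "\<bar>Re p\<bar> \<le> R1" if "p \<in> pts" for p
      using le that by blast
  qed
  have openS: "open S"
    unfolding S_def by (intro open_Collect_conj open_Collect_less continuous_intros)
  have convS: "convex S"
  proof -
    have "S = {u. Im u > - \<rho>} \<inter> {u. Im u < 2 * pi + \<rho>}" by (auto simp: S_def)
    then show ?thesis by (simp add: convex_Int convex_halfspace_Im_gt convex_halfspace_Im_lt)
  qed
  have cont: "continuous_on (S - pts) f"
    using hol holomorphic_on_imp_continuous_on unfolding S_def by blast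
  have bound: "norm ((\<integral>t. indicator {- R..R} t *\<^sub>R h t \<partial>lborel) + 2 * of_real pi * \<i> * (\<Sum>p\<in>pts. residue f p)) \<le>
          4 * pi * D * exp (- R)" if R: "R > R1" for R
  proof -
    define b1 where "b1 = - complex_of_real R"
    define b2 where "b2 = complex_of_real R"
    define b3 where "b3 = of_real R + 2 * of_real pi * \<i>"
    define b4 where "b4 = - of_real R + 2 * of_real pi * \<i>"
    have R0: "R > 0" using R R1 by linarith
    note b = b1_def b2_def b3_def b4_def
    have rect: "rectpath b1 b3 = linepath b1 b2 +++ linepath b2 b3 +++ linepath b3 b4 +++ linepath b4 b1"
    proof -
      have "Complex (Re b3) (Im b1) = b2" "Complex (Re b1) (Im b3) = b4"
        by (auto simp: b complex_eq_iff)
      then show ?thesis by (simp add: rectpath_def Let_def)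
    qed
    have box: "pts \<subseteq> box b1 b3"
    proof
      fix p assume p: "p \<in> pts"
      then show "p \<in> box b1 b3"
        using pts(2)[OF p] R1(3)[OF p] R by (auto simp: in_box_complex_iff b)
    qed
    have cboxS: "cbox b1 b3 \<subseteq> S"
      using \<rho> by (auto simp: in_cbox_complex_iff S_def b)
    have le: "Re b1 \<le> Re b3" "Im b1 \<le> Im b3"
      using R0 by (auto simp: b)
    have img: "path_image (rectpath b1 b3) \<subseteq> S - pts"
      using cboxS box by (auto simp: path_image_rectpath_cbox_minus_box[OF le])
    have img_eq: "path_image (rectpath b1 b3) = closed_segment b1 b2 \<union> closed_segment b2 b3 \<union>
                    closed_segment b3 b4 \<union> closed_segment b4 b1"
      unfolding rect by (simp add: path_image_join Un_assoc)
    have integ: "f contour_integrable_on linepath b1 b2" "f contour_integrable_on linepath b2 b3"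
                "f contour_integrable_on linepath b3 b4" "f contour_integrable_on linepath b4 b1"
      using img unfolding img_eq
      by (intro contour_integrable_continuous_linepath continuous_on_subset[OF cont]; blast)+
    have "contour_integral (rectpath b1 b3) f =
          of_real (2 * pi) * \<i> * (\<Sum>p\<in>pts. winding_number (rectpath b1 b3) p * residue f p)"
    proof (rule Residue_theorem[OF openS convex_connected[OF convS] pts(1)])
      show "f holomorphic_on S - pts" using hol by (simp add: S_def)
      show "\<forall>z. z \<notin> S \<longrightarrow> winding_number (rectpath b1 b3) z = 0"
        using cboxS le by (auto intro!: winding_number_rectpath_outside)
    qed (use img in auto)
    also have "complex_of_real (2 * pi) = 2 * of_real pi" by simp
    also have "(\<Sum>p\<in>pts. winding_number (rectpath b1 b3) p * residue f p) = (\<Sum>p\<in>pts. residue f p)"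
      using box by (intro sum.cong refl) (auto simp: winding_number_rectpath)
    also have "contour_integral (rectpath b1 b3) f =
        contour_integral (linepath b1 b2) f + contour_integral (linepath b2 b3) f +
        contour_integral (linepath b3 b4) f + contour_integral (linepath b4 b1) f"
      unfolding rect using integ by (simp add: contour_integrable_joinI add.assoc)
    also have "contour_integral (linepath b3 b4) f = - contour_integral (linepath b4 b3) f"
      using contour_integral_reversepath[of "linepath b4 b3" f] by simp
    finally have res: "contour_integral (linepath b1 b2) f - contour_integral (linepath b4 b3) f +
        contour_integral (linepath b2 b3) f + contour_integral (linepath b4 b1) f =
        2 * of_real pi * \<i> * (\<Sum>p\<in>pts. residue f p)"
      by (simp add: algebra_simps)
    have trans: "linepath b4 b3 = (+) (2 * of_real pi * \<i>) \<circ> linepath b1 b2"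
      by (auto simp: b linepath_def fun_eq_iff algebra_simps scaleR_conv_of_real)
    have integ': "(\<lambda>u. f (u + 2 * of_real pi * \<i>)) contour_integrable_on linepath b1 b2"
    proof -
      have "f contour_integrable_on linepath b4 b3"
        using integ(3) contour_integrable_reversepath_eq[of "linepath b4 b3" f] by simp
      then show ?thesis
        unfolding trans contour_integrable_translate .
    qed
    have "contour_integral (linepath b4 b3) f - contour_integral (linepath b1 b2) f =
          contour_integral (linepath b1 b2) (\<lambda>u. f (u + 2 * of_real pi * \<i>) - f u)"
      unfolding trans contour_integral_translate using integ(1) integ' by (simp add: contour_integral_diff)
    also have "\<dots> = integral {- R..R} (\<lambda>t. f (of_real t + 2 * of_real pi * \<i>) - f (of_real t))"
      using R0 by (subst contour_integral_linepath_Reals_eq) (auto simp: b)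
    also have "\<dots> = integral {- R..R} h"
      by (simp add: diff)
    also have "\<dots> = (\<integral>t. indicator {- R..R} t *\<^sub>R h t \<partial>lborel)"
      using set_borel_integral_eq_integral(2)[of "{- R..R}" h] integrable_mult_indicator[OF _ int, of "{- R..R}"]
      by (simp add: set_integrable_def set_lebesgue_integral_def)
    finally have "(\<integral>t. indicator {- R..R} t *\<^sub>R h t \<partial>lborel) + 2 * of_real pi * \<i> * (\<Sum>p\<in>pts. residue f p) =
        contour_integral (linepath b2 b3) f + contour_integral (linepath b4 b1) f"
      unfolding res[symmetric] by (simp add: algebra_simps)
    also have "norm \<dots> \<le> D * exp (- R) * norm (b3 - b2) + D * exp (- R) * norm (b1 - b4)"
    proof (intro norm_triangle_le add_mono contour_integral_bound_linepath integ)
      have "norm (f b2) \<le> D * exp (- \<bar>Re b2\<bar>)"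
        using R R1 R0 by (intro decay) (auto simp: b)
      then show nonneg: "0 \<le> D * exp (- R)" "0 \<le> D * exp (- R)"
        using order_trans[OF norm_ge_zero] R0 by (auto simp: b)
      fix u
      show "norm (f u) \<le> D * exp (- R)" if "u \<in> closed_segment b2 b3"
      proof -
        have "Re u = R" "0 \<le> Im u" "Im u \<le> 2 * pi"
          using that by (auto simp: closed_segment_same_Re closed_segment_eq_real_ivl b split: if_splits)
        then show ?thesis
          using decay[of u] R R1 R0 by simp
      qed
      show "norm (f u) \<le> D * exp (- R)" if "u \<in> closed_segment b4 b1"
      proof -
        have "Re u = - R" "0 \<le> Im u" "Im u \<le> 2 * pi"
          using that by (auto simp: closed_segment_same_Re closed_segment_eq_real_ivl b split: if_splits)
        then show ?thesis
          using decay[of u] R R1 R0 by simp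
      qed
    qed
    also have "norm (b3 - b2) = 2 * pi"
      by (simp add: b norm_mult)
    also have "norm (b1 - b4) = 2 * pi"
      by (simp add: b norm_mult)
    finally show ?thesis by (simp add: mult_ac)
  qed
  have lim0: "((\<lambda>R. (\<integral>t. indicator {- R..R} t *\<^sub>R h t \<partial>lborel) + 2 * of_real pi * \<i> * (\<Sum>p\<in>pts. residue f p)) \<longlongrightarrow> 0) at_top"
  proof (rule Lim_null_comparison)
    show "\<forall>\<^sub>F R in at_top. norm ((\<integral>t. indicator {- R..R} t *\<^sub>R h t \<partial>lborel) + 2 * of_real pi * \<i> * (\<Sum>p\<in>pts. residue f p)) \<le>
          4 * pi * D * exp (- R)"
      using eventually_gt_at_top[of R1] by eventually_elim (rule bound)
    show "((\<lambda>R. 4 * pi * D * exp (- R)) \<longlongrightarrow> 0) at_top"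
      by real_asymp
  qed
  have "((\<lambda>R. \<integral>t. indicator {- R..R} t *\<^sub>R h t \<partial>lborel) \<longlongrightarrow> integral\<^sup>L lborel h) at_top"
  proof (rule integral_dominated_convergence_at_top)
    show "integrable lborel (\<lambda>t. norm (h t))" using int by simp
    show "AE t in lborel. ((\<lambda>R. indicator {- R..R} t *\<^sub>R h t) \<longlongrightarrow> h t) at_top"
    proof (intro AE_I2 tendsto_eventually)
      fix t :: real
      show "\<forall>\<^sub>F R in at_top. indicator {- R..R} t *\<^sub>R h t = h t"
        using eventually_gt_at_top[of "\<bar>t\<bar>"] by eventually_elim (auto simp: indicator_def)
    qed
    show "\<forall>\<^sub>F R in at_top. AE t in lborel. norm (indicator {- R..R} t *\<^sub>R h t) \<le> norm (h t)"
      by (intro always_eventually allI AE_I2) (auto simp: indicator_def)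
  qed (use int in auto)
  then have "((\<lambda>R. (\<integral>t. indicator {- R..R} t *\<^sub>R h t \<partial>lborel) + 2 * of_real pi * \<i> * (\<Sum>p\<in>pts. residue f p)) \<longlongrightarrow>
      integral\<^sup>L lborel h + 2 * of_real pi * \<i> * (\<Sum>p\<in>pts. residue f p)) at_top"
    by (intro tendsto_intros)
  with lim0 have "integral\<^sup>L lborel h + 2 * of_real pi * \<i> * (\<Sum>p\<in>pts. residue f p) = 0"
    using tendsto_unique trivial_limit_at_top_linorder by blast
  then show ?thesis
    by (simp add: add_eq_0_iff2)
qed

lemma residue_times_simple_pole:
  assumes "open S" "finite X" "p \<in> S" and hol: "(\<lambda>u. g u * f u) holomorphic_on S - X"
    and g: "isCont g p" and f: "((\<lambda>u. f u * (u - p)) \<longlongrightarrow> c) (at p)"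
  shows "residue (\<lambda>u. g u * f u) p = g p * c"
proof (rule residue_simple')
  show "open (S - (X - {p}))" "p \<in> S - (X - {p})"
    using assms(1-3) by (auto intro!: open_Diff finite_imp_closed)
  show "(\<lambda>u. g u * f u) holomorphic_on S - (X - {p}) - {p}"
    by (rule holomorphic_on_subset[OF hol]) auto
  show "((\<lambda>u. g u * f u * (u - p)) \<longlongrightarrow> g p * c) (at p)"
    using tendsto_mult[OF g[unfolded isCont_def] f] by (simp add: mult.assoc)
qed

lemma Re_gf_pole [simp]: "Re (gf_pole q k) = 0"
  and Im_gf_pole: "Im (gf_pole q k) = 2 * pi * of_int k / of_nat q"
  by (auto simp: gf_pole_def)

lemma gf_pole_strip:
  assumes u: "u \<notin> char_gf_dom q" and q: "q > 1"
    and Im: "- (2 * pi / real q) < Im u" "Im u < 2 * pi + 2 * pi / real q"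
  shows "\<exists>k\<in>{1..<int q}. u = gf_pole q k"
proof -
  obtain k where k: "k \<in> {1..<int q}" "exp (u - gf_pole q k) = 1"
    using u by (auto simp: char_gf_dom_def exp_mult_add_char_minus)
  then obtain n where n: "Re u = 0" "Im u = of_int (2 * n) * pi + 2 * pi * of_int k / real q"
    by (auto simp: exp_eq_1 Im_gf_pole algebra_simps)
  then have "Im u = 2 * pi / real q * of_int (n * int q + k)"
    using q by (simp add: field_simps)
  moreover have "2 * pi + 2 * pi / real q = 2 * pi / real q * of_int (int q + 1)"
    using q by (simp add: field_simps)
  ultimately have "2 * pi / real q * of_int (- 1) < 2 * pi / real q * of_int (n * int q + k)"
      "2 * pi / real q * of_int (n * int q + k) < 2 * pi / real q * of_int (int q + 1)"
    using Im by simp_all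
  then have "- 1 < n * int q + k" "n * int q + k < int q + 1"
  proof -
    have c: "2 * pi / real q > 0" using q by simp
    show "- 1 < n * int q + k" "n * int q + k < int q + 1"
      using \<open>2 * pi / real q * of_int (- 1) < _\<close> \<open>_ < 2 * pi / real q * of_int (int q + 1)\<close>
      unfolding mult_less_cancel_left_pos[OF c] of_int_less_iff .
  qed
  have "n = 0"
  proof (rule ccontr)
    assume "n \<noteq> 0"
    then consider "n \<ge> 1" | "n \<le> - 1" by linarith
    then show False
    proof cases
      case 1
      then have "1 * int q \<le> n * int q" using q by (intro mult_right_mono) auto
      then show False using k(1) \<open>n * int q + k < int q + 1\<close> by auto
    next
      case 2
      then have "n * int q \<le> (- 1) * int q" using q by (intro mult_right_mono) auto
      then show False using k(1) \<open>- 1 < n * int q + k\<close> by auto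
    qed
  qed
  then have "u = gf_pole q k"
    using n by (simp add: complex_eq_iff Im_gf_pole)
  with k(1) show ?thesis by blast
qed

lemma gf_pole_diff_small:
  assumes "gf_pole q j - gf_pole q k = s" "norm s < 2 * pi / real q" "q > 0"
  shows "j = k \<and> s = 0"
proof -
  have "norm (gf_pole q j - gf_pole q k) = 2 * pi / real q * \<bar>of_int (j - k)\<bar>"
  proof -
    have "gf_pole q j - gf_pole q k = of_real (2 * pi / real q * of_int (j - k)) * \<i>"
      using assms(3) by (simp add: gf_pole_def field_simps)
    then have "norm (gf_pole q j - gf_pole q k) = \<bar>2 * pi / real q * of_int (j - k)\<bar>"
      by (simp only: norm_mult norm_of_real norm_ii mult_1_right)
    then show ?thesis by (simp only: abs_mult) simp
  qed
  then have "2 * pi / real q * \<bar>of_int (j - k)\<bar> < 2 * pi / real q * 1"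
    using assms by simp
  then have "\<bar>real_of_int (j - k)\<bar> < 1"
    using assms(3) by (subst (asm) mult_less_cancel_left_pos) auto
  then have "j = k" by linarith
  with assms(1) show ?thesis by simp
qed

context
  fixes q :: nat and chi :: "int \<Rightarrow> complex"
  assumes prim: "primitive_character q chi" and q: "q > 1"
begin

text \<open>The poles of the two generating functions are simple, and a nonzero \<open>s\<close> smaller than \<open>\<pi>/q\<close> keeps them apart and inside
  the strip. So the residue of the product at a pole of one factor is the residue of that factor times the value of the rest.\<close>
lemma moment_integral_residues:
  fixes P :: "complex \<Rightarrow> complex"
  assumes P: "P holomorphic_on UNIV" and growth: "\<And>u. norm (P u) \<le> K * exp (norm u)"
    and diff: "\<And>u. P (u + 2 * of_real pi * \<i>) - P u = u ^ n"
    and s: "s \<noteq> 0" "norm s < pi / real q"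
  shows "moment_integral q chi n s = - 2 * of_real pi * \<i> * (\<Sum>k\<in>{1..<int q}.
           P (gf_pole q k) * (chi k / gauss_sum q chi) * char_gf q chi (gf_pole q k + s) +
           P (gf_pole q k - s) * (cnj (chi k) / gauss_sum q (conj_character chi)) *
             char_gf q (conj_character chi) (gf_pole q k - s))"
proof -
  note prim' = primitive_character_conj[OF prim]
  define F where "F = char_gf q chi"
  define G where "G = char_gf q (conj_character chi)"
  \<comment> \<open>half the distance between neighbouring points \<open>2\<pi>i k/q\<close>\<close>
  define \<rho> where "\<rho> = pi / real q"
  have \<rho>: "\<rho> > 0" "2 * pi / real q = 2 * \<rho>" using q by (auto simp: \<rho>_def)
  define f where "f u = P u * F (u + s) * G u" for u
  define A where "A = gf_pole q ` {1..<int q}"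
  define B where "B = (\<lambda>k. gf_pole q k - s) ` {1..<int q}"
  define S where "S = {u. - \<rho> < Im u \<and> Im u < 2 * pi + \<rho>}"
  have Ims: "\<bar>Im s\<bar> < \<rho>" and Res: "\<bar>Re s\<bar> < \<rho>"
    using s abs_Im_le_cmod[of s] abs_Re_le_cmod[of s] by (auto simp: \<rho>_def)
  have polebd: "2 * \<rho> \<le> Im (gf_pole q k) \<and> Im (gf_pole q k) \<le> 2 * pi - 2 * \<rho>" if "k \<in> {1..<int q}" for k
  proof -
    have "2 * pi / real q * 1 \<le> 2 * pi / real q * of_int k" "2 * pi / real q * of_int k \<le> 2 * pi / real q * (real q - 1)"
      using that q by (intro mult_left_mono; simp)+
    moreover have "2 * pi / real q * (real q - 1) = 2 * pi - 2 * pi / real q"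
      using q by (simp add: field_simps)
    ultimately show ?thesis
      unfolding \<rho>(2)[symmetric] Im_gf_pole by (simp add: mult.commute)
  qed
  have dom1: "u \<in> char_gf_dom q" if "u \<in> S" "u \<notin> A" for u
  proof (rule ccontr)
    assume "u \<notin> char_gf_dom q"
    then show False
      using gf_pole_strip[of u q] q that \<rho> unfolding S_def A_def \<rho>(2) by auto
  qed
  have dom2: "u + s \<in> char_gf_dom q" if "u \<in> S" "u \<notin> B" for u
  proof (rule ccontr)
    assume "u + s \<notin> char_gf_dom q"
    moreover have "- (2 * pi / real q) < Im (u + s)" "Im (u + s) < 2 * pi + 2 * pi / real q"
      using that(1) Ims unfolding \<rho>(2) S_def by auto
    ultimately obtain k where "k \<in> {1..<int q}" "u + s = gf_pole q k"
      using gf_pole_strip[of "u + s" q] q by blast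
    then have "u \<in> B" by (auto simp: B_def image_iff intro!: bexI[of _ k] simp flip: \<open>u + s = gf_pole q k\<close>)
    with that(2) show False by contradiction
  qed
  have AS: "A \<subseteq> S" and BS: "B \<subseteq> S"
    using polebd Ims \<rho>(1) by (force simp: A_def B_def S_def)+
  have small: "norm s < 2 * pi / real q" "norm (- s) < 2 * pi / real q"
    using s(2) \<rho> by (auto simp: \<rho>_def)
  have disj: "A \<inter> B = {}"
  proof (rule ccontr)
    assume "A \<inter> B \<noteq> {}"
    then obtain j k where "gf_pole q j = gf_pole q k - s"
      by (auto simp: A_def B_def)
    then have "gf_pole q k - gf_pole q j = s" by simp
    then show False using gf_pole_diff_small[of q k j s] small(1) q s(1) by simp
  qed
  have inj: "inj_on (gf_pole q) {1..<int q}"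
    using gf_pole_diff_small[of q _ _ 0] q by (auto intro!: inj_onI)
  then have inj': "inj_on (\<lambda>k. gf_pole q k - s) {1..<int q}"
    by (auto simp: inj_on_def)
  have fin: "finite A" "finite B" by (auto simp: A_def B_def)
  have openS: "open S"
    unfolding S_def by (intro open_Collect_conj open_Collect_less continuous_intros)
  have holF: "(\<lambda>u. F (u + s)) holomorphic_on S - B"
    unfolding F_def
    by (intro holomorphic_on_compose_gen[OF _ char_gf_holomorphic, unfolded o_def] holomorphic_intros)
       (use dom2 in auto)
  have holG: "G holomorphic_on S - A"
    unfolding G_def by (rule holomorphic_on_subset[OF char_gf_holomorphic]) (use dom1 in auto)
  have holP: "P holomorphic_on X" for X
    using P by (rule holomorphic_on_subset) auto
  have hol: "f holomorphic_on S - (A \<union> B)"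
    unfolding f_def
    by (intro holomorphic_intros holP holomorphic_on_subset[OF holF] holomorphic_on_subset[OF holG]) auto
  have resA: "residue f (gf_pole q k) = P (gf_pole q k) * F (gf_pole q k + s) * (chi k / gauss_sum q chi)"
    if k: "k \<in> {1..<int q}" for k
  proof -
    define p where "p = gf_pole q k"
    have "p \<in> A" using k by (simp add: p_def A_def)
    then have p: "p \<in> S" "p \<in> S - B" using AS disj by blast+
    have "open (S - B)" using openS fin by (intro open_Diff finite_imp_closed)
    moreover have "continuous_on (S - B) (\<lambda>u. P u * F (u + s))"
      by (intro holomorphic_on_imp_continuous_on holomorphic_on_mult holP holF)
    ultimately have "isCont (\<lambda>u. P u * F (u + s)) p"
      using p(2) continuous_on_eq_continuous_at by blast
    moreover have "((\<lambda>u. G u * (u - p)) \<longlongrightarrow> chi k / gauss_sum q chi) (at p)"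
    proof -
      have "cnj (conj_character chi k) = chi k" by (simp add: conj_character_def)
      then show ?thesis
        using char_gf_pole_limit[OF prim' q k] by (simp add: G_def p_def)
    qed
    ultimately show ?thesis
      unfolding p_def[symmetric] f_def[abs_def] using openS fin p hol
      by (intro residue_times_simple_pole[of S "A \<union> B"]) (auto simp: f_def[abs_def])
  qed
  have resB: "residue f (gf_pole q k - s) =
      P (gf_pole q k - s) * G (gf_pole q k - s) * (cnj (chi k) / gauss_sum q (conj_character chi))"
    if k: "k \<in> {1..<int q}" for k
  proof -
    define p where "p = gf_pole q k - s"
    have "p \<in> B" using k by (simp add: p_def B_def)
    then have p: "p \<in> S" "p \<in> S - A" using BS disj by blast+
    have f_alt: "f = (\<lambda>u. P u * G u * F (u + s))" by (auto simp: f_def)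
    have "open (S - A)" using openS fin by (intro open_Diff finite_imp_closed)
    moreover have "continuous_on (S - A) (\<lambda>u. P u * G u)"
      by (intro holomorphic_on_imp_continuous_on holomorphic_on_mult holP holG)
    ultimately have "isCont (\<lambda>u. P u * G u) p"
      using p(2) continuous_on_eq_continuous_at by blast
    moreover have "((\<lambda>u. F (u + s) * (u - p)) \<longlongrightarrow> cnj (chi k) / gauss_sum q (conj_character chi)) (at p)"
      using LIM_offset[OF char_gf_pole_limit[OF prim q k], of s] by (simp add: F_def p_def algebra_simps)
    ultimately show ?thesis
      unfolding p_def[symmetric] f_alt using openS fin p hol
      by (intro residue_times_simple_pole[of S "A \<union> B"]) (auto simp: f_alt)
  qed
  obtain C1 where C1: "C1 > 0"
    "\<And>u. \<bar>Re u\<bar> \<ge> 1 \<or> \<bar>Im u\<bar> \<le> 0 + 0 * \<bar>Re u\<bar> \<Longrightarrow> norm (F u) \<le> C1 * exp (- \<bar>Re u\<bar>)"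
    using char_gf_bound[OF prim q, of 0 0] q unfolding F_def by auto
  obtain C2 where C2: "C2 > 0"
    "\<And>u. \<bar>Re u\<bar> \<ge> 1 \<or> \<bar>Im u\<bar> \<le> 0 + 0 * \<bar>Re u\<bar> \<Longrightarrow> norm (G u) \<le> C2 * exp (- \<bar>Re u\<bar>)"
    using char_gf_bound[OF prim' q, of 0 0] q unfolding G_def by auto
  have K: "K \<ge> 0"
    using order_trans[OF norm_ge_zero growth[of 0]] by simp
  define h where "h t = of_real t ^ n * G (of_real t) * F (s + of_real t)" for t :: real
  have "integral\<^sup>L lborel h = - 2 * of_real pi * \<i> * (\<Sum>p\<in>A \<union> B. residue f p)"
  proof (rule integral_periodic_strip_residues[where \<rho> = \<rho> and M = "1 + \<rho>" and D = "K * exp (2 * pi) * (C1 * exp \<rho>) * C2"])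
    show "f holomorphic_on {u. - \<rho> < Im u \<and> Im u < 2 * pi + \<rho>} - (A \<union> B)"
      using hol by (simp add: S_def)
    show "0 < Im p \<and> Im p < 2 * pi" if "p \<in> A \<union> B" for p
      using that polebd Ims \<rho>(1) by (force simp: A_def B_def)
    show "integrable lborel h"
      unfolding h_def F_def G_def by (rule moment_integrand_integrable[OF prim q s(2)])
    show "f (of_real t + 2 * of_real pi * \<i>) - f (of_real t) = h t" for t
    proof -
      have "F (of_real t + 2 * of_real pi * \<i> + s) = F (s + of_real t)"
        using char_gf_periodic[of q chi "s + of_real t"] by (simp add: F_def add_ac)
      moreover have "G (of_real t + 2 * of_real pi * \<i>) = G (of_real t)"
        by (simp add: G_def char_gf_periodic)
      ultimately have "f (of_real t + 2 * of_real pi * \<i>) - f (of_real t) =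
          (P (of_real t + 2 * of_real pi * \<i>) - P (of_real t)) * F (s + of_real t) * G (of_real t)"
        by (simp add: f_def algebra_simps)
      then show ?thesis by (simp add: diff h_def)
    qed
    show "norm (f u) \<le> K * exp (2 * pi) * (C1 * exp \<rho>) * C2 * exp (- \<bar>Re u\<bar>)"
      if u: "1 + \<rho> \<le> \<bar>Re u\<bar>" "0 \<le> Im u" "Im u \<le> 2 * pi" for u
    proof -
      have "norm u \<le> \<bar>Re u\<bar> + 2 * pi"
        using cmod_le[of u] u by linarith
      then have "K * exp (norm u) \<le> K * exp (\<bar>Re u\<bar> + 2 * pi)"
        using K by (intro mult_left_mono) auto
      then have 1: "norm (P u) \<le> K * exp (\<bar>Re u\<bar> + 2 * pi)"
        using growth[of u] by linarith
      have Re: "\<bar>Re (u + s)\<bar> \<ge> \<bar>Re u\<bar> - \<rho>" using Res by simp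
      have "norm (F (u + s)) \<le> C1 * exp (- \<bar>Re (u + s)\<bar>)"
        using C1(2)[of "u + s"] Re u by linarith
      also have "\<dots> \<le> C1 * exp (\<rho> - \<bar>Re u\<bar>)"
        using Re C1(1) by (intro mult_left_mono) auto
      finally have 2: "norm (F (u + s)) \<le> C1 * exp (\<rho> - \<bar>Re u\<bar>)" .
      have 3: "norm (G u) \<le> C2 * exp (- \<bar>Re u\<bar>)"
        using C2(2)[of u] u \<rho> by linarith
      have "norm (f u) \<le> K * exp (\<bar>Re u\<bar> + 2 * pi) * (C1 * exp (\<rho> - \<bar>Re u\<bar>)) * (C2 * exp (- \<bar>Re u\<bar>))"
        unfolding f_def norm_mult using K C1(1) C2(1) by (intro mult_mono 1 2 3) auto
      also have "\<dots> = K * exp (2 * pi) * (C1 * exp \<rho>) * C2 * exp (- \<bar>Re u\<bar>)"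
        by (simp add: exp_add exp_diff exp_minus field_simps)
      finally show ?thesis .
    qed
  qed (use \<rho> fin in auto)
  also have "(\<Sum>p\<in>A \<union> B. residue f p) = (\<Sum>k\<in>{1..<int q}. residue f (gf_pole q k)) + (\<Sum>k\<in>{1..<int q}. residue f (gf_pole q k - s))"
    unfolding sum.union_disjoint[OF fin disj] unfolding A_def B_def
    by (simp add: sum.reindex[OF inj] sum.reindex[OF inj'])
  also have "\<dots> = (\<Sum>k\<in>{1..<int q}. residue f (gf_pole q k) + residue f (gf_pole q k - s))"
    by (simp add: sum.distrib)
  also have "integral\<^sup>L lborel h = moment_integral q chi n s"
    unfolding moment_integral_def h_def F_def G_def by (simp add: mult_ac add_ac)
  finally show ?thesis
    by (simp add: resA resB F_def G_def mult_ac)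
qed

end

section \<open>Bernoulli polynomials\<close>

definition bernoulli_fps :: "'a :: field_char_0 \<Rightarrow> 'a fps" where
  "bernoulli_fps x = fps_X * fps_exp x / (fps_exp 1 - 1)"

lemma bernoulli_poly_eq: "bernoulli_poly n x = fact n * fps_nth (bernoulli_fps x) n"
  by (simp add: bernoulli_poly_def bernoulli_fps_def)

lemma fps_exp_minus_1_neq_0: "c \<noteq> 0 \<Longrightarrow> fps_exp c - 1 \<noteq> (0 :: 'a :: field_char_0 fps)"
  by (auto simp: fps_eq_iff intro!: exI[of _ 1])

lemma subdegree_fps_exp_minus_1:
  assumes "c \<noteq> 0"
  shows "subdegree (fps_exp c - 1 :: 'a :: field_char_0 fps) = 1"
        "subdegree (1 - fps_exp c :: 'a :: field_char_0 fps) = 1"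
  using assms by (auto intro!: subdegreeI)

lemma bernoulli_fps_mult: "bernoulli_fps x * (fps_exp 1 - 1) = fps_X * fps_exp x"
proof -
  have "fps_exp 1 - 1 dvd fps_X * fps_exp x"
    by (subst fps_dvd_iff)
       (auto simp: fps_exp_minus_1_neq_0 subdegree_fps_exp_minus_1)
  then show ?thesis
    unfolding bernoulli_fps_def by (rule dvd_div_mult_self)
qed

lemma bernoulli_fps_eqI:
  assumes "F * (fps_exp 1 - 1) = fps_X * fps_exp x"
  shows "F = bernoulli_fps x"
  using assms bernoulli_fps_mult[of x] fps_exp_minus_1_neq_0[of "1 :: 'a"] by (metis mult_cancel_right one_neq_zero)

lemma bernoulli_fps_add: "bernoulli_fps (x + y) = bernoulli_fps x * fps_exp y"
proof (rule bernoulli_fps_eqI[symmetric])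
  have "bernoulli_fps x * fps_exp y * (fps_exp 1 - 1) = (bernoulli_fps x * (fps_exp 1 - 1)) * fps_exp y"
    by (simp only: mult_ac)
  also have "\<dots> = fps_X * fps_exp (x + y)"
    by (simp add: bernoulli_fps_mult fps_exp_add_mult mult_ac)
  finally show "bernoulli_fps x * fps_exp y * (fps_exp 1 - 1) = fps_X * fps_exp (x + y)" .
qed

lemma bernoulli_fps_0: "fps_nth (bernoulli_fps x) 0 = 1"
proof -
  have "fps_nth (bernoulli_fps x * (fps_exp 1 - 1)) 1 = fps_nth (fps_X * fps_exp x) 1"
    by (simp only: bernoulli_fps_mult)
  then show ?thesis by (simp add: fps_mult_nth)
qed

lemma bernoulli_poly_add:
  "bernoulli_poly n (x + y) =
     fact n * (\<Sum>i=0..n. fps_nth (bernoulli_fps x) i * (y ^ (n - i) / fact (n - i)))"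
  by (simp add: bernoulli_poly_eq bernoulli_fps_add fps_mult_nth)

lemma bernoulli_poly_diff:
  "bernoulli_poly (Suc n) (x + 1) - bernoulli_poly (Suc n) x = of_nat (Suc n) * x ^ n"
proof -
  have "fps_nth (bernoulli_fps (x + 1) - bernoulli_fps x) (Suc n) = x ^ n / fact n"
  proof -
    have "bernoulli_fps (x + 1) - bernoulli_fps x = bernoulli_fps x * (fps_exp 1 - 1)"
      unfolding bernoulli_fps_add[of x 1] by (simp only: right_diff_distrib mult_1_right)
    then show ?thesis by (simp add: bernoulli_fps_mult)
  qed
  then have "fps_nth (bernoulli_fps (x + 1)) (Suc n) = fps_nth (bernoulli_fps x) (Suc n) + x ^ n / fact n"
    by (simp add: algebra_simps)
  then show ?thesis
    by (simp add: bernoulli_poly_eq algebra_simps)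
qed

text \<open>Rescaling the variable of the generating function by \<open>c\<close>. It is used with \<open>c = q\<close> and with \<open>c = -q\<close>; the value at 0 removes
  the singularity.\<close>
lemma bernoulli_kernel_fps:
  fixes c x :: complex
  assumes c: "c \<noteq> 0"
  shows "(\<lambda>s. if s = 0 then 1 / c else s * exp (c * x * s) / (exp (c * s) - 1)) has_fps_expansion
           Abs_fps (\<lambda>j. fps_nth (bernoulli_fps x) j * c ^ j / c)"
proof -
  define D where "D = Abs_fps (\<lambda>j. fps_nth (bernoulli_fps x) j * c ^ j / c)"
  have "D * (fps_exp c - 1) = fps_X * fps_exp (c * x)"
  proof (rule fps_ext)
    fix m
    have "fps_nth (D * (fps_exp c - 1)) m =
          (\<Sum>i=0..m. fps_nth (bernoulli_fps x) i * c ^ i / c * fps_nth (fps_exp c - 1) (m - i))"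
      by (simp add: fps_mult_nth D_def)
    also have "\<dots> = (\<Sum>i=0..m. c ^ m / c * (fps_nth (bernoulli_fps x) i * fps_nth (fps_exp 1 - 1) (m - i)))"
    proof (intro sum.cong refl)
      fix i assume i: "i \<in> {0..m}"
      have "fps_nth (fps_exp c - 1) (m - i) = c ^ (m - i) * fps_nth (fps_exp 1 - 1) (m - i)"
        by (auto simp: fps_one_nth)
      moreover have "c ^ i * c ^ (m - i) = c ^ m"
        using i by (simp flip: power_add)
      ultimately show "fps_nth (bernoulli_fps x) i * c ^ i / c * fps_nth (fps_exp c - 1) (m - i) =
           c ^ m / c * (fps_nth (bernoulli_fps x) i * fps_nth (fps_exp 1 - 1) (m - i))"
        by (metis (no_types, lifting) mult.assoc mult.commute times_divide_eq_left)
    qed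
    also have "\<dots> = c ^ m / c * fps_nth (bernoulli_fps x * (fps_exp 1 - 1)) m"
      by (simp add: fps_mult_nth sum_distrib_left)
    also have "\<dots> = fps_nth (fps_X * fps_exp (c * x)) m"
      using c by (cases m) (simp_all add: bernoulli_fps_mult power_mult_distrib)
    finally show "fps_nth (D * (fps_exp c - 1)) m = fps_nth (fps_X * fps_exp (c * x)) m" .
  qed
  then have D: "D = fps_X * fps_exp (c * x) / (fps_exp c - 1)"
    using fps_exp_minus_1_neq_0[OF c] by (metis nonzero_mult_div_cancel_right)
  have "(\<lambda>s. if s = 0 then 1 / c else s * exp (c * x * s) / (exp (c * s) - 1)) has_fps_expansion
          (fps_X * fps_exp (c * x)) / (fps_exp c - 1)"
    using c
    by (intro has_fps_expansion_divide fps_expansion_intros)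
       (auto simp: fps_exp_minus_1_neq_0 subdegree_fps_exp_minus_1)
  then show ?thesis
    unfolding D[symmetric] D_def .
qed

section \<open>The Taylor coefficients of the period function\<close>

definition char_bernoulli_sum :: "nat \<Rightarrow> (int \<Rightarrow> complex) \<Rightarrow> nat \<Rightarrow> complex" where
  "char_bernoulli_sum q chi j = (\<Sum>a\<in>{1..<q}. \<Sum>b\<in>{1..<q}.
     chi (int a) * chi (int b) * root_xi q ^ (a * b) *
       (bernoulli_poly j (of_nat a / of_nat q) * bernoulli_poly j (of_nat b / of_nat q)))"

lemma sum_int_nat: "(\<Sum>k\<in>{1..<int q}. f k) = (\<Sum>k\<in>{1..<q}. f (int k))"
  by (rule sum.reindex_bij_witness[of _ int nat]) auto

lemma B_chi_eq:
  assumes dc: "dirichlet_character q chi" and q: "q > 1"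
  shows "B_chi q chi j = (2 * of_real pi * \<i> * of_nat q) ^ j /
           (gauss_sum q chi * of_nat (j + 1) * fact (j + 1)) * char_bernoulli_sum q chi (j + 1)"
proof -
  have "chi (int q) = 0"
    using q by (simp add: dirichlet_eq_0_iff[OF dc])
  moreover have "{1..q} = insert q {1..<q}" using q by auto
  ultimately show ?thesis
    by (simp add: B_chi_def char_bernoulli_sum_def dirichlet_mult[OF dc] mult_ac)
qed

context
  fixes q :: nat and chi :: "int \<Rightarrow> complex"
  assumes prim: "primitive_character q chi" and q: "q > 1"
begin

lemma char_bernoulli_sum_0: "char_bernoulli_sum q chi 0 = of_nat (totient q) * gauss_sum q chi"
proof -
  note dc = primitive_character_imp_dirichlet[OF prim]
  have inner: "(\<Sum>b\<in>{1..<q}. chi (int b) * root_xi q ^ (a * b)) = cnj (chi (int a)) * gauss_sum q chi" for a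
  proof -
    have "{1..q-1} = {1..<q}" using q by auto
    then have "(\<Sum>b\<in>{1..<q}. chi (int b) * root_xi q ^ (a * b)) = (\<Sum>b=1..q-1. chi (int b) * add_char q (int b * int a))"
      by (simp add: root_xi_power mult_ac)
    also have "\<dots> = (\<Sum>k\<in>{0..<int q}. chi k * add_char q (k * int a))"
      by (rule sum_dirichlet_int_nat[OF dc q, symmetric])
    also have "\<dots> = cnj (chi (int a)) * gauss_sum q chi"
      by (rule gauss_sum_twist[OF prim q])
    finally show ?thesis .
  qed
  have "char_bernoulli_sum q chi 0 = (\<Sum>a\<in>{1..<q}. chi (int a) * (\<Sum>b\<in>{1..<q}. chi (int b) * root_xi q ^ (a * b)))"
    by (simp add: char_bernoulli_sum_def bernoulli_poly_eq bernoulli_fps_0 sum_distrib_left mult_ac)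
  also have "\<dots> = (\<Sum>a\<in>{1..<q}. (if coprime a q then 1 else 0)) * gauss_sum q chi"
    unfolding inner sum_distrib_right
    by (intro sum.cong refl) (simp add: dirichlet_mult_cnj[OF dc] flip: mult.assoc)
  also have "(\<Sum>a\<in>{1..<q}. (if coprime a q then 1 else 0)) = of_nat (card {a\<in>{1..<q}. coprime a q})"
    by (simp add: sum.If_cases Int_def)
  also have "{a\<in>{1..<q}. coprime a q} = totatives q"
    using q by (auto simp: totatives_def le_less)
  finally show ?thesis
    by (simp add: totient_def)
qed

text \<open>Shifting by a pole multiplies the \<open>b\<close>-th exponential by \<open>\<xi>^(k b)\<close>. The closed form is applied at the negated argument,
  because this yields directly the generating function \<open>e^(b s) / (e^(q s) - 1)\<close> of the Bernoulli polynomials at \<open>b/q\<close>.\<close>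
lemma char_gf_near_pole:
  assumes s: "exp (of_nat q * s) \<noteq> 1"
  shows "char_gf q chi (gf_pole q (int k) + s) =
           chi (- 1) * (\<Sum>b\<in>{1..<q}. chi (int b) * root_xi q ^ (k * b) * (exp (of_nat b * s) / (exp (of_nat q * s) - 1)))"
proof -
  note dc = primitive_character_imp_dirichlet[OF prim]
  have chi0: "chi 0 = 0" using q by (simp add: dirichlet_eq_0_iff[OF dc])
  define u where "u = gf_pole q (int k) + s"
  have eu: "exp (of_nat b * u) = root_xi q ^ (k * b) * exp (of_nat b * s)" for b
  proof -
    have "exp (of_nat b * u) = exp (gf_pole q (int k)) ^ b * exp (of_nat b * s)"
      unfolding exp_of_nat_mult[symmetric] exp_add[symmetric] by (simp add: u_def ring_distribs)
    then show ?thesis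
      by (simp add: exp_gf_pole add_char_power root_xi_power)
  qed
  have "root_xi q ^ (k * q) = 1"
    using q by (simp add: root_xi_power add_char_eq_1_iff)
  then have equ: "exp (of_nat q * u) = exp (of_nat q * s)"
    by (simp add: eu)
  have "u \<in> char_gf_dom q"
  proof (rule ccontr)
    assume "u \<notin> char_gf_dom q"
    then obtain j where "exp u * add_char q (- j) = 1"
      by (auto simp: char_gf_dom_def)
    then have "exp u = add_char q j"
      by (simp add: add_char_minus field_simps)
    then have "exp (of_nat q * u) = 1"
      using q by (simp add: exp_of_nat_mult add_char_power add_char_eq_1_iff)
    then show False using s equ by simp
  qed
  then have "char_gf q chi u = - (chi (- 1) * char_gf q chi (- u))"
    using char_gf_minus[OF prim q] dirichlet_minus_1_square[OF dc] by (simp flip: mult.assoc)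
  also have "char_gf q chi (- u) =
      (\<Sum>b<q. chi (int b) * exp (- (of_nat b * - u))) / (1 - exp (- (of_nat q * - u)))"
    using s equ by (intro char_gf_eq[OF prim q]) (simp add: exp_minus)
  also have "(\<Sum>b<q. chi (int b) * exp (- (of_nat b * - u))) = (\<Sum>b\<in>{1..<q}. chi (int b) * (root_xi q ^ (k * b) * exp (of_nat b * s)))"
    by (simp add: eu) (intro sum.mono_neutral_right, auto simp: chi0 not_le)
  also have "- (chi (- 1) * ((\<Sum>b\<in>{1..<q}. chi (int b) * (root_xi q ^ (k * b) * exp (of_nat b * s))) / (1 - exp (- (of_nat q * - u))))) =
      chi (- 1) * ((\<Sum>b\<in>{1..<q}. chi (int b) * (root_xi q ^ (k * b) * exp (of_nat b * s))) / (exp (of_nat q * s) - 1))"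
    using equ s by (simp add: field_simps)
  finally show ?thesis
    unfolding u_def sum_divide_distrib by (simp add: mult_ac)
qed

end

text \<open>A polynomial \<open>P\<close> with \<open>P(u + 2\<pi>i) - P(u) = u^n\<close>.\<close>
definition bernoulli_antidifference :: "nat \<Rightarrow> complex \<Rightarrow> complex" where
  "bernoulli_antidifference n u = (2 * of_real pi * \<i>) ^ n / of_nat (Suc n) * bernoulli_poly (Suc n) (u / (2 * of_real pi * \<i>))"

lemma bernoulli_antidifference_diff:
  "bernoulli_antidifference n (u + 2 * of_real pi * \<i>) - bernoulli_antidifference n u = u ^ n"
proof -
  define c where "c = 2 * of_real pi * \<i>"
  have c: "c \<noteq> 0" by (simp add: c_def)
  have "bernoulli_antidifference n (u + c) - bernoulli_antidifference n u =
        c ^ n / of_nat (Suc n) * (bernoulli_poly (Suc n) (u / c + 1) - bernoulli_poly (Suc n) (u / c))"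
    using c by (simp add: bernoulli_antidifference_def add_divide_distrib right_diff_distrib flip: c_def)
  also have "\<dots> = c ^ n / of_nat (Suc n) * (of_nat (Suc n) * (u / c) ^ n)"
    by (simp only: bernoulli_poly_diff)
  also have "\<dots> = u ^ n"
    using c by (simp add: power_divide del: of_nat_Suc)
  finally show ?thesis by (simp add: c_def)
qed

lemma bernoulli_antidifference_expand:
  "bernoulli_antidifference n (v + u) = (\<Sum>i=0..Suc n. (2 * of_real pi * \<i>) ^ n * fact n *
     fps_nth (bernoulli_fps (v / (2 * of_real pi * \<i>))) i / fact (Suc n - i) * (u / (2 * of_real pi * \<i>)) ^ (Suc n - i))"
  unfolding bernoulli_antidifference_def add_divide_distrib bernoulli_poly_add sum_distrib_left
  by (intro sum.cong refl) (simp add: field_simps del: of_nat_Suc)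

lemma bernoulli_antidifference_holomorphic: "bernoulli_antidifference n holomorphic_on A"
proof -
  have "(\<lambda>u. bernoulli_antidifference n (0 + u)) holomorphic_on A"
    unfolding bernoulli_antidifference_expand by (intro holomorphic_intros) auto
  then show ?thesis by simp
qed

lemma bernoulli_antidifference_growth: "\<exists>K. \<forall>u. norm (bernoulli_antidifference n u) \<le> K * exp (norm u)"
proof -
  define c where "c = 2 * complex_of_real pi * \<i>"
  define a where "a i = c ^ n * fact n * fps_nth (bernoulli_fps (0 / c)) i / fact (Suc n - i)" for i
  have c: "norm c \<ge> 1" using pi_gt3 by (simp add: c_def norm_mult)
  have "norm (bernoulli_antidifference n u) \<le> (\<Sum>i=0..Suc n. norm (a i) * fact (Suc n - i)) * exp (norm u)" for u
  proof -
    have "norm (bernoulli_antidifference n u) = norm (\<Sum>i=0..Suc n. a i * (u / c) ^ (Suc n - i))"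
      using bernoulli_antidifference_expand[of n 0 u] by (simp add: a_def c_def)
    also have "\<dots> \<le> (\<Sum>i=0..Suc n. norm (a i) * (fact (Suc n - i) * exp (norm u)))"
    proof (rule sum_norm_le)
      fix i
      have "norm (u / c) ^ (Suc n - i) \<le> norm u ^ (Suc n - i)"
        using c by (intro power_mono) (auto simp: norm_divide divide_le_eq mult_le_cancel_left1)
      also have "\<dots> \<le> fact (Suc n - i) * exp (norm u)"
        by (rule power_le_fact_exp) simp
      finally show "norm (a i * (u / c) ^ (Suc n - i)) \<le> norm (a i) * (fact (Suc n - i) * exp (norm u))"
        unfolding norm_mult norm_power by (intro mult_left_mono) auto
    qed
    finally show ?thesis
      by (simp only: sum_distrib_right mult.assoc)
  qed
  then show ?thesis by blast
qed

context
  fixes q :: nat and chi :: "int \<Rightarrow> complex"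
  assumes prim: "primitive_character q chi" and q: "q > 1"
begin

text \<open>Multiplied by \<open>s\<close>, every summand of the residue formula has an explicit power series at 0, and the coefficients of
  \<open>s^(n+1)\<close> can be compared.\<close>
lemma moment_integral_coeff:
  assumes A: "moment_integral q chi n has_fps_expansion A"
  shows "fps_nth A n = - 2 * of_real pi * \<i> * chi (- 1) *
    ((2 * of_real pi * \<i>) ^ n * fact n * of_nat q ^ n * char_bernoulli_sum q chi (Suc n) / (fact (Suc n) * fact (Suc n) * gauss_sum q chi) +
     (\<Sum>i=0..Suc n. (2 * of_real pi * \<i>) ^ n * fact n / fact (Suc n - i) * (- 1 / (2 * of_real pi * \<i>)) ^ (Suc n - i) *
        ((- of_nat q) ^ i / (- of_nat q)) * char_bernoulli_sum q (conj_character chi) i /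
          (fact i * fact i * gauss_sum q (conj_character chi))))"
proof -
  note dc = primitive_character_imp_dirichlet[OF prim]
  note prim' = primitive_character_conj[OF prim]
  define c where "c = 2 * complex_of_real pi * \<i>"
  define T where "T = gauss_sum q chi"
  define T' where "T' = gauss_sum q (conj_character chi)"
  define N where "N = complex_of_nat q"
  define P where "P = bernoulli_antidifference n"
  define H where "H m x s = (if s = 0 then 1 / m else s * exp (m * x * s) / (exp (m * s) - 1))" for m x s :: complex
  define D where "D m x = Abs_fps (\<lambda>j. fps_nth (bernoulli_fps x) j * m ^ j / m)" for m x :: complex
  define a where "a i k = c ^ n * fact n * fps_nth (bernoulli_fps (of_nat k / N)) i / fact (Suc n - i) * (- 1 / c) ^ (Suc n - i)"
    for i k :: nat
  define w where "w k b = chi (int k) * chi (int b) * root_xi q ^ (k * b) / T" for k b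
  define w' where "w' k b = cnj (chi (int k)) * cnj (chi (int b)) * root_xi q ^ (k * b) / T'" for k b
  define p where "p k = gf_pole q (int k)" for k
  define Q where "Q = fps_const (- c * chi (- 1)) * (\<Sum>k\<in>{1..<q}. \<Sum>b\<in>{1..<q}.
      fps_const (w k b * P (p k)) * D N (of_nat b / N) +
      fps_const (w' k b) * ((\<Sum>i=0..Suc n. fps_const (a i k) * fps_X ^ (Suc n - i)) * D (- N) (of_nat b / N)))"
  define \<Phi> where "\<Phi> s = (- c * chi (- 1)) * (\<Sum>k\<in>{1..<q}. \<Sum>b\<in>{1..<q}.
      (w k b * P (p k)) * H N (of_nat b / N) s +
      w' k b * ((\<Sum>i=0..Suc n. a i k * s ^ (Suc n - i)) * H (- N) (of_nat b / N) s))" for s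
  have c0: "c \<noteq> 0" and N0: "N \<noteq> 0" using q by (auto simp: c_def N_def)
  have pc: "p k / c = of_nat k / N" for k
    using c0 by (simp add: p_def gf_pole_def c_def N_def)
  have H: "H m x has_fps_expansion D m x" if "m \<noteq> 0" for m x
    using bernoulli_kernel_fps[OF that, of x] unfolding H_def D_def .
  have \<Phi>: "\<Phi> has_fps_expansion Q"
    unfolding \<Phi>_def Q_def using N0
    by (intro has_fps_expansion_cmult_left has_fps_expansion_sum has_fps_expansion_add
              has_fps_expansion_mult has_fps_expansion_fps_X_power H) auto
  have P_expand: "P (p k - s) = (\<Sum>i=0..Suc n. a i k * s ^ (Suc n - i))" for k s
  proof -
    have "P (p k + - s) = (\<Sum>i=0..Suc n. a i k * s ^ (Suc n - i))"
      unfolding P_def bernoulli_antidifference_expand a_def c_def[symmetric] pc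
    proof (intro sum.cong refl)
      fix i
      have "(- s / c) ^ (Suc n - i) = (- 1 / c) ^ (Suc n - i) * s ^ (Suc n - i)"
        by (simp flip: power_mult_distrib)
      then show "c ^ n * fact n * fps_nth (bernoulli_fps (of_nat k / N)) i / fact (Suc n - i) * (- s / c) ^ (Suc n - i) =
          c ^ n * fact n * fps_nth (bernoulli_fps (of_nat k / N)) i / fact (Suc n - i) * (- 1 / c) ^ (Suc n - i) * s ^ (Suc n - i)"
        by simp
    qed
    then show ?thesis by simp
  qed
  have eq: "s * moment_integral q chi n s = \<Phi> s" if s: "s \<noteq> 0" "norm s < pi / real q" for s
  proof -
    obtain K where K: "\<And>u. norm (P u) \<le> K * exp (norm u)"
      using bernoulli_antidifference_growth[of n] unfolding P_def by blast
    have "real q * norm s < pi"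
      using s(2) q by (simp add: field_simps)
    then have "\<bar>Im (N * s)\<bar> < 2 * pi"
      using abs_Im_le_cmod[of "N * s"] pi_gt_zero unfolding N_def norm_mult norm_of_nat by linarith
    then have e: "exp (N * s) \<noteq> 1" "exp (N * - s) \<noteq> 1"
      using exp_eq_1_small[of "N * s"] N0 s(1) by (auto simp: exp_minus)
    have g1: "s * char_gf q chi (p k + s) = chi (- 1) * (\<Sum>b\<in>{1..<q}. chi (int b) * root_xi q ^ (k * b) * H N (of_nat b / N) s)" for k
      using char_gf_near_pole[OF prim q e(1)[unfolded N_def], of k] s(1) N0
      by (simp add: p_def H_def N_def sum_distrib_left mult_ac)
    have g2: "s * char_gf q (conj_character chi) (p k - s) = chi (- 1) * (\<Sum>b\<in>{1..<q}. cnj (chi (int b)) * root_xi q ^ (k * b) * H (- N) (of_nat b / N) s)" for k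
      using char_gf_near_pole[OF prim' q e(2)[unfolded N_def], of k] s(1) N0
      by (simp add: p_def H_def N_def sum_distrib_left mult_ac conj_character_def dirichlet_minus_1_real[OF dc])
    have "moment_integral q chi n s = - 2 * of_real pi * \<i> * (\<Sum>k\<in>{1..<int q}.
           P (gf_pole q k) * (chi k / T) * char_gf q chi (gf_pole q k + s) +
           P (gf_pole q k - s) * (cnj (chi k) / T') * char_gf q (conj_character chi) (gf_pole q k - s))"
      unfolding T_def T'_def
      by (rule moment_integral_residues[OF prim q _ K _ s])
         (simp_all add: P_def bernoulli_antidifference_holomorphic bernoulli_antidifference_diff)
    then have "s * moment_integral q chi n s = - c * (\<Sum>k\<in>{1..<q}.
           P (p k) * (chi (int k) / T) * (s * char_gf q chi (p k + s)) +
           P (p k - s) * (cnj (chi (int k)) / T') * (s * char_gf q (conj_character chi) (p k - s)))"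
      unfolding sum_int_nat p_def c_def by (simp add: sum_distrib_left ring_distribs mult_ac)
    also have "\<dots> = \<Phi> s"
      unfolding g1 g2 P_expand \<Phi>_def w_def w'_def
      by (simp add: sum_distrib_left sum.distrib ring_distribs mult_ac)
    finally show ?thesis .
  qed
  \<comment> \<open>the formula holds only for \<open>s \<noteq> 0\<close>, so the expansions are compared as Laurent series\<close>
  have "fps_X * A = Q"
  proof -
    have ev: "eventually (\<lambda>s. s * moment_integral q chi n s = \<Phi> s) (at 0)"
    proof -
      have "eventually (\<lambda>s. s \<in> ball 0 (pi / real q) - {0}) (at (0::complex))"
        using q by (intro eventually_at_in_open) auto
      then show ?thesis
        by eventually_elim (use eq in auto)
    qed
    have "(\<lambda>s. s * moment_integral q chi n s) has_laurent_expansion fps_to_fls (fps_X * A)"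
      by (intro has_laurent_expansion_fps has_fps_expansion_mult has_fps_expansion_fps_X A)
    then have "\<Phi> has_laurent_expansion fps_to_fls (fps_X * A)"
      using has_laurent_expansion_cong[OF ev refl] by blast
    then have "fps_to_fls (fps_X * A) = fps_to_fls Q"
      by (rule has_laurent_expansion_unique) (rule has_laurent_expansion_fps[OF \<Phi>])
    then show ?thesis by simp
  qed
  then have "fps_nth A n = fps_nth Q (Suc n)"
    by (metis fps_X_mult_nth diff_Suc_1 nat.distinct(1))
  also have "\<dots> = - c * chi (- 1) * (\<Sum>k\<in>{1..<q}. \<Sum>b\<in>{1..<q}.
      w k b * P (p k) * fps_nth (D N (of_nat b / N)) (Suc n) +
      w' k b * (\<Sum>i=0..Suc n. a i k * fps_nth (D (- N) (of_nat b / N)) i))"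
  proof -
    have "fps_nth ((\<Sum>i=0..Suc n. fps_const (a i k) * fps_X ^ (Suc n - i)) * D (- N) x) (Suc n) =
          (\<Sum>i=0..Suc n. a i k * fps_nth (D (- N) x) i)" for k x
      unfolding sum_distrib_right fps_sum_nth
    proof (intro sum.cong refl)
      fix i assume "i \<in> {0..Suc n}"
      then have "Suc n - (Suc n - i) = i" "\<not> Suc n < Suc n - i" by auto
      then show "fps_nth (fps_const (a i k) * fps_X ^ (Suc n - i) * D (- N) x) (Suc n) = a i k * fps_nth (D (- N) x) i"
        by (simp only: mult.assoc fps_mult_left_const_nth fps_X_power_mult_nth if_False)
    qed
    then show ?thesis
      by (simp only: Q_def fps_mult_left_const_nth fps_sum_nth fps_add_nth)
  qed
  also have "(\<Sum>k\<in>{1..<q}. \<Sum>b\<in>{1..<q}.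
      w k b * P (p k) * fps_nth (D N (of_nat b / N)) (Suc n) +
      w' k b * (\<Sum>i=0..Suc n. a i k * fps_nth (D (- N) (of_nat b / N)) i)) =
      (\<Sum>k\<in>{1..<q}. \<Sum>b\<in>{1..<q}. w k b * P (p k) * fps_nth (D N (of_nat b / N)) (Suc n)) +
      (\<Sum>k\<in>{1..<q}. \<Sum>b\<in>{1..<q}. \<Sum>i=0..Suc n. w' k b * (a i k * fps_nth (D (- N) (of_nat b / N)) i))"
    by (simp only: sum.distrib sum_distrib_left)
  also have "(\<Sum>k\<in>{1..<q}. \<Sum>b\<in>{1..<q}. w k b * P (p k) * fps_nth (D N (of_nat b / N)) (Suc n)) =
      c ^ n * fact n * N ^ n * char_bernoulli_sum q chi (Suc n) / (fact (Suc n) * fact (Suc n) * T)"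
    unfolding char_bernoulli_sum_def sum_distrib_left sum_divide_distrib
  proof (intro sum.cong refl)
    fix k b
    have e1: "P (p k) = c ^ n / of_nat (Suc n) * bernoulli_poly (Suc n) (of_nat k / N)"
      unfolding P_def bernoulli_antidifference_def c_def[symmetric] pc ..
    have e2: "fps_nth (D N (of_nat b / N)) (Suc n) = bernoulli_poly (Suc n) (of_nat b / N) / fact (Suc n) * N ^ n"
      using N0 by (simp add: D_def bernoulli_poly_eq del: fact_Suc of_nat_Suc)
    show "w k b * P (p k) * fps_nth (D N (of_nat b / N)) (Suc n) =
      c ^ n * fact n * N ^ n *
         (chi (int k) * chi (int b) * root_xi q ^ (k * b) *
          (bernoulli_poly (Suc n) (of_nat k / of_nat q) * bernoulli_poly (Suc n) (of_nat b / of_nat q))) /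
         (fact (Suc n) * fact (Suc n) * T)"
      unfolding e1 e2 by (simp add: w_def N_def divide_simps del: of_nat_Suc)
  qed
  also have "(\<Sum>k\<in>{1..<q}. \<Sum>b\<in>{1..<q}. \<Sum>i=0..Suc n. w' k b * (a i k * fps_nth (D (- N) (of_nat b / N)) i)) =
      (\<Sum>k\<in>{1..<q}. \<Sum>i=0..Suc n. \<Sum>b\<in>{1..<q}. w' k b * (a i k * fps_nth (D (- N) (of_nat b / N)) i))"
    by (intro sum.cong refl sum.swap)
  also have "\<dots> = (\<Sum>i=0..Suc n. \<Sum>k\<in>{1..<q}. \<Sum>b\<in>{1..<q}. w' k b * (a i k * fps_nth (D (- N) (of_nat b / N)) i))"
    by (rule sum.swap)
  also have "\<dots> = (\<Sum>i=0..Suc n. c ^ n * fact n / fact (Suc n - i) * (- 1 / c) ^ (Suc n - i) *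
        ((- N) ^ i / (- N)) * char_bernoulli_sum q (conj_character chi) i / (fact i * fact i * T'))"
    unfolding char_bernoulli_sum_def sum_distrib_left[of "_ * (_ / _)"] sum_divide_distrib[of _ _ "_ * T'"]
  proof (intro sum.cong refl)
    fix i k b
    have "a i k = c ^ n * fact n * (bernoulli_poly i (of_nat k / N) / fact i) / fact (Suc n - i) * (- 1 / c) ^ (Suc n - i)"
      by (simp add: a_def bernoulli_poly_eq)
    moreover have "fps_nth (D (- N) (of_nat b / N)) i = bernoulli_poly i (of_nat b / N) / fact i * ((- N) ^ i / (- N))"
      by (simp add: D_def bernoulli_poly_eq)
    ultimately show "w' k b * (a i k * fps_nth (D (- N) (of_nat b / N)) i) =
        c ^ n * fact n / fact (Suc n - i) * (- 1 / c) ^ (Suc n - i) * ((- N) ^ i / (- N)) *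
         (conj_character chi (int k) * conj_character chi (int b) * root_xi q ^ (k * b) *
          (bernoulli_poly i (of_nat k / of_nat q) * bernoulli_poly i (of_nat b / of_nat q))) /
         (fact i * fact i * T')"
      by (simp add: w'_def N_def conj_character_def mult_ac)
  qed
  finally show ?thesis
    unfolding T_def T'_def N_def c_def by (simp only: mult_minus_left)
qed

end

theorem theorem1p2:
  fixes q n :: nat and chi :: "int \<Rightarrow> complex"
  assumes "q \<ge> 3" and "primitive_character q chi"
  shows "(deriv ^^ n) (psi_chi q chi) 1 / fact n =
           of_nat (totient q) / (2 * of_real pi * \<i> * of_nat q) * ((- 1) ^ n / of_nat (n + 1))
           + B_chi q chi n
           + (- 1) ^ n * (\<Sum>j = 0..n. of_nat (n choose j) * B_chi q (conj_character chi) j)"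
proof -
  have q: "q > 1" using assms(1) by simp
  note prim = assms(2)
  note prim' = primitive_character_conj[OF prim]
  note dc = primitive_character_imp_dirichlet[OF prim]
  note dc' = dirichlet_character_conj[OF dc]
  define c where "c = 2 * complex_of_real pi * \<i>"
  define N where "N = complex_of_nat q"
  define T where "T = gauss_sum q chi"
  define T' where "T' = gauss_sum q (conj_character chi)"
  have nz: "c \<noteq> 0" "N \<noteq> 0" "T \<noteq> 0" "T' \<noteq> 0"
    using q gauss_sum_neq_0[OF prim q] gauss_sum_neq_0[OF prim' q] by (auto simp: c_def N_def T_def T'_def)
  define g where "g i = c ^ n * fact n / fact (Suc n - i) * (- 1 / c) ^ (Suc n - i) *
        ((- N) ^ i / (- N)) * char_bernoulli_sum q (conj_character chi) i / (fact i * fact i * T')" for i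
  define U where "U = c ^ n * fact n * N ^ n * char_bernoulli_sum q chi (Suc n) / (fact (Suc n) * fact (Suc n) * T)"
  have "(deriv ^^ n) (psi_chi q chi) 1 / fact n =
        chi (- 1) * \<i> / (2 * of_real pi) * (- c * chi (- 1) * (U + (\<Sum>i=0..Suc n. g i)))"
    unfolding psi_chi_taylor[OF prim q moment_integral_fps[OF prim q]]
              moment_integral_coeff[OF prim q moment_integral_fps[OF prim q]]
    by (simp add: U_def g_def c_def N_def T_def T'_def)
  also have "\<dots> = (chi (- 1) * chi (- 1)) * (- c * \<i> / (2 * of_real pi)) * (U + (\<Sum>i=0..Suc n. g i))"
    by simp
  also have "- c * \<i> / (2 * of_real pi) = 1"
    by (simp add: c_def)
  also have "chi (- 1) * chi (- 1) = 1"
    by (rule dirichlet_minus_1_square[OF dc])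
  also have "U = B_chi q chi n"
    using nz unfolding U_def B_chi_eq[OF dc q] c_def[symmetric] N_def[symmetric] T_def[symmetric]
    by (simp add: power_mult_distrib divide_simps)
  \<comment> \<open>the Bernoulli index is shifted by one against the index of \<open>B_chi\<close>; index 0 gives the totient term\<close>
  also have "(\<Sum>i=0..Suc n. g i) = g 0 + (\<Sum>j=0..n. g (Suc j))"
    unfolding sum.atLeast0_atMost_Suc_shift o_def ..
  also have "g 0 = of_nat (totient q) / (c * N) * ((- 1) ^ n / of_nat (n + 1))"
  proof -
    have "char_bernoulli_sum q (conj_character chi) 0 = of_nat (totient q) * T'"
      unfolding T'_def by (rule char_bernoulli_sum_0[OF prim' q])
    moreover have "(- 1 / c) ^ (Suc n - 0) = (- 1) ^ Suc n / c ^ Suc n"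
      by (simp only: power_divide diff_zero)
    ultimately show ?thesis
      unfolding g_def using nz by (simp add: divide_simps mult.commute[of "c ^ n"])
  qed
  also have "(\<Sum>j=0..n. g (Suc j)) = (\<Sum>j=0..n. (- 1) ^ n * (of_nat (n choose j) * B_chi q (conj_character chi) j))"
  proof (intro sum.cong refl)
    fix j assume j: "j \<in> {0..n}"
    define m where "m = n - j"
    have n: "n = j + m" using j by (simp add: m_def)
    have c: "c ^ n * (- 1 / c) ^ m = (- 1) ^ m * c ^ j"
    proof -
      have "(- 1 / c) ^ m = (- 1) ^ m / c ^ m" by (rule power_divide)
      then show ?thesis
        unfolding n power_add using nz by simp
    qed
    have N: "(- N) ^ Suc j / (- N) = (- 1) ^ j * N ^ j"
      using nz by (simp add: power_minus[of N])
    have "g (Suc j) = (c ^ n * (- 1 / c) ^ m) * ((- N) ^ Suc j / (- N)) * fact n / fact m *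
            char_bernoulli_sum q (conj_character chi) (Suc j) / (fact (Suc j) * fact (Suc j) * T')"
      by (simp add: g_def m_def mult_ac)
    also have "\<dots> = (- 1) ^ n * ((c * N) ^ j * (fact n / (fact j * fact m)) / (of_nat (Suc j) * fact (Suc j) * T') *
            char_bernoulli_sum q (conj_character chi) (Suc j))"
      unfolding c N using nz by (simp add: n power_add power_mult_distrib divide_simps)
    also have "fact n / (fact j * fact m) = (of_nat (n choose j) :: complex)"
      using j by (simp add: m_def binomial_fact)
    finally show "g (Suc j) = (- 1) ^ n * (of_nat (n choose j) * B_chi q (conj_character chi) j)"
      unfolding B_chi_eq[OF dc' q] c_def[symmetric] N_def[symmetric] T'_def[symmetric]
      by (simp add: mult_ac)
  qed
  finally show ?thesis
    by (simp add: c_def N_def sum_distrib_left)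
qed

end
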